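(* For $\tau=1$ there is a continuum of asymptotically approximate solutions (AAS) of the equation $$1=\frac{S(T,U)}{\ln T},$$ and the structure of the set of these solutions is the following: to each sufficiently large $T_0$ there corresponds a continuum of AAS. That is, for every sufficiently large $T_0>0$ there is a set $A(T_0)$, of the cardinality of the continuum, of pairs $[\tilde T,\tilde U]$ with $$\tilde T\in[T_0,T_0+1.1\,U_0],\qquad \tilde U\in\left(0,T_0^{1/6-\epsilon/2}\right],\qquad U_0=T_0^{1/3+2\epsilon},$$ such that for every choice of pairs $[\tilde T,\tilde U]=[\tilde T(T_0),\tilde U(T_0)]\in A(T_0)$ one has $$\frac{S(\tilde T,\tilde U)}{\ln\tilde T}\sim 1,\qquad T_0\to\infty.$$
   Context: Here $\epsilon>0$ is a fixed sufficiently small number, $d(n)$ is the number of divisors of $n$, and for $T,U>0$, with $P=T/2\pi$, $$S(T,U)=2\sum_{n<P}\frac{d(n)}{\sqrt n}\,\frac{\sin\left(\frac U2\ln\frac Pn\right)}{\frac U2\ln\frac Pn}\cos\left\{\left(2\pi P+\frac U2\right)\ln\frac Pn-2\pi P-\frac\pi4\right\},$$ the sum being over positive integers $n<P$. Definition (AAS). Let $\eta>0$ be a fixed sufficiently small number and $\bar\tau\in[\eta,1-\eta]\cup\{1\}$. Suppose there are a sequence $\{T_0(\bar\tau)\}$, $T_0\to\infty$, and values $\tilde T=\tilde T(T_0,\bar\tau)$, $\tilde U=\tilde U(T_0,\bar\tau)$ with $\tilde T\in[T_0,T_0+1.1U_0]$, $\tilde U\in(0,T_0^{1/6-\epsilon/2}]$,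 where $U_0=T_0^{1/3+2\epsilon}$, such that $\bar\tau\sim S(\tilde T,\tilde U)/\ln\tilde T$ as $T_0\to\infty$. Then the pair $[\tilde T,\tilde U]$ is called an asymptotically approximate solution (AAS) of the equation $\tau=S(T,U)/\ln T$ for $\tau=\bar\tau$. *)

theory Defs
  imports "HOL-Library.Equipollence" "HOL-Library.Landau_Symbols" Complex_Main
begin

definition divisor_count :: "nat \<Rightarrow> nat" where
  "divisor_count n = card {m. m dvd n}"

definition S :: "real \<Rightarrow> real \<Rightarrow> real" where
  "S T U = (let P = T / (2 * pi) in
     2 * (\<Sum>n\<in>{n::nat. 0 < n \<and> real n < P}.
       real (divisor_count n) / sqrt (real n)
       * (sin (U / 2 * ln (P / real n)) / (U / 2 * ln (P / real n)))
       * cos ((2 * pi * P + U / 2) * ln (P / real n) - 2 * pi * P - pi / 4)))"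

definition U0 :: "real \<Rightarrow> real \<Rightarrow> real" where
  "U0 \<epsilon> T0 = T0 powr (1/3 + 2 * \<epsilon>)"

definition admissible_pairs :: "real \<Rightarrow> real \<Rightarrow> (real \<times> real) set" where
  "admissible_pairs \<epsilon> T0 =
     {T0 .. T0 + 1.1 * U0 \<epsilon> T0} \<times> {0 <.. T0 powr (1/6 - \<epsilon> / 2)}"

(* Being an AAS is a property of a whole family of pairs, not of a single pair:
   \<open>T k\<close> and \<open>U k\<close> are the values belonging to the k-th member \<open>T0 k\<close> of the sequence. *)
definition is_AAS ::
  "real \<Rightarrow> real \<Rightarrow> real \<Rightarrow> (nat \<Rightarrow> real) \<Rightarrow> (nat \<Rightarrow> real) \<Rightarrow> (nat \<Rightarrow> real) \<Rightarrow> bool" where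
  "is_AAS \<eta> \<epsilon> \<tau> T0 T U \<longleftrightarrow>
     \<tau> \<in> {\<eta> .. 1 - \<eta>} \<union> {1} \<and>
     (\<forall>k. T0 k > 0) \<and> filterlim T0 at_top sequentially \<and>
     (\<forall>k. (T k, U k) \<in> admissible_pairs \<epsilon> (T0 k)) \<and>
     (\<lambda>_. \<tau>) \<sim>[sequentially] (\<lambda>k. S (T k) (U k) / ln (T k))"

end

theory Submission
  imports Defs "HOL-Complex_Analysis.Complex_Analysis" "HOL-Probability.Distributions"
    "HOL-Real_Asymp.Real_Asymp"
begin

text \<open>
  Write \<open>P = T / (2 pi)\<close> and \<open>s = 1/2 + i T\<close>, and let \<open>N\<close> be the integer with
  \<open>N^2 < P \<le> (N+1)^2\<close>.  As \<open>U\<close> tends to \<open>0\<close> from the right, \<open>S T U\<close> tends to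
  \<open>F(T) = 2 Re (omega \<Sum> d(n) n^(-s))\<close>, the sum being over \<open>n < P\<close> and
  \<open>omega = exp (i (T ln P - T - pi/4))\<close> (\<open>S_tendsto_S_limit\<close>).  The admissible \<open>U\<close> may be as small
  as one likes, so it is enough to find, in every window \<open>[T0, T0 + T0^(1/3)]\<close> with large \<open>T0\<close>, one
  point \<open>T\<close> with \<open>F(T) = ln T0 + O(1)\<close>: by the limit above all sufficiently small \<open>U\<close> then give
  \<open>S T U = ln T0 + O(1)\<close>, and these \<open>U\<close> form an interval.

  To find \<open>T\<close>, compare \<open>F\<close> with the square of the main sum of the Riemann-Siegel formula,
  \<open>Z(T) = 2 Re (exp (i theta(T)) A(T))\<close>, where \<open>A\<close> is the sum of \<open>a^(-s)\<close> over \<open>a \<le> N\<close> and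
  \<open>exp (2 i theta) = omega\<close>.  In fact \<open>F = Z^2 + O(1)\<close> (\<open>S_limit_approx_RS_Z_squared\<close>); this is an
  approximate functional equation for the square of the zeta function, with an error free of
  logarithms.  The hyperbola method reduces it to the partial sums of \<open>b^(-s)\<close> over
  \<open>N < b < P / a\<close>, for \<open>a \<le> N\<close>.  Poisson summation in \<open>b\<close> turns such a sum into integrals of
  \<open>z^(-s) exp (2 pi i j z)\<close>; the \<open>j\<close>-th integrand is stationary at \<open>z = P / j\<close>, which lies in the
  range of summation for \<open>a < j \<le> N\<close> and at its end for \<open>j = a\<close>.  Each stationary point contributes
  \<open>cnj omega * j^(s-1)\<close>, the one at the end half as much, and everything else is \<open>O(N^(-1/2))\<close>
  (\<open>partial_sum_reflection\<close>).  Those errors, weighted by \<open>a^(-1/2)\<close>, add up to \<open>O(1)\<close>, and the main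
  terms reassemble to \<open>Z^2\<close>.  All integrals are handled through a primitive of the integrand on the
  right half-plane, whose increments along suitable segments are bounded or, at a stationary point,
  compared with a Gaussian integral.

  It remains to see that \<open>Z\<close> passes through \<open>sqrt (ln T0)\<close> or \<open>-sqrt (ln T0)\<close> in the window.  On the
  one hand the integral of \<open>Z\<close> over the window is smaller than the length of the window
  (\<open>RS_Z_integral_bound\<close>): the phases \<open>theta(T) - T ln a\<close> have derivative at least \<open>(N - a) / N\<close>, and
  the first derivative test leaves \<open>O(T^(1/4) ln T)\<close>.  So \<open>Z\<close> can stay neither above \<open>2\<close> nor
  below \<open>-2\<close> on the whole window.  On the other hand \<open>\<bar>Z\<bar>\<close> is large somewhere, by resonance
  (\<open>RS_Z_large_value_bound\<close>): if \<open>D\<close> is the sum of \<open>m^(-s)\<close> over \<open>m \<le> M\<close>, with \<open>M\<close> a small power of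
  \<open>T\<close>, the mean of \<open>Z exp (-i theta) \<bar>D\<bar>^2\<close> keeps only the solutions of \<open>a k = m\<close> and is of order
  \<open>(ln M)^2\<close>, while the mean of \<open>\<bar>D\<bar>^2\<close> is of order \<open>ln M\<close>.  Hence \<open>\<bar>Z\<bar>\<close> reaches the order of \<open>ln T\<close>,
  and the intermediate value theorem gives a point with \<open>Z^2 = ln T0\<close>.
\<close>

section \<open>Increments of functions with a bounded derivative\<close>

text \<open>
  Bounding the derivative of \<open>f\<close> by that of \<open>g\<close> replaces the
  estimation of integrals: the path integrals below are increments of primitives, and the
  bounds for their integrands have elementary antiderivatives.
\<close>

lemma norm_diff_le_antiderivative:
  fixes f :: "real \<Rightarrow> ('a::real_normed_vector)" and g :: "real \<Rightarrow> real"
  assumes "a \<le> b"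
    and "\<And>t. t \<in> {a..b} \<Longrightarrow> (f has_vector_derivative f' t) (at t within {a..b})"
    and "\<And>t. t \<in> {a..b} \<Longrightarrow> (g has_real_derivative g' t) (at t within {a..b})"
    and "\<And>t. t \<in> {a..b} \<Longrightarrow> norm (f' t) \<le> g' t"
  shows "norm (f b - f a) \<le> g b - g a"
proof -
  have "continuous_on {a..b} f"
    unfolding continuous_on_eq_continuous_within
    using assms(2) has_vector_derivative_continuous by blast
  moreover have "continuous_on {a..b} g"
    unfolding continuous_on_eq_continuous_within
    using assms(3) DERIV_continuous by blast
  moreover have "(f has_vector_derivative f' t) (at t)" "(g has_vector_derivative g' t) (at t)"
    if "a < t" "t < b" for t
    using assms(2,3)[of t] that
    by (auto simp: at_within_Icc_at has_real_derivative_iff_has_vector_derivative)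
  ultimately show ?thesis
    using differentiable_bound_general[of a b f g f' g'] assms(1,4)
    by (cases "a = b") auto
qed

lemma norm_diff_le_const:
  fixes f :: "real \<Rightarrow> ('a::real_normed_vector)"
  assumes "a \<le> b"
    and "\<And>t. t \<in> {a..b} \<Longrightarrow> (f has_vector_derivative f' t) (at t within {a..b})"
    and "\<And>t. t \<in> {a..b} \<Longrightarrow> norm (f' t) \<le> c"
  shows "norm (f b - f a) \<le> c * (b - a)"
proof -
  have "norm (f b - f a) \<le> c * b - c * a"
    by (rule norm_diff_le_antiderivative[OF assms(1,2), where g' = "\<lambda>_. c"])
       (auto intro!: derivative_eq_intros assms(3))
  thus ?thesis by (simp add: algebra_simps)
qed

section \<open>The terms of the Poisson formula and their primitives\<close>

text \<open>
  This is \<open>z^(-s) exp (2 pi i \<xi> z)\<close> with \<open>s = 1/2 + 2 pi i P\<close>,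
  the term of frequency \<open>\<xi>\<close> in the Poisson formula for the sum of
  \<open>b^(-s)\<close>. Its stationary point is \<open>z = P / \<xi>\<close>.
\<close>

definition kernel :: "real \<Rightarrow> real \<Rightarrow> complex \<Rightarrow> complex" where
  "kernel P \<xi> z = exp (2 * pi * \<i> * \<xi> * z - (1/2 + 2 * pi * \<i> * P) * Ln z)"

text \<open>
  The right half-plane is convex, so a primitive exists there; the value at any one point is
  immaterial because only increments are used.
\<close>

definition primitive :: "real \<Rightarrow> real \<Rightarrow> complex \<Rightarrow> complex" where
  "primitive P \<xi> = (SOME g. \<forall>z. Re z > 0 \<longrightarrow> (g has_field_derivative kernel P \<xi> z) (at z))"

lemma nonpos_Reals_Re_pos: "Re z > 0 \<Longrightarrow> z \<notin> \<real>\<^sub>\<le>\<^sub>0"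
  by (auto simp: complex_nonpos_Reals_iff)

lemma primitive_deriv: 
  assumes "Re z > 0"
  shows "(primitive P \<xi> has_field_derivative kernel P \<xi> z) (at z)"
proof -
  have hol: "kernel P \<xi> holomorphic_on {z. Re z > 0}"
    unfolding kernel_def by (intro holomorphic_intros) (auto simp: nonpos_Reals_Re_pos)
  obtain g where "\<And>x. x \<in> {z. Re z > 0} \<Longrightarrow> (g has_field_derivative kernel P \<xi> x) (at x within {z. Re z > 0})"
    using holomorphic_convex_primitive'[OF convex_halfspace_Re_gt open_halfspace_Re_gt hol] by metis
  hence "\<exists>g. \<forall>z. Re z > 0 \<longrightarrow> (g has_field_derivative kernel P \<xi> z) (at z)"
    by (metis at_within_open mem_Collect_eq open_halfspace_Re_gt)
  from someI_ex[OF this] show ?thesis using assms unfolding primitive_def by blast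
qed

lemma primitive_along_path:
  assumes "Re (\<gamma> t) > 0" "(\<gamma> has_vector_derivative d) (at t within X)"
  shows "((\<lambda>t. primitive P \<xi> (\<gamma> t)) has_vector_derivative (d * kernel P \<xi> (\<gamma> t))) (at t within X)"
  using field_vector_diff_chain_within[OF assms(2), of "primitive P \<xi>" "kernel P \<xi> (\<gamma> t)"]
    has_field_derivative_at_within[OF primitive_deriv[OF assms(1)]]
  by (simp add: o_def)

lemma norm_kernel:
  assumes "Re z > 0"
  shows "norm (kernel P \<xi> z) = exp (2 * pi * (P * arctan (Im z / Re z) - \<xi> * Im z)) / sqrt (norm z)"
proof -
  have z: "z \<noteq> 0" using assms by auto
  have "Im (Ln z) = arctan (Im z / Re z)" using assms Arg_eq_Im_Ln z arg_conv_arctan by metis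
  hence "Re (2 * pi * \<i> * \<xi> * z - (1/2 + 2 * pi * \<i> * P) * Ln z)
      = 2 * pi * (P * arctan (Im z / Re z) - \<xi> * Im z) - ln (sqrt (norm z))"
    using z by (simp add: ln_sqrt algebra_simps)
  hence "norm (kernel P \<xi> z) = exp (2 * pi * (P * arctan (Im z / Re z) - \<xi> * Im z) - ln (sqrt (norm z)))"
    by (simp only: kernel_def norm_exp_eq_Re)
  thus ?thesis using z by (simp add: exp_diff)
qed

lemma kernel_add: "kernel P (\<xi> + real m) z = kernel P \<xi> z * exp (2 * pi * \<i> * z) ^ m"
  unfolding kernel_def exp_of_nat_mult[symmetric] exp_add[symmetric]
  by (rule arg_cong[of _ _ exp]) (simp add: ring_distribs)

lemma kernel_diff: "kernel P (\<xi> - real m) z = kernel P \<xi> z * exp (- 2 * pi * \<i> * z) ^ m"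
  unfolding kernel_def exp_of_nat_mult[symmetric] exp_add[symmetric]
  by (rule arg_cong[of _ _ exp]) (simp add: ring_distribs)

lemma norm_kernel_real:
  assumes "x > 0" shows "norm (kernel P \<xi> (of_real x)) = 1 / sqrt x"
  using assms by (simp add: norm_kernel)

text \<open>
  Going up from \<open>x\<close>, the factor \<open>z^(-s)\<close> grows at most at the rate
  \<open>2 pi P / x\<close> since \<open>arctan v \<le> v\<close>. So the kernel decays along
  this path whenever its stationary point \<open>P / \<xi>\<close> lies to the left of
  \<open>x\<close>.
\<close>

lemma norm_kernel_vertical_le:
  assumes "x > 0" "t \<ge> 0" "P \<ge> 0"
  shows "norm (kernel P \<xi> (Complex x t)) \<le> exp (- (2 * pi * (\<xi> - P / x)) * t) / sqrt x"
proof -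
  have "arctan (t / x) \<le> t / x" using assms by (intro arctan_le_self) auto
  hence "2 * pi * (P * arctan (t / x) - \<xi> * t) \<le> 2 * pi * (P * (t / x) - \<xi> * t)"
    using assms by (intro mult_left_mono diff_right_mono) simp_all
  also have "\<dots> = - (2 * pi * (\<xi> - P / x)) * t" by (simp add: ring_distribs)
  finally have 1: "exp (2 * pi * (P * arctan (t / x) - \<xi> * t)) \<le> exp (- (2 * pi * (\<xi> - P / x)) * t)"
    by (rule iffD2[OF exp_le_cancel_iff])
  have 2: "x \<le> cmod (Complex x t)" using complex_Re_le_cmod[of "Complex x t"] by simp
  have "exp (2 * pi * (P * arctan (t / x) - \<xi> * t)) / sqrt (cmod (Complex x t)) \<le> exp (- (2 * pi * (\<xi> - P / x)) * t) / sqrt x"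
    by (rule frac_le[OF _ 1 _ real_sqrt_le_mono[OF 2]]) (use assms(1) in simp_all)
  moreover have "norm (kernel P \<xi> (Complex x t)) = exp (2 * pi * (P * arctan (t / x) - \<xi> * t)) / sqrt (cmod (Complex x t))"
    using norm_kernel[of "Complex x t" P \<xi>] assms(1) unfolding complex.sel .
  ultimately show ?thesis by linarith
qed
text \<open>
  The argument of \<open>z\<close> never exceeds \<open>pi / 2\<close>, so far above the real
  axis the kernel is negligible without regard to its stationary point.
\<close>

lemma norm_kernel_high_le:
  assumes "x > 0" "P \<ge> 0"
  shows "norm (kernel P \<xi> (Complex x y)) \<le> exp (pi\<^sup>2 * P - 2 * pi * \<xi> * y) / sqrt x"
proof -
  have "arctan (y / x) \<le> pi/2" using arctan_ubound[of "y/x"] by simp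
  hence "2 * pi * (P * arctan (y / x) - \<xi> * y) \<le> 2 * pi * (P * (pi / 2) - \<xi> * y)"
    using assms by (intro mult_left_mono diff_right_mono) simp_all
  also have "\<dots> = pi\<^sup>2 * P - 2 * pi * \<xi> * y" by (simp add: ring_distribs power2_eq_square)
  finally have 1: "exp (2 * pi * (P * arctan (y / x) - \<xi> * y)) \<le> exp (pi\<^sup>2 * P - 2 * pi * \<xi> * y)"
    by (rule iffD2[OF exp_le_cancel_iff])
  have 2: "x \<le> cmod (Complex x y)" using complex_Re_le_cmod[of "Complex x y"] by simp
  have "exp (2 * pi * (P * arctan (y / x) - \<xi> * y)) / sqrt (cmod (Complex x y)) \<le> exp (pi\<^sup>2 * P - 2 * pi * \<xi> * y) / sqrt x"
    by (rule frac_le[OF _ 1 _ real_sqrt_le_mono[OF 2]]) (use assms(1) in simp_all)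
  moreover have "norm (kernel P \<xi> (Complex x y)) = exp (2 * pi * (P * arctan (y / x) - \<xi> * y)) / sqrt (cmod (Complex x y))"
    using norm_kernel[of "Complex x y" P \<xi>] assms(1) unfolding complex.sel .
  ultimately show ?thesis by linarith
qed

text \<open>
  Below the real axis a vertical path is of no use, because the argument of \<open>x - i
  t\<close> is concave in \<open>t\<close>. Along the diagonal \<open>x (1 - \<tau> - i
  \<tau>)\<close> the argument decreases at least as fast as \<open>\<tau>\<close> grows, which
  is what is needed.
\<close>

lemma arctan_slope:
  assumes "0 \<le> \<tau>" "\<tau> \<le> 1/2"
  shows "\<tau> \<le> arctan (\<tau> / (1 - \<tau>))"
proof -
  have "(\<lambda>x. arctan (x / (1 - x)) - x) 0 \<le> (\<lambda>x. arctan (x / (1 - x)) - x) \<tau>"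
  proof (rule DERIV_nonneg_imp_nondecreasing[OF assms(1)])
    fix x :: real assume x: "0 \<le> x" "x \<le> \<tau>"
    hence x1: "x < 1" using assms by auto
    have "((\<lambda>x. arctan (x / (1 - x)) - x) has_real_derivative
        inverse (1 + (x / (1 - x))\<^sup>2) * ((1 * (1 - x) - x * (- 1)) / ((1 - x) * (1 - x))) - 1) (at x)"
      using x1 by (auto intro!: derivative_eq_intros)
    moreover have "inverse (1 + (x / (1 - x))\<^sup>2) * ((1 * (1 - x) - x * (- 1)) / ((1 - x) * (1 - x))) - 1
       = 1 / ((1-x)\<^sup>2 + x\<^sup>2) - 1"
    proof -
      have "1 + (x / (1 - x))\<^sup>2 = ((1-x)\<^sup>2 + x\<^sup>2) / (1-x)\<^sup>2" using x1 by (simp add: field_simps)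
      thus ?thesis using x1 by (simp add: power2_eq_square)
    qed
    moreover have "1 / ((1-x)\<^sup>2 + x\<^sup>2) - 1 \<ge> 0"
    proof -
      have "(1-x)\<^sup>2 + x\<^sup>2 = 1 - 2 * x * (1 - x)" by (simp add: power2_eq_square algebra_simps)
      hence "(1-x)\<^sup>2 + x\<^sup>2 \<le> 1" using x x1 by simp
      moreover have "(1-x)\<^sup>2 + x\<^sup>2 > 0" using x1 by (intro add_pos_nonneg) auto
      ultimately show ?thesis by simp
    qed
    ultimately show "\<exists>y. ((\<lambda>x. arctan (x / (1 - x)) - x) has_real_derivative y) (at x) \<and> 0 \<le> y"
      by auto
  qed
  thus ?thesis by simp
qed

text \<open>
  Going down to the left from \<open>x\<close>, the kernel decays whenever its stationary point
  \<open>P / \<xi>\<close> lies to the right of \<open>x\<close>. The path ends on the ray of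
  argument \<open>- pi / 4\<close>.
\<close>

lemma norm_kernel_diagonal_le:
  assumes "x > 0" "0 \<le> t" "t \<le> x / 2" "P \<ge> 0"
  shows "norm (kernel P \<xi> (Complex (x - t) (- t))) \<le> 2 * exp (- (2 * pi * (P / x - \<xi>)) * t) / sqrt x"
proof -
  define \<tau> where "\<tau> = t / x"
  have \<tau>: "0 \<le> \<tau>" "\<tau> \<le> 1/2" "t = \<tau> * x" using assms by (auto simp: \<tau>_def field_simps)
  have "\<tau> / (1 - \<tau>) = t / (x - t)" using assms by (simp add: \<tau>_def field_simps)
  hence "arctan (t / (x - t)) \<ge> t / x" using arctan_slope[OF \<tau>(1,2)] by (metis \<tau>_def)
  hence "2 * pi * (P * (- arctan (t / (x - t))) - \<xi> * (- t)) \<le> 2 * pi * (P * (- (t / x)) - \<xi> * (- t))"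
    using assms by (intro mult_left_mono diff_right_mono) simp_all
  also have "\<dots> = - (2 * pi * (P / x - \<xi>)) * t" by (simp add: algebra_simps)
  finally have 1: "exp (2 * pi * (P * (- arctan (t / (x - t))) - \<xi> * (- t))) \<le> exp (- (2 * pi * (P / x - \<xi>)) * t)"
    by (rule iffD2[OF exp_le_cancel_iff])
  have "(x/2)\<^sup>2 \<le> (x - t)\<^sup>2 " using assms by (intro power_mono) auto
  hence "(x/2) \<le> cmod (Complex (x - t) (- t))"
    unfolding cmod_def by (intro real_le_rsqrt) (simp add: add_increasing2)
  hence "sqrt (x / 4) \<le> sqrt (cmod (Complex (x - t) (- t)))" using assms by auto
  hence 2: "sqrt x / 2 \<le> sqrt (cmod (Complex (x - t) (- t)))" by (simp add: real_sqrt_divide)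
  have "norm (kernel P \<xi> (Complex (x - t) (- t))) = 
     exp (2 * pi * (P * (- arctan (t / (x - t))) - \<xi> * (- t))) / sqrt (cmod (Complex (x - t) (- t)))"
    using norm_kernel[of "Complex (x - t) (- t)" P \<xi>] assms unfolding complex.sel
    by (simp add: arctan_minus)
  also have "\<dots> \<le> exp (- (2 * pi * (P / x - \<xi>)) * t) / (sqrt x / 2)"
    by (rule frac_le[OF _ 1 _ 2]) (use assms(1) in simp_all)
  finally show ?thesis by (simp add: field_simps)
qed

text \<open>
  The exponent is negative, of order \<open>P\<close>, as long as \<open>\<xi> r \<le>
  P\<close>, because \<open>pi < pi^2 / 2\<close>. This makes the ray a common place to end
  paths that come from different points of the real axis.
\<close>

lemma norm_kernel_ray_le:
  assumes "r \<ge> 1"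
  shows "norm (kernel P \<xi> (Complex (r/2) (-r/2))) \<le> 2 * exp (pi * \<xi> * r - pi\<^sup>2 * P / 2)"
proof -
  have "1/4 \<le> r / 2" using assms by simp
  also have "r / 2 \<le> cmod (Complex (r/2) (-r/2))" using complex_Re_le_cmod[of "Complex (r/2) (-r/2)"] by simp
  finally have "sqrt (1/4) \<le> sqrt (cmod (Complex (r/2) (-r/2)))" by auto
  hence 2: "1/2 \<le> sqrt (cmod (Complex (r/2) (-r/2)))" by (simp add: real_sqrt_divide)
  have "norm (kernel P \<xi> (Complex (r/2) (-r/2))) = exp (pi * \<xi> * r - pi\<^sup>2 * P / 2) / sqrt (cmod (Complex (r/2) (-r/2)))"
    using assms by (subst norm_kernel) (auto simp: arctan_minus arctan_one power2_eq_square algebra_simps)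
  also have "\<dots> \<le> exp (pi * \<xi> * r - pi\<^sup>2 * P / 2) / (1/2)"
    using 2 by (intro divide_left_mono) auto
  finally show ?thesis by (simp add: field_simps)
qed


section \<open>Paths away from the stationary points\<close>

text \<open>
  Consecutive frequencies differ by the factor \<open>exp (2 pi i z)\<close>, so sums over
  frequencies are geometric. The bound does not depend on the number of terms, which makes the
  later passage to infinitely many frequencies possible.
\<close>

lemma norm_geometric_sum_le:
  fixes q :: complex
  assumes "norm q \<le> 1" "norm (1 - q) \<ge> 1/2"
  shows "norm (\<Sum>i<n. q ^ i) \<le> 4"
proof -
  have "q \<noteq> 1" using assms by auto
  hence "norm (\<Sum>i<n. q ^ i) = norm (1 - q ^ n) / norm (1 - q)"
    by (subst sum_gp_strict) (auto simp: norm_divide)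
  also have "\<dots> \<le> 2 / (1/2)"
  proof (rule frac_le[OF _ _ _ assms(2)])
    show "norm (1 - q ^ n) \<le> 2"
      using norm_triangle_ineq4[of 1 "q ^ n"] power_le_one[OF norm_ge_zero assms(1), of n]
      by (simp add: norm_power)
  qed auto
  finally show ?thesis by simp
qed

lemma norm_sum_kernel_add_le:
  assumes "norm (exp (2 * pi * \<i> * z)) \<le> 1" "norm (1 - exp (2 * pi * \<i> * z)) \<ge> 1/2"
  shows "norm (\<Sum>i<n. kernel P (\<xi> + real i) z) \<le> 4 * norm (kernel P \<xi> z)"
proof -
  have "(\<Sum>i<n. kernel P (\<xi> + real i) z) = kernel P \<xi> z * (\<Sum>i<n. exp (2 * pi * \<i> * z) ^ i)"
    by (simp add: kernel_add sum_distrib_left)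
  moreover have "norm (kernel P \<xi> z) * norm (\<Sum>i<n. exp (2 * pi * \<i> * z) ^ i) \<le> norm (kernel P \<xi> z) * 4"
    by (intro mult_left_mono norm_geometric_sum_le[OF assms]) simp
  ultimately show ?thesis by (simp only: norm_mult mult.commute)
qed

lemma norm_sum_kernel_diff_le:
  assumes "norm (exp (- 2 * pi * \<i> * z)) \<le> 1" "norm (1 - exp (- 2 * pi * \<i> * z)) \<ge> 1/2"
  shows "norm (\<Sum>i<n. kernel P (\<xi> - real i) z) \<le> 4 * norm (kernel P \<xi> z)"
proof -
  have "(\<Sum>i<n. kernel P (\<xi> - real i) z) = kernel P \<xi> z * (\<Sum>i<n. exp (- 2 * pi * \<i> * z) ^ i)"
    by (simp add: kernel_diff sum_distrib_left)
  moreover have "norm (kernel P \<xi> z) * norm (\<Sum>i<n. exp (- 2 * pi * \<i> * z) ^ i) \<le> norm (kernel P \<xi> z) * 4"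
    by (intro mult_left_mono norm_geometric_sum_le[OF assms]) simp
  ultimately show ?thesis by (simp only: norm_mult mult.commute)
qed

text \<open>
  The reason for cutting the sums at half-integers: there consecutive frequencies have opposite
  signs, the ratio of the geometric sums stays away from \<open>1\<close>, and no logarithms
  arise.
\<close>

lemma exp_half_integer:
  assumes "x = real b + 1/2"
  shows "exp (2 * pi * \<i> * x) = - 1" "exp (- 2 * pi * \<i> * x) = - 1"
proof -
  have *: "exp (pi * \<i> * of_nat b) * exp (pi * \<i> * of_nat b) = 1"
    unfolding exp_add[symmetric] using exp_2pi_1_nat[of b] by (simp add: algebra_simps)
  have "exp (2 * pi * \<i> * x) = exp (pi * \<i> * of_nat b) * exp (pi * \<i> * of_nat b) * exp (pi * \<i>)"
    unfolding exp_add[symmetric] assms by (rule arg_cong[of _ _ exp]) (simp add: algebra_simps)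
  thus "exp (2 * pi * \<i> * x) = - 1" using * by simp
  thus "exp (- 2 * pi * \<i> * x) = - 1" using exp_minus[of "2 * pi * \<i> * x"] by simp
qed

text \<open>
  All frequencies \<open>m, m + 1, ...\<close> whose stationary points lie to the left of
  \<open>x\<close> are treated together; the kernel of lowest frequency dominates the geometric
  sum.
\<close>

lemma upper_tail:
  assumes x: "x = real b + 1/2" and P: "P \<ge> 0" and m: "P / x < m" and Y: "Y \<ge> 0"
  shows "norm (\<Sum>i<n. primitive P (m + real i) (Complex x Y) - primitive P (m + real i) (of_real x))
           \<le> 4 / (2 * pi * (m - P / x) * sqrt x)"
proof -
  define k where "k = 2 * pi * (m - P / x)"
  have k: "k > 0" using m by (simp add: k_def)
  have x0: "x > 0" using x by simp
  define F where "F = (\<lambda>t. \<Sum>i<n. primitive P (m + real i) (Complex x t))"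
  have "norm (F Y - F 0) \<le> (\<lambda>t. - (4 / (k * sqrt x)) * exp (- k * t)) Y - (\<lambda>t. - (4 / (k * sqrt x)) * exp (- k * t)) 0"
  proof (rule norm_diff_le_antiderivative[OF Y])
    fix t assume t: "t \<in> {0..Y}"
    have "((\<lambda>t. Complex x t) has_vector_derivative \<i>) (at t within {0..Y})"
      unfolding Complex_eq by (auto intro!: derivative_eq_intros)
    thus "(F has_vector_derivative (\<Sum>i<n. \<i> * kernel P (m + real i) (Complex x t))) (at t within {0..Y})"
      unfolding F_def using x0 by (intro has_vector_derivative_sum primitive_along_path) auto
    show "((\<lambda>t. - (4 / (k * sqrt x)) * exp (- k * t)) has_real_derivative 4 * (exp (- k * t) / sqrt x)) (at t within {0..Y})"
      using k x0 by (auto intro!: derivative_eq_intros simp: field_simps)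
    define q where "q = exp (2 * pi * \<i> * Complex x t)"
    have "q = exp (2 * pi * \<i> * x) * exp (- 2 * pi * t)"
      unfolding q_def exp_add[symmetric] exp_of_real[symmetric] by (rule arg_cong[of _ _ exp]) (simp add: Complex_eq algebra_simps)
    hence q: "q = - of_real (exp (- 2 * pi * t))" using exp_half_integer(1)[OF x] by simp
    have "norm (1 - q) = 1 + exp (- 2 * pi * t)"
      unfolding q by (metis add_pos_pos diff_minus_eq_add exp_gt_zero norm_of_real of_real_1 of_real_add zero_less_one abs_of_pos)
    hence "norm (1 - q) \<ge> 1/2" by (simp add: add_increasing2)
    moreover have "norm q \<le> 1" unfolding q using t by simp
    ultimately have "norm (\<Sum>i<n. kernel P (m + real i) (Complex x t)) \<le> 4 * norm (kernel P m (Complex x t))"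
      unfolding q_def by (intro norm_sum_kernel_add_le)
    also have "\<dots> \<le> 4 * (exp (- k * t) / sqrt x)"
      unfolding k_def by (intro mult_left_mono norm_kernel_vertical_le) (use x0 t P in auto)
    finally show "norm (\<Sum>i<n. \<i> * kernel P (m + real i) (Complex x t)) \<le> 4 * (exp (- k * t) / sqrt x)"
      by (simp add: sum_distrib_left[symmetric] norm_mult)
  qed
  also have "\<dots> \<le> 4 / (k * sqrt x)" using k x0 by simp
  also have "F Y - F 0 = (\<Sum>i<n. primitive P (m + real i) (Complex x Y) - primitive P (m + real i) (of_real x))"
    unfolding F_def by (simp add: sum_subtractf complex_of_real_def)
  finally show ?thesis by (simp add: k_def)
qed

text \<open>
  The counterpart of \<open>upper_tail\<close> for the frequencies \<open>m, m - 1,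
  ...\<close>, including the negative ones, whose stationary points do not lie on
  \<open>{0..x}\<close>.
\<close>

lemma lower_tail:
  assumes x: "x = real b + 1/2" and P: "P \<ge> 0" and m: "m < P / x"
  shows "norm (\<Sum>i<n. primitive P (m - real i) (of_real x) - primitive P (m - real i) (Complex (x/2) (-x/2)))
           \<le> 16 / (2 * pi * (P / x - m) * sqrt x)"
proof -
  define k where "k = 2 * pi * (P / x - m)"
  have k: "k > 0" using m by (simp add: k_def)
  have x0: "x > 0" using x by simp
  define F where "F = (\<lambda>t. \<Sum>i<n. primitive P (m - real i) (Complex (x - t) (- t)))"
  have "norm (F (x/2) - F 0) \<le> (\<lambda>t. - (16 / (k * sqrt x)) * exp (- k * t)) (x/2) - (\<lambda>t. - (16 / (k * sqrt x)) * exp (- k * t)) 0"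
  proof (rule norm_diff_le_antiderivative)
    show "0 \<le> x / 2" using x0 by simp
    fix t assume t: "t \<in> {0..x/2}"
    have "((\<lambda>t. Complex (x - t) (- t)) has_vector_derivative (- 1 - \<i>)) (at t within {0..x/2})"
      unfolding Complex_eq by (auto intro!: derivative_eq_intros)
    thus "(F has_vector_derivative (\<Sum>i<n. (- 1 - \<i>) * kernel P (m - real i) (Complex (x - t) (- t)))) (at t within {0..x/2})"
      unfolding F_def using x0 t by (intro has_vector_derivative_sum primitive_along_path) auto
    show "((\<lambda>t. - (16 / (k * sqrt x)) * exp (- k * t)) has_real_derivative 16 * (exp (- k * t) / sqrt x)) (at t within {0..x/2})"
      using k x0 by (auto intro!: derivative_eq_intros simp: field_simps)
    define q where "q = exp (- 2 * pi * \<i> * Complex (x - t) (- t))"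
    have "q = exp (- 2 * pi * \<i> * x) * (exp (- 2 * pi * t) * cis (2 * pi * t))"
      unfolding q_def exp_add[symmetric] exp_of_real[symmetric] cis_conv_exp
      by (rule arg_cong[of _ _ exp]) (simp add: Complex_eq algebra_simps)
    hence q: "q = - (of_real (exp (- 2 * pi * t)) * cis (2 * pi * t))" using exp_half_integer(2)[OF x] by simp
    hence nq: "norm q = exp (- 2 * pi * t)" by (simp add: norm_mult)
    hence nq1: "norm q \<le> 1" using t by simp
    have "norm (1 - q) \<ge> 1/2"
    proof (cases "t \<le> 1/4")
      case True
      hence "cos (2 * pi * t) \<ge> 0" using t by (intro cos_ge_zero) (auto intro: order_trans[of _ 0])
      hence "Re (1 - q) \<ge> 1" unfolding q by simp
      thus ?thesis using complex_Re_le_cmod[of "1 - q"] by linarith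
    next
      case False
      hence "pi * (1/4) \<le> pi * t" by (intro mult_left_mono) auto
      hence "2 * pi * t \<ge> 1" using pi_gt3 by linarith
      have "2 \<le> exp (1::real)" using exp_ge_add_one_self[of 1] by simp
      also have "\<dots> \<le> exp (2 * pi * t)" using \<open>2 * pi * t \<ge> 1\<close> by simp
      finally have "exp (- 2 * pi * t) \<le> 1/2" by (simp add: exp_minus field_simps)
      hence "norm q \<le> 1/2" using nq by simp
      thus ?thesis using norm_triangle_ineq2[of 1 q] by simp
    qed
    hence "norm (\<Sum>i<n. kernel P (m - real i) (Complex (x - t) (- t))) \<le> 4 * norm (kernel P m (Complex (x - t) (- t)))"
      using nq1 unfolding q_def by (intro norm_sum_kernel_diff_le)
    also have "\<dots> \<le> 4 * (2 * exp (- k * t) / sqrt x)"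
      unfolding k_def by (intro mult_left_mono norm_kernel_diagonal_le) (use x0 t P in auto)
    finally have 1: "norm (\<Sum>i<n. kernel P (m - real i) (Complex (x - t) (- t))) \<le> 8 * (exp (- k * t) / sqrt x)" by simp
    have "norm (- 1 - \<i>) \<le> 2" using norm_triangle_ineq4[of "-1" \<i>] by simp
    hence "norm (- 1 - \<i>) * norm (\<Sum>i<n. kernel P (m - real i) (Complex (x - t) (- t))) \<le> 2 * (8 * (exp (- k * t) / sqrt x))"
      using 1 by (intro mult_mono) auto
    thus "norm (\<Sum>i<n. (- 1 - \<i>) * kernel P (m - real i) (Complex (x - t) (- t))) \<le> 16 * (exp (- k * t) / sqrt x)"
      by (simp add: sum_distrib_left[symmetric] norm_mult)
  qed
  also have "\<dots> \<le> 16 / (k * sqrt x)" using k x0 by simp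
  also have "F (x/2) - F 0 = - (\<Sum>i<n. primitive P (m - real i) (of_real x) - primitive P (m - real i) (Complex (x/2) (-x/2)))"
    unfolding F_def by (simp add: sum_subtractf complex_of_real_def)
  finally show ?thesis by (simp add: k_def)
qed

text \<open>
  The height \<open>2 P\<close> is large enough for the kernels of frequency at least
  \<open>1\<close> to be exponentially small there: \<open>pi^2 < 4 pi\<close>.
\<close>

lemma upper_connection:
  assumes P: "P \<ge> 1" and m: "m \<ge> 1" and x: "x1 \<ge> 1" "x1 \<le> x2"
  shows "norm (\<Sum>i<n. primitive P (m + real i) (Complex x2 (2 * P)) - primitive P (m + real i) (Complex x1 (2 * P)))
           \<le> 4 * exp (- 2 * P) * (x2 - x1)"
proof -
  define F where "F = (\<lambda>x. \<Sum>i<n. primitive P (m + real i) (Complex x (2 * P)))"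
  have "norm (F x2 - F x1) \<le> 4 * exp (- 2 * P) * (x2 - x1)"
  proof (rule norm_diff_le_const[OF x(2)])
    fix t assume t: "t \<in> {x1..x2}"
    have "((\<lambda>t. Complex t (2 * P)) has_vector_derivative 1) (at t within {x1..x2})"
      unfolding Complex_eq by (auto intro!: derivative_eq_intros)
    thus "(F has_vector_derivative (\<Sum>i<n. 1 * kernel P (m + real i) (Complex t (2 * P)))) (at t within {x1..x2})"
      unfolding F_def using t x by (intro has_vector_derivative_sum primitive_along_path) auto
    define q where "q = exp (2 * pi * \<i> * Complex t (2 * P))"
    have "pi * P \<ge> 3 * 1" using P pi_gt3 by (intro mult_mono) auto
    hence "exp (4 * pi * P) \<ge> 2" using exp_ge_add_one_self[of "4 * pi * P"] by linarith
    hence nq: "norm q \<le> 1/2" unfolding q_def norm_exp_eq_Re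
      by (simp add: exp_minus field_simps)
    hence "norm (1 - q) \<ge> 1/2" using norm_triangle_ineq2[of 1 q] by simp
    hence "norm (\<Sum>i<n. kernel P (m + real i) (Complex t (2 * P))) \<le> 4 * norm (kernel P m (Complex t (2 * P)))"
      using nq unfolding q_def by (intro norm_sum_kernel_add_le) linarith+
    also have "\<dots> \<le> 4 * (exp (pi\<^sup>2 * P - 2 * pi * m * (2 * P)) / sqrt t)"
      by (intro mult_left_mono norm_kernel_high_le) (use t x P in auto)
    also have "\<dots> \<le> 4 * exp (- 2 * P)"
    proof -
      have "pi * (4 * m - pi) \<ge> 3 * (2/3)" 
        using m pi_gt3 pi_approx by (intro mult_mono) auto
      hence "2 * P \<le> (pi * (4 * m - pi)) * P" using P by (intro mult_right_mono) auto
      hence "pi\<^sup>2 * P - 2 * pi * m * (2 * P) \<le> - 2 * P" by (simp add: algebra_simps power2_eq_square)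
      hence "exp (pi\<^sup>2 * P - 2 * pi * m * (2 * P)) \<le> exp (- 2 * P)" by (rule iffD2[OF exp_le_cancel_iff])
      moreover have "1 \<le> sqrt t" using t x by auto
      ultimately have "exp (pi\<^sup>2 * P - 2 * pi * m * (2 * P)) / sqrt t \<le> exp (- 2 * P) / 1"
        by (intro frac_le) auto
      thus ?thesis by linarith
    qed
    finally show "norm (\<Sum>i<n. 1 * kernel P (m + real i) (Complex t (2 * P))) \<le> 4 * exp (- 2 * P)" by simp
  qed
  thus ?thesis unfolding F_def by (simp add: sum_subtractf)
qed

lemma ray_connection:
  assumes P: "P \<ge> 0" and m: "m \<ge> 0" and r: "r1 \<ge> 1" "r1 \<le> r2" "m * r2 \<le> P"
  shows "norm (\<Sum>i<n. primitive P (m - real i) (Complex (r2/2) (-r2/2)) - primitive P (m - real i) (Complex (r1/2) (-r1/2)))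
           \<le> 8 * exp (- P) * (r2 - r1)"
proof -
  define F where "F = (\<lambda>x. \<Sum>i<n. primitive P (m - real i) (Complex (x/2) (-x/2)))"
  have "norm (F r2 - F r1) \<le> 8 * exp (- P) * (r2 - r1)"
  proof (rule norm_diff_le_const[OF r(2)])
    fix t assume t: "t \<in> {r1..r2}"
    have "((\<lambda>t. Complex (t/2) (- t/2)) has_vector_derivative (1/2 - \<i>/2)) (at t within {r1..r2})"
      unfolding Complex_eq by (auto intro!: derivative_eq_intros)
    thus "(F has_vector_derivative (\<Sum>i<n. (1/2 - \<i>/2) * kernel P (m - real i) (Complex (t/2) (- t/2)))) (at t within {r1..r2})"
      unfolding F_def using t r by (intro has_vector_derivative_sum primitive_along_path) auto
    define q where "q = exp (- 2 * pi * \<i> * Complex (t/2) (- t/2))"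
    have "pi * t \<ge> 3 * 1" using t r pi_gt3 by (intro mult_mono) auto
    hence "exp (pi * t) \<ge> 2" using exp_ge_add_one_self[of "pi * t"] by linarith
    hence nq: "norm q \<le> 1/2" unfolding q_def norm_exp_eq_Re
      by (simp add: exp_minus field_simps)
    hence "norm (1 - q) \<ge> 1/2" using norm_triangle_ineq2[of 1 q] by simp
    hence "norm (\<Sum>i<n. kernel P (m - real i) (Complex (t/2) (- t/2))) \<le> 4 * norm (kernel P m (Complex (t/2) (- t/2)))"
      using nq unfolding q_def by (intro norm_sum_kernel_diff_le) linarith+
    also have "\<dots> \<le> 4 * (2 * exp (pi * m * t - pi\<^sup>2 * P / 2))"
      by (intro mult_left_mono norm_kernel_ray_le) (use t r P in auto)
    also have "\<dots> \<le> 8 * exp (- P)"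
    proof -
      have "m * t \<le> m * r2" using t m by (intro mult_left_mono) auto
      hence "pi * (m * t) \<le> pi * P" using r by (intro mult_left_mono[OF _ pi_ge_zero]) linarith
      moreover have "pi * (pi / 2 - 1) \<ge> 3 * (1/3)" 
        using pi_gt3 pi_approx by (intro mult_mono) auto
      hence "1 * P \<le> (pi * (pi / 2 - 1)) * P" using P by (intro mult_right_mono) auto
      moreover have "pi * m * t - pi\<^sup>2 * P / 2 = pi * (m * t) - pi * P - (pi * (pi / 2 - 1)) * P"
        by (simp add: algebra_simps power2_eq_square)
      ultimately have "pi * m * t - pi\<^sup>2 * P / 2 \<le> - P" by linarith
      hence "exp (pi * m * t - pi\<^sup>2 * P / 2) \<le> exp (- P)" by (rule iffD2[OF exp_le_cancel_iff])
      thus ?thesis by linarith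
    qed
    finally have 1: "norm (\<Sum>i<n. kernel P (m - real i) (Complex (t/2) (- t/2))) \<le> 8 * exp (- P)" .
    have "norm (1/2 - \<i>/2) \<le> 1" using norm_triangle_ineq4[of "1/2" "\<i>/2"] by (simp add: norm_divide)
    hence "norm (1/2 - \<i>/2) * norm (\<Sum>i<n. kernel P (m - real i) (Complex (t/2) (- t/2))) \<le> 1 * (8 * exp (- P))"
      using 1 by (intro mult_mono) auto
    thus "norm (\<Sum>i<n. (1/2 - \<i>/2) * kernel P (m - real i) (Complex (t/2) (- t/2))) \<le> 8 * exp (- P)"
      by (simp add: sum_distrib_left[symmetric] norm_mult)
  qed
  thus ?thesis unfolding F_def by (simp add: sum_subtractf)
qed

section \<open>The contribution of a stationary point\<close>

definition gauss_int :: "real \<Rightarrow> real" where "gauss_int x = integral {0..x} (\<lambda>t. exp (- t\<^sup>2))"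

lemma gauss_int_deriv: 
  assumes "x \<ge> 0" shows "(gauss_int has_real_derivative exp (- x\<^sup>2)) (at x within {0..})"
proof -
  have "((\<lambda>u. integral {0..u} (\<lambda>t. exp (- t\<^sup>2))) has_vector_derivative exp (- x\<^sup>2)) (at x within {0..x+1})"
    by (rule integral_has_vector_derivative) (auto intro!: continuous_intros assms)
  hence "(gauss_int has_real_derivative exp (- x\<^sup>2)) (at x within {0..x+1})"
    unfolding gauss_int_def has_real_derivative_iff_has_vector_derivative .
  moreover have "at x within {0..x+1} = at x within {0..}"
    by (rule at_within_nhd[of _ "{..<x+1}"]) (use assms in auto)
  ultimately show ?thesis by simp
qed

lemma gauss_int_limit: "(gauss_int \<longlongrightarrow> sqrt pi / 2) at_top"
proof -
  have b: "has_bochner_integral lborel (\<lambda>x. indicator {0..} x *\<^sub>R exp (- x\<^sup>2)) (sqrt pi / 2)"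
    by (rule gaussian_moment_0)
  hence "set_integrable lborel {0..} (\<lambda>x::real. exp (- x\<^sup>2))"
    unfolding set_integrable_def using has_bochner_integral_iff by blast
  moreover have "(LBINT x:{0..}. exp (- x\<^sup>2)) = sqrt pi / 2"
    using b unfolding set_lebesgue_integral_def by (rule has_bochner_integral_integral_eq)
  ultimately have "((\<lambda>b::real. LBINT x:{0..b}. exp (- x\<^sup>2)) \<longlongrightarrow> sqrt pi / 2) at_top"
    using tendsto_set_lebesgue_integral_at_top[of 0 lborel "\<lambda>x. exp (- x\<^sup>2)"] by (simp only:) simp
  moreover have "(LBINT x:{0..b}. exp (- x\<^sup>2)) = gauss_int b" for b :: real
    unfolding gauss_int_def
    by (intro set_borel_integral_eq_integral)
       (auto intro!: borel_integrable_atLeastAtMost' continuous_intros)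
  ultimately show ?thesis by simp
qed

text \<open>
  On \<open>{b..}\<close> the factor \<open>t / b\<close> is at least \<open>1\<close>, and
  \<open>t exp (- t^2)\<close> has an explicit antiderivative.
\<close>

lemma gauss_int_tail:
  assumes "b > 0"
  shows "\<bar>gauss_int b - sqrt pi / 2\<bar> \<le> exp (- b\<^sup>2) / (2 * b)"
proof -
  have 1: "norm (gauss_int s - gauss_int b) \<le> exp (- b\<^sup>2) / (2 * b)" if s: "s \<ge> b" for s
  proof -
    have "norm (gauss_int s - gauss_int b) \<le> (\<lambda>x. - exp (- x\<^sup>2) / (2 * b)) s - (\<lambda>x. - exp (- x\<^sup>2) / (2 * b)) b"
    proof (rule norm_diff_le_antiderivative[OF s])
      fix t assume t: "t \<in> {b..s}"
      have "(gauss_int has_real_derivative exp (- t\<^sup>2)) (at t within {b..s})"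
        by (rule DERIV_subset[OF gauss_int_deriv]) (use t assms in auto)
      thus "(gauss_int has_vector_derivative exp (- t\<^sup>2)) (at t within {b..s})"
        by (simp add: has_real_derivative_iff_has_vector_derivative)
      show "((\<lambda>x. - exp (- x\<^sup>2) / (2 * b)) has_real_derivative (t / b) * exp (- t\<^sup>2)) (at t within {b..s})"
        using assms by (auto intro!: derivative_eq_intros simp: field_simps)
      show "norm (exp (- t\<^sup>2)) \<le> t / b * exp (- t\<^sup>2)"
        using t assms by (simp add: field_simps)
    qed
    also have "\<dots> \<le> exp (- b\<^sup>2) / (2 * b)" using assms by simp
    finally show ?thesis .
  qed
  have "((\<lambda>s. norm (gauss_int s - gauss_int b)) \<longlongrightarrow> norm (sqrt pi / 2 - gauss_int b)) at_top"
    by (intro tendsto_intros gauss_int_limit)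
  moreover have "eventually (\<lambda>s. norm (gauss_int s - gauss_int b) \<le> exp (- b\<^sup>2) / (2 * b)) at_top"
    using 1 unfolding eventually_at_top_linorder by blast
  ultimately have "norm (sqrt pi / 2 - gauss_int b) \<le> exp (- b\<^sup>2) / (2 * b)"
    by (rule tendsto_upperbound) simp
  thus ?thesis by (simp add: abs_minus_commute)
qed


lemma norm_exp_diff_le:
  fixes a b :: complex
  assumes "norm (exp a) \<le> M" "norm (exp b) \<le> M"
  shows "norm (exp a - exp b) \<le> norm (a - b) * M"
proof -
  define f where "f = (\<lambda>t. exp (b + of_real t * (a - b)))"
  have "norm (f 1 - f 0) \<le> norm (a - b) * M * (1 - 0)"
  proof (rule norm_diff_le_const)
    fix t :: real assume t: "t \<in> {0..1}"
    show "(f has_vector_derivative ((a - b) * f t)) (at t within {0..1})"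
      unfolding f_def by (rule has_vector_derivative_eq_rhs, rule field_vector_diff_chain_within[unfolded o_def]) 
        (auto intro!: derivative_eq_intros)
    have "Re (b + of_real t * (a - b)) = (1 - t) * Re b + t * Re a" by (simp add: algebra_simps)
    also have "\<dots> \<le> max (Re a) (Re b)"
      using t by (intro convex_bound_le) auto
    finally have "exp (Re (b + of_real t * (a - b))) \<le> exp (max (Re a) (Re b))" 
      by (rule iffD2[OF exp_le_cancel_iff])
    also have "\<dots> \<le> M" using assms by (simp add: max_def)
    finally have "norm (f t) \<le> M" unfolding f_def norm_exp_eq_Re .
    thus "norm ((a - b) * f t) \<le> norm (a - b) * M" by (simp add: norm_mult mult_left_mono)
  qed auto
  thus ?thesis by (simp add: f_def)
qed

text \<open>
  The line of steepest descent through the stationary point, which is scaled to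
  \<open>1\<close>.
\<close>

definition saddle_line :: "real \<Rightarrow> complex" where "saddle_line u = Complex (1 + u) u"

lemma saddle_line_altdef: "saddle_line u = 1 + (1 + \<i>) * of_real u"
  by (simp add: saddle_line_def complex_eq_iff)

lemma saddle_line_deriv: "((\<lambda>t. saddle_line (s * t)) has_vector_derivative (of_real s * (1 + \<i>))) (at t within X)"
  unfolding saddle_line_altdef by (auto intro!: derivative_eq_intros)

lemma norm_saddle_line_ge: "norm (saddle_line u) \<ge> 1 / sqrt 2"
proof -
  have "(1 + u)\<^sup>2 + u\<^sup>2 = 1/2 + (1 + 2 * u)\<^sup>2 / 2" by (simp add: power2_eq_square field_simps)
  hence "sqrt (1/2) \<le> sqrt ((1 + u)\<^sup>2 + u\<^sup>2)" by simp
  thus ?thesis by (simp add: saddle_line_def cmod_def real_sqrt_divide)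
qed

lemma norm_one_plus_i: "norm (1 + \<i>) = sqrt 2" by (simp add: cmod_def)

text \<open>
  These are the Taylor estimates of order one and three for \<open>Ln (1 + (1 + i) u)\<close>.
  They hold up to \<open>\<bar>u\<bar> = 1/2\<close> since \<open>\<bar>1 + (1 + i)
  u\<bar>\<close> is at least \<open>1 / sqrt 2\<close> for every real \<open>u\<close>.
\<close>

lemma Ln_saddle_line_bounds:
  assumes "\<bar>u\<bar> \<le> 1/2"
  shows "norm (Ln (saddle_line u)) \<le> 2 * \<bar>u\<bar>"
    and "norm (Ln (saddle_line u) - (1 + \<i>) * u + \<i> * u\<^sup>2) \<le> 4/3 * \<bar>u\<bar> ^ 3"
proof -
  define s where "s = (if u \<ge> 0 then 1 else -1 :: real)"
  have s: "s * \<bar>u\<bar> = u" "\<bar>s\<bar> = 1" "s\<^sup>2 = 1" by (auto simp: s_def)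
  have pos: "Re (saddle_line (s * t)) > 0" if "t \<in> {0..\<bar>u\<bar>}" for t
    using that assms by (auto simp: saddle_line_def s_def split: if_splits)
  have D: "((\<lambda>t. Ln (saddle_line (s * t))) has_vector_derivative (of_real s * (1 + \<i>)) * inverse (saddle_line (s * t))) (at t within {0..\<bar>u\<bar>})"
    if "t \<in> {0..\<bar>u\<bar>}" for t
    by (rule field_vector_diff_chain_within[unfolded o_def, OF saddle_line_deriv has_field_derivative_at_within[OF has_field_derivative_Ln]])
      (use pos[OF that] nonpos_Reals_Re_pos in auto)
  have inv: "norm (inverse (saddle_line v)) \<le> sqrt 2" for v
  proof -
    have "inverse (norm (saddle_line v)) \<le> inverse (1 / sqrt 2)"
      by (intro le_imp_inverse_le norm_saddle_line_ge) auto
    thus ?thesis by (simp add: norm_inverse)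
  qed
  have "norm (Ln (saddle_line (s * \<bar>u\<bar>)) - Ln (saddle_line (s * 0))) \<le> 2 * (\<bar>u\<bar> - 0)"
  proof (rule norm_diff_le_const[OF _ D])
    fix t assume "t \<in> {0..\<bar>u\<bar>}"
    have "norm ((of_real s * (1 + \<i>)) * inverse (saddle_line (s * t))) \<le> sqrt 2 * sqrt 2"
      using mult_left_mono[OF inv[of "s * t"], of "sqrt 2"] s(2) by (simp add: norm_mult norm_one_plus_i del: real_sqrt_mult_self)
    thus "norm ((of_real s * (1 + \<i>)) * inverse (saddle_line (s * t))) \<le> 2" by simp
  qed auto
  thus "norm (Ln (saddle_line u)) \<le> 2 * \<bar>u\<bar>" using s by (simp add: saddle_line_altdef)
  define g where "g = (\<lambda>t. Ln (saddle_line (s * t)) - (1 + \<i>) * of_real (s * t) + \<i> * (of_real (s * t))\<^sup>2)"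
  have "norm (g \<bar>u\<bar> - g 0) \<le> (\<lambda>t. 4/3 * t^3) \<bar>u\<bar> - (\<lambda>t. 4/3 * t^3) 0"
  proof (rule norm_diff_le_antiderivative)
    fix t assume t: "t \<in> {0..\<bar>u\<bar>}"
    define d where "d = (of_real s * (1 + \<i>)) * inverse (saddle_line (s * t)) - (1 + \<i>) * s + \<i> * (2 * of_real (s * t) * s)"
    show "(g has_vector_derivative d) (at t within {0..\<bar>u\<bar>})"
      unfolding g_def d_def
      by (intro has_vector_derivative_add has_vector_derivative_diff D t)
         (auto intro!: derivative_eq_intros simp: power2_eq_square algebra_simps)
    show "((\<lambda>t. 4/3 * t^3) has_real_derivative 4 * t\<^sup>2) (at t within {0..\<bar>u\<bar>})"
      by (auto intro!: derivative_eq_intros)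
    have nz: "saddle_line (s * t) \<noteq> 0" using pos[OF t] by auto
    have "d * saddle_line (s * t) = of_real s * (1 + \<i>) * (1 - saddle_line (s * t) + (1 + \<i>) * of_real (s * t) * saddle_line (s * t))"
      using nz unfolding d_def by (simp add: algebra_simps)
    also have "\<dots> = of_real s * (1 + \<i>) * (2 * \<i> * of_real (s * t) ^ 2)"
      unfolding saddle_line_altdef by (simp add: algebra_simps power2_eq_square)
    finally have "d = of_real s * (1 + \<i>) * (2 * \<i> * of_real (s * t) ^ 2) * inverse (saddle_line (s * t))"
      using nz by (simp add: field_simps)
    hence "norm d = sqrt 2 * (2 * t\<^sup>2) * norm (inverse (saddle_line (s * t)))"
      using s by (simp add: norm_mult norm_one_plus_i norm_power power_mult_distrib)
    also have "\<dots> \<le> sqrt 2 * (2 * t\<^sup>2) * sqrt 2" by (intro mult_left_mono inv) auto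
    also have "\<dots> = 4 * t\<^sup>2" by (simp add: mult.commute mult.left_commute)
    finally show "norm d \<le> 4 * t\<^sup>2" .
  qed auto
  thus "norm (Ln (saddle_line u) - (1 + \<i>) * u + \<i> * u\<^sup>2) \<le> 4/3 * \<bar>u\<bar> ^ 3"
    using s(1) by (simp add: g_def saddle_line_altdef flip: of_real_mult)
qed

lemma arctan_saddle_line_deriv:
  assumes "u > -1"
  shows "((\<lambda>u. arctan (u / (1 + u)) - u + u\<^sup>2 / 5) has_real_derivative
     u * (2/5 - 2 * (1 + u) / (1 + 2 * u + 2 * u\<^sup>2))) (at u)"
proof -
  have "((\<lambda>u. arctan (u / (1 + u)) - u + u\<^sup>2 / 5) has_real_derivative
        inverse (1 + (u / (1 + u))\<^sup>2) * ((1 * (1 + u) - u * 1) / ((1 + u) * (1 + u))) - 1 + 2 * u / 5) (at u)"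
    using assms by (auto intro!: derivative_eq_intros)
  moreover have "inverse (1 + (u / (1 + u))\<^sup>2) * ((1 * (1 + u) - u * 1) / ((1 + u) * (1 + u))) = 1 / (1 + 2 * u + 2 * u\<^sup>2)"
  proof -
    have "1 + (u / (1 + u))\<^sup>2 = (1 + 2 * u + 2 * u\<^sup>2) / (1 + u)\<^sup>2" 
    proof -
      have "(1 + u)\<^sup>2 \<noteq> 0" using assms by simp
      hence "1 + (u / (1 + u))\<^sup>2 = ((1 + u)\<^sup>2 + u\<^sup>2) / (1 + u)\<^sup>2" by (simp add: power_divide add_divide_distrib)
      also have "(1 + u)\<^sup>2 + u\<^sup>2 = 1 + 2 * u + 2 * u\<^sup>2" by (simp add: power2_eq_square algebra_simps)
      finally show ?thesis .
    qed
    thus ?thesis using assms by (simp add: power2_eq_square)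
  qed
  moreover have "1 / (1 + 2 * u + 2 * u\<^sup>2) - 1 + 2 * u / 5 = u * (2/5 - 2 * (1 + u) / (1 + 2 * u + 2 * u\<^sup>2))"
  proof -
    have "1 + 2 * u + 2 * u\<^sup>2 = u\<^sup>2 + (1 + u)\<^sup>2" by (simp add: power2_eq_square algebra_simps)
    also have "\<dots> > 0" using assms by (intro add_nonneg_pos) auto
    finally have "1 + 2 * u + 2 * u\<^sup>2 \<noteq> 0" by simp
    thus ?thesis by (simp add: divide_simps) (simp add: algebra_simps power2_eq_square)
  qed
  ultimately show ?thesis by simp
qed

text \<open>
  The argument of \<open>saddle_line u\<close> falls short of \<open>u\<close> quadratically on
  both sides of the saddle; this gives the kernel its Gaussian decay.
\<close>

lemma arctan_saddle_line_le:
  assumes "\<bar>u\<bar> \<le> 1/2"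
  shows "arctan (u / (1 + u)) - u \<le> - u\<^sup>2 / 5"
proof -
  define f where "f = (\<lambda>u::real. arctan (u / (1 + u)) - u + u\<^sup>2 / 5)"
  have neg: "2/5 - 2 * (1 + v) / (1 + 2 * v + 2 * v\<^sup>2) \<le> 0" if "\<bar>v\<bar> \<le> 1/2" for v :: real
  proof -
    have "v\<^sup>2 \<le> (1/2)\<^sup>2" using that by (subst abs_le_square_iff[symmetric]) auto
    hence "1 + 2 * v + 2 * v\<^sup>2 \<le> 5 * (1 + v)" using that by (simp add: power2_eq_square) 
    moreover have "1 + 2 * v + 2 * v\<^sup>2 = v\<^sup>2 + (1 + v)\<^sup>2" by (simp add: power2_eq_square algebra_simps)
    moreover have "v\<^sup>2 + (1 + v)\<^sup>2 > 0" using that by (intro add_nonneg_pos) auto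
    ultimately show ?thesis by (simp add: field_simps)
  qed
  have "f u \<le> f 0"
  proof (cases "u \<ge> 0")
    case True
    show ?thesis
    proof (rule DERIV_nonpos_imp_nonincreasing[OF True])
      fix v assume v: "0 \<le> v" "v \<le> u"
      have "v * (2/5 - 2 * (1 + v) / (1 + 2 * v + 2 * v\<^sup>2)) \<le> 0"
        using v assms neg[of v] by (intro mult_nonneg_nonpos) auto
      thus "\<exists>y. (f has_real_derivative y) (at v) \<and> y \<le> 0"
        using arctan_saddle_line_deriv[of v] v assms unfolding f_def by auto
    qed
  next
    case False
    hence "u \<le> 0" by simp
    show ?thesis
    proof (rule DERIV_nonneg_imp_nondecreasing[OF \<open>u \<le> 0\<close>])
      fix v assume v: "u \<le> v" "v \<le> 0"
      have "v * (2/5 - 2 * (1 + v) / (1 + 2 * v + 2 * v\<^sup>2)) \<ge> 0"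
        using v assms neg[of v] by (intro mult_nonpos_nonpos) auto
      thus "\<exists>y. (f has_real_derivative y) (at v) \<and> y \<ge> 0"
        using arctan_saddle_line_deriv[of v] v assms unfolding f_def by auto
    qed
  qed
  thus ?thesis by (simp add: f_def)
qed


text \<open>
  The kernel on the saddle line, divided by its value at the stationary point.
\<close>

definition scaled_kernel :: "real \<Rightarrow> real \<Rightarrow> complex" where
  "scaled_kernel P u = exp (2 * pi * \<i> * P * ((1 + \<i>) * u) - (1/2 + 2 * pi * \<i> * P) * Ln (saddle_line u))"

lemma norm_scaled_kernel:
  assumes "u > -1"
  shows "norm (scaled_kernel P u) = exp (2 * pi * P * (arctan (u / (1 + u)) - u)) / sqrt (norm (saddle_line u))"
proof -
  have "kernel P P (saddle_line u) = scaled_kernel P u * exp (\<i> * (2 * pi * P))"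
    unfolding kernel_def scaled_kernel_def exp_add[symmetric]
    by (rule arg_cong[of _ _ exp]) (simp add: saddle_line_altdef algebra_simps)
  hence "norm (scaled_kernel P u) = norm (kernel P P (saddle_line u))" by (simp add: norm_mult)
  also have "\<dots> = exp (2 * pi * (P * arctan (u / (1 + u)) - P * u)) / sqrt (norm (saddle_line u))"
    using norm_kernel[of "saddle_line u" P P] assms by (simp add: saddle_line_def)
  finally show ?thesis by (simp add: algebra_simps)
qed

text \<open>
  The exponents of the kernel and of the Gaussian differ by \<open>O(\<bar>u\<bar> + P
  \<bar>u\<bar>^3)\<close>, and both exponentials are at most \<open>2 exp (- P u^2)\<close>.
\<close>

lemma scaled_kernel_gaussian_approx:
  assumes "\<bar>u\<bar> \<le> 1/2" "P \<ge> 1"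
  shows "norm (scaled_kernel P u - exp (- 2 * pi * P * u\<^sup>2)) \<le> (\<bar>u\<bar> + 9 * P * \<bar>u\<bar> ^ 3) * (2 * exp (- P * u\<^sup>2))"
proof -
  define A where "A = 2 * pi * \<i> * P * ((1 + \<i>) * u) - (1/2 + 2 * pi * \<i> * P) * Ln (saddle_line u)"
  define B where "B = complex_of_real (- 2 * pi * P * u\<^sup>2)"
  have diff: "A - B = - (1/2) * Ln (saddle_line u) - 2 * pi * \<i> * P * (Ln (saddle_line u) - (1 + \<i>) * u + \<i> * u\<^sup>2)"
    by (simp add: A_def B_def algebra_simps power2_eq_square)
  have "norm (A - B) \<le> 1/2 * norm (Ln (saddle_line u)) + 2 * pi * P * norm (Ln (saddle_line u) - (1 + \<i>) * u + \<i> * u\<^sup>2)"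
    unfolding diff using assms(2) 
    by (intro order_trans[OF norm_triangle_ineq4]) (simp add: norm_mult)
  also have "\<dots> \<le> 1/2 * (2 * \<bar>u\<bar>) + 2 * pi * P * (4/3 * \<bar>u\<bar> ^ 3)"
    using Ln_saddle_line_bounds[OF assms(1)] assms(2) by (intro add_mono mult_left_mono) auto
  also have "\<dots> \<le> \<bar>u\<bar> + 9 * P * \<bar>u\<bar> ^ 3"
  proof -
    have "(8 * pi / 3) * (P * \<bar>u\<bar> ^ 3) \<le> 9 * (P * \<bar>u\<bar> ^ 3)"
      using pi_approx assms(2) by (intro mult_right_mono) auto
    thus ?thesis by simp
  qed
  finally have AB: "norm (A - B) \<le> \<bar>u\<bar> + 9 * P * \<bar>u\<bar> ^ 3" .
  have pi1: "P * u\<^sup>2 \<le> 2 * pi * P * (u\<^sup>2 / 5)"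
  proof -
    have "1 * (P * u\<^sup>2) \<le> (2 * pi / 5) * (P * u\<^sup>2)"
      using pi_gt3 assms(2) by (intro mult_right_mono) auto
    thus ?thesis by simp
  qed
  have "norm (exp A) \<le> 2 * exp (- P * u\<^sup>2)"
  proof -
    have "norm (exp A) = norm (scaled_kernel P u)" by (simp add: A_def scaled_kernel_def)
    also have "\<dots> = exp (2 * pi * P * (arctan (u / (1 + u)) - u)) / sqrt (norm (saddle_line u))"
      using assms by (intro norm_scaled_kernel) auto
    also have "\<dots> \<le> exp (- P * u\<^sup>2) / (1/2)"
    proof (rule frac_le)
      have "2 * pi * P * (arctan (u / (1 + u)) - u) \<le> 2 * pi * P * (- u\<^sup>2 / 5)"
        using arctan_saddle_line_le[OF assms(1)] assms(2) by (intro mult_left_mono) auto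
      hence "2 * pi * P * (arctan (u / (1 + u)) - u) \<le> - P * u\<^sup>2" using pi1 by simp
      thus "exp (2 * pi * P * (arctan (u / (1 + u)) - u)) \<le> exp (- P * u\<^sup>2)"
        by (rule iffD2[OF exp_le_cancel_iff])
      have "1 / 4 \<le> 1 / sqrt 2" using real_sqrt_le_mono[of 2 16] by (simp add: field_simps)
      also have "\<dots> \<le> norm (saddle_line u)" by (rule norm_saddle_line_ge)
      finally have "sqrt (1/4) \<le> sqrt (norm (saddle_line u))" by (rule real_sqrt_le_mono)
      thus "1/2 \<le> sqrt (norm (saddle_line u))" by (simp add: real_sqrt_divide)
    qed auto
    finally show ?thesis by simp
  qed
  moreover have "norm (exp B) \<le> 2 * exp (- P * u\<^sup>2)"
  proof -
    have "norm (exp B) = exp (- 2 * pi * P * u\<^sup>2)" by (simp add: B_def)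
    also have "\<dots> \<le> exp (- P * u\<^sup>2)"
    proof (rule iffD2[OF exp_le_cancel_iff])
      have "1 * (P * u\<^sup>2) \<le> (2 * pi) * (P * u\<^sup>2)"
        using pi_gt3 assms(2) by (intro mult_right_mono) auto
      thus "- 2 * pi * P * u\<^sup>2 \<le> - P * u\<^sup>2" by simp
    qed
    finally show ?thesis by (smt (verit) exp_gt_zero)
  qed
  ultimately have "norm (exp A - exp B) \<le> norm (A - B) * (2 * exp (- P * u\<^sup>2))"
    by (rule norm_exp_diff_le)
  also have "\<dots> \<le> (\<bar>u\<bar> + 9 * P * \<bar>u\<bar> ^ 3) * (2 * exp (- P * u\<^sup>2))"
    by (intro mult_right_mono AB) auto
  finally show ?thesis by (simp add: A_def B_def scaled_kernel_def exp_of_real[symmetric])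
qed

text \<open>
  The value of the kernel at the stationary point \<open>\<rho>\<close>, times the derivative
  \<open>\<rho> (1 + i)\<close> of the parametrisation of the saddle line.
\<close>

definition saddle_factor :: "real \<Rightarrow> real \<Rightarrow> complex" where
  "saddle_factor P \<rho> = of_real \<rho> * (1 + \<i>) * exp (2 * pi * \<i> * P - (1/2 + 2 * pi * \<i> * P) * of_real (ln \<rho>))"

lemma norm_saddle_factor: "\<rho> > 0 \<Longrightarrow> norm (saddle_factor P \<rho>) = sqrt 2 * sqrt \<rho>"
proof -
  assume \<rho>: "\<rho> > 0"
  have "Re (2 * pi * \<i> * P - (1/2 + 2 * pi * \<i> * P) * of_real (ln \<rho>)) = - ln (sqrt \<rho>)"
    using \<rho> by (simp add: ln_sqrt)
  hence E: "norm (exp (2 * pi * \<i> * P - (1/2 + 2 * pi * \<i> * P) * of_real (ln \<rho>))) = 1 / sqrt \<rho>"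
    unfolding norm_exp_eq_Re using \<rho>
    by (simp only: exp_minus exp_ln real_sqrt_gt_zero inverse_eq_divide)
  have "norm (saddle_factor P \<rho>) = norm (of_real \<rho> :: complex) * norm (1 + \<i>)
      * norm (exp (2 * pi * \<i> * P - (1/2 + 2 * pi * \<i> * P) * of_real (ln \<rho>)))"
    by (simp only: saddle_factor_def norm_mult)
  also have "\<dots> = \<rho> * sqrt 2 * (1 / sqrt \<rho>)"
    unfolding E norm_one_plus_i norm_of_real using \<rho> by (simp only: abs_of_pos)
  also have "\<dots> = sqrt 2 * (\<rho> / sqrt \<rho>)"
    by (simp only: mult_ac times_divide_eq_right times_divide_eq_left mult_1_right)
  also have "\<rho> / sqrt \<rho> = sqrt \<rho>" using \<rho> by (intro real_div_sqrt less_imp_le)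
  finally show ?thesis .
qed

lemma kernel_saddle_line:
  assumes "\<rho> > 0" "u > -1"
  shows "of_real \<rho> * (1 + \<i>) * kernel P (P / \<rho>) (of_real \<rho> * saddle_line u) = saddle_factor P \<rho> * scaled_kernel P u"
proof -
  have "saddle_line u \<noteq> 0" using assms by (auto simp: saddle_line_def complex_eq_iff)
  hence "Ln (of_real \<rho> * saddle_line u) = of_real (ln \<rho>) + Ln (saddle_line u)"
    using assms by (subst Ln_times_of_real) (auto simp: Ln_of_real)
  moreover have "2 * pi * \<i> * (P / \<rho>) * (of_real \<rho> * saddle_line u) = 2 * pi * \<i> * P + 2 * pi * \<i> * P * ((1 + \<i>) * u)"
    using assms by (simp add: saddle_line_altdef field_simps)
  ultimately have "kernel P (P / \<rho>) (of_real \<rho> * saddle_line u) = exp (2 * pi * \<i> * P - (1/2 + 2 * pi * \<i> * P) * of_real (ln \<rho>)) * scaled_kernel P u"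
    unfolding kernel_def scaled_kernel_def exp_add[symmetric]
    by (intro arg_cong[of _ _ exp]) (simp only: of_real_divide, simp add: ring_distribs)
  thus ?thesis by (simp add: saddle_factor_def)
qed

lemma primitive_saddle_line_deriv:
  assumes "\<rho> > 0" "s * t > -1"
  shows "((\<lambda>t. primitive P (P / \<rho>) (of_real \<rho> * saddle_line (s * t))) has_vector_derivative
           (of_real s * (saddle_factor P \<rho> * scaled_kernel P (s * t)))) (at t within X)"
proof -
  have "((\<lambda>t. of_real \<rho> * saddle_line (s * t)) has_vector_derivative (of_real \<rho> * (of_real s * (1 + \<i>)))) (at t within X)"
    by (intro has_vector_derivative_mult_right saddle_line_deriv)
  hence "((\<lambda>t. primitive P (P / \<rho>) (of_real \<rho> * saddle_line (s * t))) has_vector_derivative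
          (of_real \<rho> * (of_real s * (1 + \<i>))) * kernel P (P / \<rho>) (of_real \<rho> * saddle_line (s * t))) (at t within X)"
    by (intro primitive_along_path) (use assms in \<open>auto simp: saddle_line_def\<close>)
  also have "(of_real \<rho> * (of_real s * (1 + \<i>))) * kernel P (P / \<rho>) (of_real \<rho> * saddle_line (s * t)) =
        of_real s * (of_real \<rho> * (1 + \<i>) * kernel P (P / \<rho>) (of_real \<rho> * saddle_line (s * t)))"
    by (simp only: mult_ac)
  also have "\<dots> = of_real s * (saddle_factor P \<rho> * scaled_kernel P (s * t))"
    by (subst kernel_saddle_line) (use assms in auto)
  finally show ?thesis .
qed

text \<open>
  Half of the saddle line carries half of the Gaussian integral. The error is of relative size
  \<open>P^(-1/2)\<close>; a weaker stationary phase estimate would not do, since the errors of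
  about \<open>N\<close> saddles are added later.
\<close>

lemma saddle_half:
  assumes P: "P \<ge> 1" and \<rho>: "\<rho> > 0" and s: "s = 1 \<or> s = -1"
  shows "norm (primitive P (P / \<rho>) (of_real \<rho> * saddle_line (s / 2)) - primitive P (P / \<rho>) (of_real \<rho>)
           - of_real s * (saddle_factor P \<rho> / (2 * sqrt (2 * P)))) \<le> 17 * sqrt \<rho> / P"
proof -
  define k where "k = 2 * pi * P"
  have k: "k > 0" using P by (simp add: k_def)
  have s': "of_real s * of_real s = (1 :: complex)" "\<bar>s\<bar> = 1" "s * s = 1" using s by auto
  have K: "saddle_factor P \<rho> \<noteq> 0" using norm_saddle_factor[OF \<rho>, of P] \<rho> by auto
  define G where "G = (\<lambda>t. gauss_int (sqrt k * t) / sqrt k)"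
  define W where "W = (\<lambda>t. of_real s * (primitive P (P / \<rho>) (of_real \<rho> * saddle_line (s * t)) / saddle_factor P \<rho>))"
  \<comment> \<open>The right-hand side is the antiderivative of the bound from the Gaussian approximation.\<close>
  have "norm ((W (1/2) - of_real (G (1/2))) - (W 0 - of_real (G 0))) \<le>
     (\<lambda>t. - (10 / P + 9 * t\<^sup>2) * exp (- P * t\<^sup>2)) (1/2) - (\<lambda>t. - (10 / P + 9 * t\<^sup>2) * exp (- P * t\<^sup>2)) 0"
  proof (rule norm_diff_le_antiderivative)
    fix t assume t: "t \<in> {0..1/2::real}"
    hence st: "\<bar>s * t\<bar> \<le> 1/2" "(s * t)\<^sup>2 = t\<^sup>2" "\<bar>s * t\<bar> = t" "s * t > -1" using s by auto
    have "(W has_vector_derivative (of_real s * (of_real s * (saddle_factor P \<rho> * scaled_kernel P (s * t)) / saddle_factor P \<rho>))) (at t within {0..1/2})"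
      unfolding W_def
      by (intro has_vector_derivative_mult_right has_vector_derivative_divide primitive_saddle_line_deriv \<rho> st)
    also have "of_real s * (of_real s * (saddle_factor P \<rho> * scaled_kernel P (s * t)) / saddle_factor P \<rho>) = scaled_kernel P (s * t)"
      using K s' by (simp add: field_simps)
    finally have DW: "(W has_vector_derivative (scaled_kernel P (s * t))) (at t within {0..1/2})" .
    have "(gauss_int has_real_derivative exp (- (sqrt k * t)\<^sup>2)) (at (sqrt k * t) within (\<lambda>t. sqrt k * t) ` {0..1/2})"
      by (rule DERIV_subset[OF gauss_int_deriv]) (use t k in auto)
    hence "((\<lambda>t. gauss_int (sqrt k * t)) has_real_derivative exp (- (sqrt k * t)\<^sup>2) * (sqrt k * 1)) (at t within {0..1/2})"
      by (rule DERIV_image_chain[unfolded o_def]) (auto intro!: derivative_eq_intros)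
    hence "(G has_real_derivative exp (- (sqrt k * t)\<^sup>2) * (sqrt k * 1) / sqrt k) (at t within {0..1/2})"
      unfolding G_def by (rule DERIV_cdivide)
    hence "(G has_real_derivative exp (- 2 * pi * P * t\<^sup>2)) (at t within {0..1/2})"
      using k by (simp add: power_mult_distrib) (simp add: k_def)
    hence "((\<lambda>t. of_real (G t) :: complex) has_vector_derivative of_real (exp (- 2 * pi * P * t\<^sup>2))) (at t within {0..1/2})"
      by (simp add: has_real_derivative_iff_has_vector_derivative has_vector_derivative_of_real)
    thus "((\<lambda>t. W t - of_real (G t)) has_vector_derivative (scaled_kernel P (s * t) - of_real (exp (- 2 * pi * P * t\<^sup>2)))) (at t within {0..1/2})"
      by (intro has_vector_derivative_diff DW)
    show "((\<lambda>t. - (10 / P + 9 * t\<^sup>2) * exp (- P * t\<^sup>2)) has_real_derivative (t + 9 * P * t^3) * (2 * exp (- P * t\<^sup>2))) (at t within {0..1/2})"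
      using P by (auto intro!: derivative_eq_intros simp: field_simps power2_eq_square power3_eq_cube)
    show "norm (scaled_kernel P (s * t) - of_real (exp (- 2 * pi * P * t\<^sup>2))) \<le> (t + 9 * P * t^3) * (2 * exp (- P * t\<^sup>2))"
      using scaled_kernel_gaussian_approx[OF st(1) P] unfolding st by (simp add: exp_of_real)
  qed auto
  also have "\<dots> \<le> 10 / P" 
  proof -
    have "- (10 / P + 9 * (1/2)\<^sup>2) * exp (- P * (1/2)\<^sup>2) \<le> 0"
    proof (rule mult_nonpos_nonneg)
      have "10 / P \<ge> 0" using P by simp
      moreover have "9 * (1/2)\<^sup>2 = (9/4 :: real)" by (simp add: power2_eq_square)
      ultimately show "- (10 / P + 9 * (1/2)\<^sup>2) \<le> 0" by linarith
    qed simp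
    moreover have "- (10 / P + 9 * 0\<^sup>2) * exp (- P * 0\<^sup>2) = - (10 / P)" by simp
    ultimately show ?thesis by linarith
  qed
  finally have 1: "norm ((W (1/2) - of_real (G (1/2))) - (W 0 - of_real (G 0))) \<le> 10 / P" .
  have G0: "G 0 = 0" by (simp add: G_def gauss_int_def)
  have 2: "\<bar>G (1/2) - 1 / (2 * sqrt (2 * P))\<bar> \<le> 1 / P"
  proof -
    have "\<bar>gauss_int (sqrt k / 2) - sqrt pi / 2\<bar> \<le> exp (- (sqrt k / 2)\<^sup>2) / (2 * (sqrt k / 2))"
      by (rule gauss_int_tail) (use k in auto)
    also have "\<dots> \<le> 1 / sqrt k" using k by (simp add: divide_right_mono)
    finally have "\<bar>gauss_int (sqrt k / 2) - sqrt pi / 2\<bar> / sqrt k \<le> (1 / sqrt k) / sqrt k"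
      using k by (intro divide_right_mono) auto
    also have "\<dots> = 1 / k" using k by simp
    also have "\<dots> \<le> 1 / P" using P pi_gt3 unfolding k_def by (intro divide_left_mono) auto
    also have "\<bar>gauss_int (sqrt k / 2) - sqrt pi / 2\<bar> / sqrt k = \<bar>(gauss_int (sqrt k / 2) - sqrt pi / 2) / sqrt k\<bar>"
      using k by (simp add: abs_divide)
    also have "(gauss_int (sqrt k / 2) - sqrt pi / 2) / sqrt k = G (1/2) - 1 / (2 * sqrt (2 * P))"
      using P unfolding G_def k_def by (simp add: diff_divide_distrib real_sqrt_mult)
    finally show ?thesis .
  qed
  have "norm (W (1/2) - W 0 - of_real (1 / (2 * sqrt (2 * P)))) \<le> 11 / P"
  proof -
    have "W (1/2) - W 0 - of_real (1 / (2 * sqrt (2 * P))) =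
       ((W (1/2) - of_real (G (1/2))) - (W 0 - of_real (G 0))) + of_real (G (1/2) - 1 / (2 * sqrt (2 * P)))"
      by (simp add: G0)
    also have "norm \<dots> \<le> 10 / P + 1 / P"
      by (intro norm_triangle_mono 1) (use 2 in \<open>simp only: norm_of_real\<close>)
    finally show ?thesis by simp
  qed
  hence "norm (saddle_factor P \<rho>) * norm (W (1/2) - W 0 - of_real (1 / (2 * sqrt (2 * P)))) \<le> (sqrt 2 * sqrt \<rho>) * (11 / P)"
    unfolding norm_saddle_factor[OF \<rho>] using \<rho> by (intro mult_left_mono) auto
  also have "\<dots> \<le> (17/11 * sqrt \<rho>) * (11 / P)"
  proof (intro mult_right_mono)
    have "sqrt 2 \<le> sqrt ((17/11)^2)" by (intro real_sqrt_le_mono) (simp add: power2_eq_square)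
    thus "sqrt 2 \<le> 17/11" by simp
  qed (use P \<rho> in simp_all)
  also have "norm (saddle_factor P \<rho>) * norm (W (1/2) - W 0 - of_real (1 / (2 * sqrt (2 * P)))) =
     norm (of_real s * saddle_factor P \<rho> * (W (1/2) - W 0 - of_real (1 / (2 * sqrt (2 * P)))))"
    using s' by (simp add: norm_mult)
  also have "of_real s * saddle_factor P \<rho> * (W (1/2) - W 0 - of_real (1 / (2 * sqrt (2 * P)))) =
     (of_real s * of_real s) * (primitive P (P / \<rho>) (of_real \<rho> * saddle_line (s / 2)) - primitive P (P / \<rho>) (of_real \<rho>))
           - of_real s * (saddle_factor P \<rho> / (2 * sqrt (2 * P)))"
    using K unfolding W_def by (simp add: field_simps saddle_line_altdef)
  finally show ?thesis using s' by simp
qed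

text \<open>
  This half of the saddle line ends on the ray of argument \<open>- pi / 4\<close>, where the
  lower tails end as well.
\<close>

lemma saddle_lower:
  assumes P: "P \<ge> 1" and \<rho>: "\<rho> > 0"
  shows "norm (primitive P (P / \<rho>) (of_real \<rho>) - primitive P (P / \<rho>) (Complex (\<rho>/2) (-\<rho>/2))
           - saddle_factor P \<rho> / (2 * sqrt (2 * P))) \<le> 17 * sqrt \<rho> / P"
proof -
  have "of_real \<rho> * saddle_line (- 1 / 2) = Complex (\<rho>/2) (-\<rho>/2)" 
    by (simp add: saddle_line_def complex_eq_iff)
  thus ?thesis using saddle_half[OF P \<rho>, of "-1"] 
    by (simp add: norm_minus_commute algebra_simps)
qed

text \<open>
  This half of the saddle line is continued up to the height \<open>2 P\<close>, where the
  upper tails end as well; beyond \<open>u = 1/2\<close> the scaled kernel is at most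
  \<open>exp (- P u)\<close>.
\<close>

lemma saddle_upper:
  assumes P: "P \<ge> 1" and \<rho>: "\<rho> > 0" "\<rho> \<le> P"
  shows "norm (primitive P (P / \<rho>) (Complex (\<rho> + 2 * P) (2 * P)) - primitive P (P / \<rho>) (of_real \<rho>) 
           - saddle_factor P \<rho> / (2 * sqrt (2 * P))) \<le> 20 * sqrt \<rho> / P"
proof -
  define F where "F = (\<lambda>t. primitive P (P / \<rho>) (of_real \<rho> * saddle_line (1 * t)))"
  define b where "b = 2 * P / \<rho>"
  have b: "b \<ge> 1/2" using \<rho> by (simp add: b_def field_simps)
  have "norm (F b - F (1/2)) \<le> (\<lambda>t. - (2 * sqrt \<rho> / P) * exp (- P * t)) b - (\<lambda>t. - (2 * sqrt \<rho> / P) * exp (- P * t)) (1/2)"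
  proof (rule norm_diff_le_antiderivative[OF b])
    fix t assume t: "t \<in> {1/2..b}"
    show "(F has_vector_derivative (of_real 1 * (saddle_factor P \<rho> * scaled_kernel P (1 * t)))) (at t within {1/2..b})"
      unfolding F_def by (rule primitive_saddle_line_deriv) (use \<rho> t in auto)
    show "((\<lambda>t. - (2 * sqrt \<rho> / P) * exp (- P * t)) has_real_derivative 2 * sqrt \<rho> * exp (- P * t)) (at t within {1/2..b})"
      using P by (auto intro!: derivative_eq_intros simp: field_simps)
    have "norm (scaled_kernel P t) = exp (2 * pi * P * (arctan (t / (1 + t)) - t)) / sqrt (norm (saddle_line t))"
      by (rule norm_scaled_kernel) (use t in auto)
    also have "\<dots> \<le> exp (- P * t) / 1"
    proof (rule frac_le)
      have "arctan (t / (1 + t)) \<le> t / (1 + t)" using t by (intro arctan_le_self) auto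
      moreover have "t / (1 + t) \<le> t * (2/3)"
      proof -
        have "t * 1 \<le> t * ((2/3) * (1 + t))" using t by (intro mult_left_mono) auto
        thus ?thesis using t by (simp add: divide_le_eq mult.assoc)
      qed
      ultimately have "arctan (t / (1 + t)) - t \<le> - t / 3" by linarith
      hence "2 * pi * P * (arctan (t / (1 + t)) - t) \<le> 2 * pi * P * (- t / 3)"
        using P by (intro mult_left_mono) simp_all
      also have "\<dots> = - ((2 * pi / 3) * (P * t))" by simp
      also have "\<dots> \<le> - (1 * (P * t))"
        using t P pi_gt3 by (intro le_imp_neg_le mult_right_mono) simp_all
      finally show "exp (2 * pi * P * (arctan (t / (1 + t)) - t)) \<le> exp (- P * t)"
        by simp
      have "1 \<le> norm (saddle_line t)" 
        using complex_Re_le_cmod[of "saddle_line t"] t by (simp add: saddle_line_def)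
      thus "1 \<le> sqrt (norm (saddle_line t))" by simp
    qed simp_all
    finally have "norm (scaled_kernel P t) \<le> exp (- P * t)" by simp
    moreover have "norm (saddle_factor P \<rho>) \<le> 2 * sqrt \<rho>"
      unfolding norm_saddle_factor[OF \<rho>(1)] using \<rho> real_sqrt_le_mono[of 2 4] by (intro mult_right_mono) simp_all
    ultimately have "norm (saddle_factor P \<rho>) * norm (scaled_kernel P t) \<le> 2 * sqrt \<rho> * exp (- P * t)"
      by (intro mult_mono) (use \<rho> in simp_all)
    thus "norm (of_real 1 * (saddle_factor P \<rho> * scaled_kernel P (1 * t))) \<le> 2 * sqrt \<rho> * exp (- P * t)" 
      by (simp only: norm_mult of_real_1 mult_1 norm_one)
  qed
  also have "\<dots> \<le> 2 * sqrt \<rho> / P * exp (- P * (1/2))" using \<rho> P by simp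
  also have "\<dots> \<le> 2 * sqrt \<rho> / P * 1" using \<rho> P by (intro mult_left_mono) simp_all
  finally have 1: "norm (F b - F (1/2)) \<le> 2 * sqrt \<rho> / P" by simp
  have 2: "of_real \<rho> * saddle_line b = Complex (\<rho> + 2 * P) (2 * P)" 
    using \<rho> by (simp add: saddle_line_def complex_eq_iff b_def field_simps)
  have "primitive P (P / \<rho>) (Complex (\<rho> + 2 * P) (2 * P)) - primitive P (P / \<rho>) (of_real \<rho>) - saddle_factor P \<rho> / (2 * sqrt (2 * P))
    = (F b - F (1/2)) + (primitive P (P / \<rho>) (of_real \<rho> * saddle_line (1 / 2)) - primitive P (P / \<rho>) (of_real \<rho>)
           - of_real 1 * (saddle_factor P \<rho> / (2 * sqrt (2 * P))))"
    unfolding F_def 2[symmetric] by simp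
  also have "norm \<dots> \<le> 2 * sqrt \<rho> / P + 17 * sqrt \<rho> / P"
    by (intro norm_triangle_mono 1 saddle_half P \<rho>) simp
  also have "\<dots> \<le> 20 * sqrt \<rho> / P" using \<rho> P by (simp add: field_simps)
  finally show ?thesis .
qed

section \<open>Poisson summation between half-integers\<close>

lemma sum_symmetric_Suc:
  fixes f :: "int \<Rightarrow> 'a::comm_monoid_add"
  shows "sum f {- int (Suc J)..int (Suc J)} = sum f {- int J..int J} + (f (int (Suc J)) + f (- int (Suc J)))"
proof -
  have "{- int (Suc J)..int (Suc J)} = insert (int (Suc J)) (insert (- int (Suc J)) {- int J..int J})"
    by auto
  thus ?thesis by (simp add: add_ac)
qed

lemma Dirichlet_kernel_sin:
  fixes z :: complex
  shows "(\<Sum>j\<in>{- int J..int J}. exp (2 * pi * \<i> * of_int j * z)) * sin (of_real pi * (z - of_nat b)) =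
     sin ((2 * of_nat J + 1) * of_real pi * (z - of_nat b))"
proof (induction J)
  case (Suc J)
  define w :: complex where "w = of_real pi * (z - of_nat b)"
  have e: "exp (2 * pi * \<i> * of_int j * z) = exp (2 * \<i> * of_int j * w)" for j :: int
  proof -
    have "exp (2 * pi * \<i> * of_int j * z) = exp (2 * \<i> * of_int j * w) * exp (2 * pi * \<i> * of_int (j * int b))"
      unfolding exp_add[symmetric] by (rule arg_cong[of _ _ exp]) (simp add: w_def algebra_simps)
    also have "exp (2 * pi * \<i> * of_int (j * int b)) = 1"
      by (subst exp_eq_1) (auto intro!: exI[of _ "j * int b"])
    finally show ?thesis by simp
  qed
  have c: "exp (2 * pi * \<i> * of_int (int (Suc J)) * z) + exp (2 * pi * \<i> * of_int (- int (Suc J)) * z) = 2 * cos (2 * (of_nat J + 1) * w)"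
    unfolding e cos_exp_eq by (simp add: algebra_simps)
  have "2 * cos (2 * (of_nat J + 1) * w) * sin w = sin (2 * (of_nat J + 1) * w + w) - sin (2 * (of_nat J + 1) * w - w)"
    by (simp add: sin_add sin_diff)
  also have "2 * (of_nat J + 1) * w - w = (2 * of_nat J + 1) * w" by (simp add: algebra_simps)
  also have "2 * (of_nat J + 1) * w + w = (2 * of_nat (Suc J) + 1) * w" by (simp add: algebra_simps)
  finally have s: "2 * cos (2 * (of_nat J + 1) * w) * sin w = sin ((2 * of_nat (Suc J) + 1) * w) - sin ((2 * of_nat J + 1) * w)" .
  have "(\<Sum>j\<in>{- int J..int J}. exp (2 * pi * \<i> * of_int j * z)) * sin w = sin ((2 * of_nat J + 1) * w)"
    using Suc.IH unfolding w_def by (simp add: mult.assoc)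
  hence "(\<Sum>j\<in>{- int (Suc J)..int (Suc J)}. exp (2 * pi * \<i> * of_int j * z)) * sin w = sin ((2 * of_nat (Suc J) + 1) * w)"
    unfolding sum_symmetric_Suc c ring_distribs(2) s by simp
  thus ?case unfolding w_def by (simp only: mult.assoc)
qed simp

text \<open>
  The quotient of \<open>f z - f b\<close> by the sine has a removable singularity; for the
  Dirichlet kernel this is the step that exposes a purely oscillating factor.
\<close>

lemma divide_by_sin:
  fixes f :: "complex \<Rightarrow> complex"
  assumes "f holomorphic_on ball b 1"
  obtains g :: "complex \<Rightarrow> complex" where "g holomorphic_on ball b 1"
    "\<And>z::complex. z \<in> ball b 1 \<Longrightarrow> f z = f b + g z * sin (of_real pi * (z - b))"
proof -
  define s :: "complex \<Rightarrow> complex" where "s = (\<lambda>z. sin (of_real pi * (z - b)))"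
  define f1 where "f1 = (\<lambda>z. if z = b then deriv f b else (f z - f b) / (z - b))"
  define s1 where "s1 = (\<lambda>z. if z = b then deriv s b else (s z - s b) / (z - b))"
  have "f1 holomorphic_on ball b 1" unfolding f1_def
    by (rule pole_lemma[OF assms]) simp
  moreover have "s1 holomorphic_on ball b 1" unfolding s1_def
    by (rule pole_lemma) (auto simp: s_def intro!: holomorphic_intros)
  moreover have nz: "s1 z \<noteq> 0" if "z \<in> ball b 1" for z
  proof (cases "z = b")
    case True
    have "(s has_field_derivative cos (of_real pi * (b - b)) * of_real pi) (at b)"
      unfolding s_def by (auto intro!: derivative_eq_intros)
    hence "deriv s b = pi" by (simp add: DERIV_imp_deriv)
    thus ?thesis using True by (simp add: s1_def)
  next
    case False
    have "s z \<noteq> 0"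
    proof
      assume "s z = 0"
      then obtain n :: int where "of_real pi * (z - b) = of_real (of_int n * pi)"
        unfolding s_def Complex_Transcendental.sin_eq_0 by (metis of_real_mult of_real_of_int_eq)
      hence n: "z - b = of_int n" by simp
      have "norm (z - b) = \<bar>real_of_int n\<bar>" unfolding n by simp
      hence "\<bar>real_of_int n\<bar> < 1" using that by (simp add: dist_norm norm_minus_commute)
      hence "n = 0" by linarith
      thus False using n False by simp
    qed
    thus ?thesis using False by (simp add: s1_def s_def)
  qed
  ultimately have "(\<lambda>z. f1 z / s1 z) holomorphic_on ball b 1"
    by (intro holomorphic_intros) auto
  moreover have "f z = f b + (f1 z / s1 z) * sin (of_real pi * (z - b))" if "z \<in> ball b 1" for z
  proof (cases "z = b")
    case False
    have "s1 z \<noteq> 0" using nz that by blast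
    moreover have "s z = s1 z * (z - b)" using False by (simp add: s1_def) (simp add: s_def)
    moreover have "sin (of_real pi * (z - b)) = s z" by (simp add: s_def)
    ultimately show ?thesis using False by (simp only:) (simp add: f1_def)
  qed simp
  ultimately show ?thesis by (rule that)
qed

lemma kernel_twist: "kernel P \<xi> z = kernel P 0 z * exp (2 * pi * \<i> * \<xi> * z)"
  unfolding kernel_def exp_add[symmetric] by (rule arg_cong[of _ _ exp]) (simp add: algebra_simps)

lemma segment_in_ball:
  assumes "t \<in> {real b - 1/2..real b + 1/2}"
  shows "of_real t \<in> ball (of_nat b :: complex) 1"
proof -
  have "dist (of_nat b) (of_real t :: complex) = dist (real b) t"
    by (metis of_real_of_nat_eq dist_of_real)
  thus ?thesis using assms by (simp add: dist_real_def abs_if)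
qed

lemma bounded_on_segment:
  assumes "g holomorphic_on ball (of_nat b) 1"
  obtains M where "\<And>t. t \<in> {real b - 1/2..real b + 1/2} \<Longrightarrow> norm (g (of_real t)) \<le> M"
proof -
  have "continuous_on {real b - 1/2..real b + 1/2} (\<lambda>t. g (of_real t))"
    by (rule continuous_on_compose2[OF holomorphic_on_imp_continuous_on[OF assms]])
       (use segment_in_ball in \<open>auto intro!: continuous_intros\<close>)
  hence "bounded ((\<lambda>t. g (of_real t)) ` {real b - 1/2..real b + 1/2})"
    by (intro compact_imp_bounded compact_continuous_image) auto
  thus ?thesis using that unfolding bounded_iff by blast
qed

text \<open>
  The Poisson formula truncated at frequency \<open>J\<close>: each summand is the integral of
  a kernel over \<open>{x..y}\<close>.
\<close>

definition freq_sum :: "real \<Rightarrow> nat \<Rightarrow> real \<Rightarrow> real \<Rightarrow> complex" where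
  "freq_sum P J x y =
     (\<Sum>j\<in>{- int J..int J}. primitive P (of_int j) (of_real y) - primitive P (of_int j) (of_real x))"

text \<open>
  The frequencies sum to the Dirichlet kernel. The constant part \<open>kernel P 0 b\<close> is
  reproduced exactly over a unit interval, and what remains is \<open>g\<close> times a sine of
  frequency about \<open>J\<close>, whose integral is \<open>O(1 / J)\<close> by an integration
  by parts.
\<close>

lemma Poisson_unit:
  assumes b: "b \<ge> 1"
  shows "(\<lambda>J. freq_sum P J (real b - 1/2) (real b + 1/2))
      \<longlonglongrightarrow> kernel P 0 (of_nat b)"
proof -
  have re: "Re z > 0" if "z \<in> ball (of_nat b) 1" for z :: complex
    using that b complex_Re_le_cmod[of "of_nat b - z"] by (simp add: dist_norm)
  have "kernel P 0 holomorphic_on ball (of_nat b) 1"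
    unfolding kernel_def using re by (intro holomorphic_intros) (auto simp: nonpos_Reals_Re_pos)
  then obtain g where g: "g holomorphic_on ball (of_nat b) 1"
    "\<And>z. z \<in> ball (of_nat b) 1 \<Longrightarrow> kernel P 0 z = kernel P 0 (of_nat b) + g z * sin (of_real pi * (z - of_nat b))"
    using divide_by_sin by blast
  obtain M0 where M0: "\<And>t. t \<in> {real b - 1/2..real b + 1/2} \<Longrightarrow> norm (g (of_real t)) \<le> M0"
    by (rule bounded_on_segment[OF g(1)]) blast
  have "deriv g holomorphic_on ball (of_nat b) 1" using g(1) by (intro holomorphic_deriv) auto
  then obtain M1 where M1: "\<And>t. t \<in> {real b - 1/2..real b + 1/2} \<Longrightarrow> norm (deriv g (of_real t)) \<le> M1"
    by (rule bounded_on_segment) blast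
  define E where "E = (\<lambda>(j::int) t::real. if j = 0 then of_real t else exp (2 * pi * \<i> * of_int j * of_real t) / (2 * pi * \<i> * of_int j))"
  have DE: "(E j has_vector_derivative exp (2 * pi * \<i> * of_int j * of_real t)) (at t within X)" for j t X
    unfolding E_def by (cases "j = 0") (auto intro!: derivative_eq_intros field_vector_diff_chain_within[unfolded o_def] simp: has_vector_derivative_of_real)
  have E_diff: "E j (real b + 1/2) - E j (real b - 1/2) = (if j = 0 then 1 else 0)" for j
  proof (cases "j = 0")
    case False
    have "exp (2 * pi * \<i> * of_int j * of_real (real b + 1/2)) =
          exp (2 * pi * \<i> * of_int j * of_real (real b - 1/2)) * exp (2 * of_int j * of_real pi * \<i>)"
      unfolding exp_add[symmetric] by (rule arg_cong[of _ _ exp]) (simp add: algebra_simps)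
    also have "exp (2 * of_int j * of_real pi * \<i>) = 1"
      by (subst exp_eq_1) (auto intro!: exI[of _ j])
    finally show ?thesis using False by (simp add: E_def)
  qed (simp add: E_def)
  have bound: "norm (freq_sum P J (real b - 1/2) (real b + 1/2)
       - kernel P 0 (of_nat b)) \<le> (2 * M0 + M1) / ((2 * real J + 1) * pi)" for J
  proof -
    define K where "K = (2 * real J + 1) * pi"
    have K: "K > 0" unfolding K_def by (intro mult_pos_pos) auto
    define G where "G = (\<lambda>t::real. (\<Sum>j\<in>{- int J..int J}. primitive P (of_int j) (of_real t) - kernel P 0 (of_nat b) * E j t))"
    define C where "C = (\<lambda>t::real. cos (of_real K * (of_real t - of_nat b) :: complex))"
    \<comment> \<open>The added term integrates \<open>g\<close> times the sine by parts; the derivative of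
    \<open>H\<close> is \<open>O(1 / K)\<close>.\<close>
    define H where "H = (\<lambda>t::real. G t + g (of_real t) * C t / of_real K)"
    have norm_cos: "norm (C t) \<le> 1" for t
    proof -
      have "C t = of_real (cos (K * (t - real b)))" unfolding C_def by (simp flip: cos_of_real)
      thus ?thesis by (simp only: norm_of_real abs_cos_le_one)
    qed
    have "norm (H (real b + 1/2) - H (real b - 1/2)) \<le> M1 / K * (real b + 1/2 - (real b - 1/2))"
    proof (rule norm_diff_le_const)
      fix t assume t: "t \<in> {real b - 1/2..real b + 1/2}"
      have ball: "of_real t \<in> ball (of_nat b :: complex) 1"
        by (rule segment_in_ball[OF t])
      have "(G has_vector_derivative (\<Sum>j\<in>{- int J..int J}. 1 * kernel P (of_int j) (of_real t) - kernel P 0 (of_nat b) * exp (2 * pi * \<i> * of_int j * of_real t)))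
             (at t within {real b - 1/2..real b + 1/2})"
        unfolding G_def using t b
        by (intro has_vector_derivative_sum has_vector_derivative_diff primitive_along_path has_vector_derivative_mult_right DE)
           (auto intro!: derivative_eq_intros simp: has_vector_derivative_of_real)
      also have "(\<Sum>j\<in>{- int J..int J}. 1 * kernel P (of_int j) (of_real t) - kernel P 0 (of_nat b) * exp (2 * pi * \<i> * of_int j * of_real t))
           = (kernel P 0 (of_real t) - kernel P 0 (of_nat b)) * (\<Sum>j\<in>{- int J..int J}. exp (2 * pi * \<i> * of_int j * of_real t))"
        by (subst kernel_twist) (simp add: sum_distrib_left algebra_simps sum_subtractf)
      also have "\<dots> = g (of_real t) * ((\<Sum>j\<in>{- int J..int J}. exp (2 * pi * \<i> * of_int j * of_real t)) * sin (of_real pi * (of_real t - of_nat b)))"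
        using g(2)[OF ball] by (simp add: mult_ac)
      also have "\<dots> = g (of_real t) * sin (of_real K * (of_real t - of_nat b))"
        unfolding Dirichlet_kernel_sin K_def by simp
      finally have DG: "(G has_vector_derivative (g (of_real t) * sin (of_real K * (of_real t - of_nat b)))) (at t within {real b - 1/2..real b + 1/2})" .
      have "(g has_field_derivative deriv g (of_real t)) (at (of_real t))"
        using g(1) ball by (simp add: holomorphic_derivI)
      hence D: "((\<lambda>z. g z * cos (of_real K * (z - of_nat b)) / of_real K) has_field_derivative
          (deriv g (of_real t) * cos (of_real K * (of_real t - of_nat b)) / of_real K - g (of_real t) * sin (of_real K * (of_real t - of_nat b)))) (at (of_real t))"
        using K by (auto intro!: derivative_eq_intros simp: field_simps)
      have "((\<lambda>t. g (of_real t) * C t / of_real K) has_vector_derivative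
          (deriv g (of_real t) * C t / of_real K - g (of_real t) * sin (of_real K * (of_real t - of_nat b)))) (at t within {real b - 1/2..real b + 1/2})"
        unfolding C_def
        by (rule has_vector_derivative_eq_rhs, rule field_vector_diff_chain_within[unfolded o_def, where f = of_real and f' = 1,
              OF _ has_field_derivative_at_within[OF D]])
           (auto intro!: derivative_eq_intros simp: has_vector_derivative_of_real)
      from has_vector_derivative_add[OF DG this]
      show "(H has_vector_derivative (deriv g (of_real t) * C t / of_real K)) (at t within {real b - 1/2..real b + 1/2})"
        unfolding H_def by simp
      have "norm (deriv g (of_real t) * C t) \<le> M1 * 1"
        unfolding norm_mult by (intro mult_mono M1[OF t] norm_cos norm_ge_zero order_trans[OF norm_ge_zero M1[OF t]])
      thus "norm (deriv g (of_real t) * C t / of_real K) \<le> M1 / K"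
        using K by (simp add: norm_divide divide_right_mono)
    qed simp
    hence H: "norm (H (real b + 1/2) - H (real b - 1/2)) \<le> M1 / K" by simp
    have gC: "norm (g (of_real t) * C t / of_real K) \<le> M0 / K" if t: "t \<in> {real b - 1/2..real b + 1/2}" for t
    proof -
      have "norm (g (of_real t) * C t) \<le> M0 * 1"
        unfolding norm_mult by (intro mult_mono M0[OF t] norm_cos norm_ge_zero order_trans[OF norm_ge_zero M0[OF t]])
      thus ?thesis using K by (simp add: norm_divide divide_right_mono)
    qed
    have "G (real b + 1/2) - G (real b - 1/2) = freq_sum P J (real b - 1/2) (real b + 1/2)
         - kernel P 0 (of_nat b) * (\<Sum>j\<in>{- int J..int J}. E j (real b + 1/2) - E j (real b - 1/2))"
      unfolding G_def freq_sum_def by (simp only: sum_subtractf sum_distrib_left right_diff_distrib) (simp only: algebra_simps)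
    also have "(\<Sum>j\<in>{- int J..int J}. E j (real b + 1/2) - E j (real b - 1/2)) = 1"
      unfolding E_diff by simp
    finally have "freq_sum P J (real b - 1/2) (real b + 1/2)
         - kernel P 0 (of_nat b) = (H (real b + 1/2) - H (real b - 1/2)) - g (of_real (real b + 1/2)) * C (real b + 1/2) / of_real K
            + g (of_real (real b - 1/2)) * C (real b - 1/2) / of_real K"
      unfolding H_def by simp
    also have "norm \<dots> \<le> M1 / K + M0 / K + M0 / K"
      by (intro norm_triangle_mono order_trans[OF norm_triangle_ineq4] add_mono H gC) auto
    finally show ?thesis unfolding K_def[symmetric] by (simp add: add_divide_distrib)
  qed
  show ?thesis
  proof (rule Lim_transform2[OF tendsto_const], rule Lim_null_comparison)
    show "eventually (\<lambda>J. norm (kernel P 0 (of_nat b) - freq_sum P J (real b - 1/2) (real b + 1/2))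
        \<le> (2 * M0 + M1) / ((2 * real J + 1) * pi)) sequentially"
      using bound by (intro always_eventually allI) (subst norm_minus_commute)
    show "(\<lambda>J. (2 * M0 + M1) / ((2 * real J + 1) * pi)) \<longlonglongrightarrow> 0"
      by real_asymp
  qed
qed


lemma Poisson_interval:
  assumes "N \<le> m"
  shows "(\<lambda>J. freq_sum P J (real N + 1/2) (real m + 1/2))
      \<longlonglongrightarrow> (\<Sum>b\<in>{N<..m}. kernel P 0 (of_nat b))"
  using assms
proof (induction m rule: dec_induct)
  case (step m)
  have "(\<lambda>J. freq_sum P J (real N + 1/2) (real m + 1/2)
     + freq_sum P J (real (Suc m) - 1/2) (real (Suc m) + 1/2))
     \<longlonglongrightarrow> (\<Sum>b\<in>{N<..m}. kernel P 0 (of_nat b)) + kernel P 0 (of_nat (Suc m))"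
    by (intro tendsto_add step.IH Poisson_unit) auto
  moreover have "{N<..Suc m} = insert (Suc m) {N<..m}" using step.hyps by auto
  ultimately show ?case by (simp add: freq_sum_def sum.distrib[symmetric] add.commute)
qed (simp add: freq_sum_def)

section \<open>Evaluation of the truncated Poisson sum\<close>

lemma sum_int_up:
  fixes h :: "real \<Rightarrow> complex"
  shows "(\<Sum>j\<in>{lo..hi}. h (of_int j)) = (\<Sum>i<nat (hi - lo + 1). h (of_int lo + real i))"
  by (rule sum.reindex_bij_witness[of _ "\<lambda>i. lo + int i" "\<lambda>j. nat (j - lo)"]) auto

lemma sum_int_down:
  fixes h :: "real \<Rightarrow> complex"
  shows "(\<Sum>j\<in>{lo..hi}. h (of_int j)) = (\<Sum>i<nat (hi - lo + 1). h (of_int hi - real i))"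
  by (rule sum.reindex_bij_witness[of _ "\<lambda>i. hi - int i" "\<lambda>j. nat (hi - j)"]) auto

text \<open>
  The increment of the \<open>j\<close>-th primitive between the end points (\<open>X1\<close>,
  \<open>X2\<close>) is rerouted according to the position of the stationary point: for small
  and for negative \<open>j\<close> through the lower ends (\<open>L1\<close>,
  \<open>L2\<close>), for large \<open>j\<close> through the upper ends (\<open>U1\<close>,
  \<open>U2\<close>), and in between through the saddle \<open>R\<close> with its ends
  \<open>LR\<close> and \<open>UR\<close>. Here \<open>c j\<close> is the contribution of half
  a saddle. At \<open>j = a\<close> the saddle is at the end point, so that only half of it
  counts; the frequencies \<open>N\<close>, \<open>N + 1\<close>, \<open>N + 2\<close> have
  their saddles near the other end point and are small as a whole.
\<close>

lemma contour_decomposition: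
  fixes X1 X2 U1 U2 L1 L2 R UR LR c :: "int \<Rightarrow> complex"
  assumes "- J \<le> a - 1" "a < N" "N + 2 \<le> J"
  shows "(\<Sum>j\<in>{-J..J}. X2 j - X1 j) - (c a + (\<Sum>j\<in>{a<..<N}. 2 * c j)) =
     (\<Sum>j\<in>{-J..a-1}. X2 j - L2 j) + (\<Sum>j\<in>{-J..a-1}. L2 j - L1 j) - (\<Sum>j\<in>{-J..N-1}. X1 j - L1 j)
     + ((X2 a - R a) + (R a - LR a - c a) + (LR a - L1 a))
     - (\<Sum>j\<in>{a+1..J}. U2 j - X2 j)
     + (\<Sum>j\<in>{a<..<N}. (U2 j - UR j) + (UR j - R j - c j) + (R j - LR j - c j) + (LR j - L1 j))
     + (\<Sum>j\<in>{N..N+2}. (U2 j - UR j) + (UR j - R j) + (R j - X1 j))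
     + (\<Sum>j\<in>{N+3..J}. U2 j - U1 j) + (\<Sum>j\<in>{N+3..J}. U1 j - X1 j)"
proof -
  have s: "sum f (A \<union> B) = sum f A + sum f B" if "finite A" "finite B" "A \<inter> B = {}" for f :: "int \<Rightarrow> complex" and A B
    using that by (rule sum.union_disjoint)
  have "{-J..N-1} = {-J..a-1} \<union> ({a} \<union> {a<..<N})" using assms by auto
  hence 1: "sum f {-J..N-1} = sum f {-J..a-1} + (f a + sum f {a<..<N})" for f :: "int \<Rightarrow> complex"
    by (subst \<open>{-J..N-1} = _\<close>, subst s) (auto simp: s)
  have "{a+1..J} = {a<..<N} \<union> ({N..N+2} \<union> {N+3..J})" using assms by auto
  hence 2: "sum f {a+1..J} = sum f {a<..<N} + (sum f {N..N+2} + sum f {N+3..J})" for f :: "int \<Rightarrow> complex"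
    by (subst \<open>{a+1..J} = _\<close>, subst s) (auto intro!: s)
  have "{-J..J} = {-J..N-1} \<union> ({N..N+2} \<union> {N+3..J})" using assms by auto
  hence 3: "sum f {-J..J} = sum f {-J..N-1} + (sum f {N..N+2} + sum f {N+3..J})" for f :: "int \<Rightarrow> complex"
    by (subst \<open>{-J..J} = _\<close>, subst s) (auto intro!: s)
  show ?thesis
    unfolding 1 2 3 sum.distrib sum_subtractf sum_distrib_left[symmetric] by (simp add: algebra_simps)
qed

lemma primitive_real_diff_le:
  assumes "0 < M" "M \<le> x" "M \<le> y" "\<bar>x - y\<bar> \<le> d"
  shows "norm (primitive P \<xi> (of_real x) - primitive P \<xi> (of_real y)) \<le> d / sqrt M"
proof -
  have *: "norm (primitive P \<xi> (of_real y) - primitive P \<xi> (of_real x)) \<le> d / sqrt M"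
    if "M \<le> x" "x \<le> y" "\<bar>x - y\<bar> \<le> d" for x y
  proof -
    have "norm ((\<lambda>t. primitive P \<xi> (of_real t)) y - (\<lambda>t. primitive P \<xi> (of_real t)) x) \<le> 1 / sqrt M * (y - x)"
    proof (rule norm_diff_le_const)
      fix t assume t: "t \<in> {x..y}"
      have "((\<lambda>t. of_real t :: complex) has_vector_derivative 1) (at t within {x..y})"
        by (auto intro!: derivative_eq_intros simp: has_vector_derivative_of_real)
      thus "((\<lambda>t. primitive P \<xi> (of_real t)) has_vector_derivative (1 * kernel P \<xi> (of_real t))) (at t within {x..y})"
        by (intro primitive_along_path) (use t that assms in auto)
      show "norm (1 * kernel P \<xi> (complex_of_real t)) \<le> 1 / sqrt M"
        using t that assms by (simp add: norm_kernel_real frac_le)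
    qed fact
    also have "\<dots> \<le> 1 / sqrt M * d" using that assms by (intro mult_left_mono) auto
    finally show ?thesis by simp
  qed
  show ?thesis
  proof (cases "x \<le> y")
    case True
    thus ?thesis using *[of x y] assms by (simp add: norm_minus_commute)
  next
    case False
    thus ?thesis using *[of y x] assms by (simp add: abs_minus_commute)
  qed
qed

lemma sum_inverse_sqrt_le: "(\<Sum>j\<in>{1..n}. 1 / sqrt (real j)) \<le> 2 * sqrt (real n)"
proof (induction n)
  case (Suc n)
  have "1 / sqrt (real (Suc n)) \<le> 2 * (sqrt (real (Suc n)) - sqrt (real n))"
  proof -
    have "sqrt (real (Suc n)) + sqrt (real n) \<le> 2 * sqrt (real (Suc n))" by simp
    moreover have "(sqrt (real (Suc n)) - sqrt (real n)) * (sqrt (real (Suc n)) + sqrt (real n)) = 1"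
      by (simp add: algebra_simps)
    moreover have "sqrt (real (Suc n)) - sqrt (real n) \<ge> 0" by simp
    ultimately have "1 \<le> (sqrt (real (Suc n)) - sqrt (real n)) * (2 * sqrt (real (Suc n)))"
      by (metis mult_left_mono)
    also have "\<dots> = (2 * (sqrt (real (Suc n)) - sqrt (real n))) * sqrt (real (Suc n))"
      by (simp only: mult_ac)
    finally show ?thesis by (subst divide_le_eq) simp
  qed
  thus ?case using Suc by simp
qed simp

text \<open>
  The contribution of one half of the saddle of frequency \<open>j\<close>.
\<close>

definition half_saddle :: "real \<Rightarrow> real \<Rightarrow> complex" where
  "half_saddle P j = saddle_factor P (P / j) / (2 * sqrt (2 * P))"

lemma norm_half_saddle:
  assumes "P > 0" "j > 0" shows "norm (half_saddle P j) = 1 / (2 * sqrt j)"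
proof -
  have "norm (half_saddle P j) = sqrt 2 * sqrt (P / j) / (2 * (sqrt 2 * sqrt P))"
    using assms norm_saddle_factor[of "P / j" P] by (simp add: half_saddle_def norm_divide norm_mult real_sqrt_mult)
  thus ?thesis using assms by (simp add: real_sqrt_divide)
qed

lemma times_exp_minus_le:
  assumes "P > 0" shows "P * exp (- P) \<le> 2 / (P :: real)"
proof -
  have "P\<^sup>2 / 2 \<le> exp P" using exp_lower_Taylor_quadratic[of P] assms by simp
  thus ?thesis using assms by (simp add: exp_minus field_simps power2_eq_square)
qed


text \<open>
  Main terms come from the saddles of frequency \<open>a < j < N\<close> and from half of the
  saddle at \<open>a\<close>. The bound is uniform in \<open>J\<close>.
\<close>

lemma truncated_Poisson_bound:
  fixes P :: real and N a m J :: nat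
  assumes N: "N \<ge> 4" and P: "real N ^ 2 < P" "P \<le> (real N + 1)\<^sup>2"
    and a: "1 \<le> a" "a < N" and m: "real m < P / real a" "P / real a \<le> real m + 1"
    and J: "N + 3 \<le> J"
  shows "norm (freq_sum P J (real N + 1/2) (real m + 1/2)
     - (half_saddle P (real a) + (\<Sum>j\<in>{int a<..<int N}. 2 * half_saddle P (of_int j)))) \<le> 500 / sqrt (real N)"
proof -
  define x1 where "x1 = real N + 1/2"
  define x2 where "x2 = real m + 1/2"
  define s where "s = 1 / sqrt (real N)"
  define X1 where "X1 = (\<lambda>j::int. primitive P (of_int j) (of_real x1))"
  define X2 where "X2 = (\<lambda>j::int. primitive P (of_int j) (of_real x2))"
  define U1 where "U1 = (\<lambda>j::int. primitive P (of_int j) (Complex x1 (2 * P)))"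
  define U2 where "U2 = (\<lambda>j::int. primitive P (of_int j) (Complex x2 (2 * P)))"
  define L1 where "L1 = (\<lambda>j::int. primitive P (of_int j) (Complex (x1/2) (- x1/2)))"
  define L2 where "L2 = (\<lambda>j::int. primitive P (of_int j) (Complex (x2/2) (- x2/2)))"
  define \<rho> where "\<rho> = (\<lambda>j::int. P / of_int j)"
  define R where "R = (\<lambda>j::int. primitive P (of_int j) (of_real (\<rho> j)))"
  define UR where "UR = (\<lambda>j::int. primitive P (of_int j) (Complex (\<rho> j + 2 * P) (2 * P)))"
  define LR where "LR = (\<lambda>j::int. primitive P (of_int j) (Complex (\<rho> j/2) (- \<rho> j/2)))"
  define c where "c = (\<lambda>j::int. half_saddle P (of_int j))"
  have N2: "real N ^ 2 = real N * real N" "(real N + 1)\<^sup>2 = real N * real N + 2 * real N + 1"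
    by (simp_all add: power2_eq_square algebra_simps)
  have N4: "real N \<ge> 4" using N by simp
  have NN: "real N * 4 \<le> real N * real N" using N4 by (intro mult_left_mono) auto
  have PN: "P \<ge> real N" "P \<ge> 1" "P > 0" using P N4 NN unfolding N2 by linarith+
  have a1: "real a \<ge> 1" "real a \<le> real N - 1" using a by auto
  have aN: "(real N + 1) * real a < P"
  proof -
    have "(real N + 1) * real a \<le> (real N + 1) * (real N - 1)" using a1 by (intro mult_left_mono) auto
    also have "\<dots> < P" using P unfolding N2 by (simp add: algebra_simps)
    finally show ?thesis .
  qed
  have Pa: "P / real a > real N + 1" using aN a1 by (simp add: field_simps)
  have PaP: "P / real a \<le> P" using PN a1 by (simp add: field_simps)
  have mN: "m \<ge> N" using m Pa by linarith
  have x1: "x1 \<ge> real N" "x1 \<ge> 1" "x1 > 0" using N4 by (auto simp: x1_def)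
  have x2: "x2 \<ge> x1" "x2 \<ge> real N" "x2 > 0" using mN x1 by (auto simp: x1_def x2_def)
  have x2P: "\<bar>x2 - P / real a\<bar> \<le> 1/2" "x2 \<le> P + 1/2" using m PaP unfolding x2_def by linarith+
  have s: "s > 0" "s \<le> 1" using N4 by (auto simp: s_def)
  have sqrt_le: "1 / sqrt x \<le> s" if "x \<ge> real N" for x
    using that N4 by (simp add: s_def frac_le)
  have invN: "1 / real N \<le> s"
  proof -
    have "sqrt (real N) \<le> real N" using N4 by (intro real_le_lsqrt) (auto simp: power2_eq_square)
    thus ?thesis using N4 unfolding s_def by (intro divide_left_mono) auto
  qed
  have tiny: "P * exp (- P) \<le> 2 / (real N)\<^sup>2"
  proof -
    have "P * exp (- P) \<le> 2 / P" using PN by (intro times_exp_minus_le)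
    also have "\<dots> \<le> 2 / (real N)\<^sup>2" using P N4 PN by (intro divide_left_mono mult_pos_pos) auto
    finally show ?thesis .
  qed
  have tiny1: "P * exp (- P) \<le> s"
  proof -
    have "2 / (real N)\<^sup>2 = (2 / real N) * (1 / real N)" by (simp add: power2_eq_square)
    also have "\<dots> \<le> 1 * (1 / real N)" using N4 by (intro mult_right_mono) auto
    finally show ?thesis using tiny invN by linarith
  qed
  have exp2: "exp (- 2 * P) \<le> exp (- P)" using PN by simp
  \<comment> \<open>The stationary frequencies at the two ends: \<open>P / x1\<close> lies between \<open>N -
  1/2\<close> and \<open>N + 2\<close>, and \<open>P / x2\<close> is within \<open>1/2\<close>
  of \<open>a\<close>. This decides which frequencies are rerouted downwards or upwards at each
  end.\<close>
  have y1: "P / x1 - (real N - 1) \<ge> 1/2" "real N + 3 - P / x1 \<ge> 1"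
  proof -
    have "(real N - 1/2) * x1 \<le> P" using P unfolding N2 x1_def by (simp add: algebra_simps)
    hence "real N - 1/2 \<le> P / x1" using x1 by (simp add: le_divide_eq)
    thus "P / x1 - (real N - 1) \<ge> 1/2" by linarith
    have "P \<le> (real N + 2) * x1" using P N4 unfolding N2 x1_def by (simp add: algebra_simps)
    hence "P / x1 \<le> real N + 2" using x1 by (simp add: divide_le_eq)
    thus "real N + 3 - P / x1 \<ge> 1" by simp
  qed
  have y2: "P / x2 - (real a - 1) \<ge> 1/2" "real a + 1 - P / x2 \<ge> 1/2"
  proof -
    have "\<bar>x2 - P / real a\<bar> * real a \<le> 1/2 * real a" using x2P a1 by (intro mult_right_mono) auto
    hence *: "\<bar>x2 * real a - P\<bar> \<le> real a / 2" using a1 by (simp add: abs_mult_pos field_simps)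
    have "real a \<le> x2" using a1 x2 by linarith
    hence "real a / 2 \<le> x2 / 2" by simp
    hence "x2 * real a - x2 / 2 \<le> P" "P \<le> x2 * real a + x2 / 2" using * by linarith+
    hence "(real a - 1/2) * x2 \<le> P" "P \<le> (real a + 1/2) * x2" by (simp_all add: algebra_simps)
    hence "real a - 1/2 \<le> P / x2" "P / x2 \<le> real a + 1/2" using x2 by (auto simp: field_simps)
    thus "P / x2 - (real a - 1) \<ge> 1/2" "real a + 1 - P / x2 \<ge> 1/2" by linarith+
  qed
  have frac_s: "C / (2 * pi * d * sqrt x) \<le> C * s" if "x \<ge> real N" "d \<ge> 1/2" "C \<ge> 0" for C d x :: real
  proof -
    have "1 * sqrt x \<le> (2 * pi * d) * sqrt x"
    proof (rule mult_right_mono)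
      have "3 * (1/2) \<le> pi * d" using pi_gt3 that by (intro mult_mono) auto
      thus "1 \<le> 2 * pi * d" by simp
    qed (use that N4 in auto)
    hence "C / (2 * pi * d * sqrt x) \<le> C / sqrt x" using that N4 by (intro divide_left_mono) auto
    also have "\<dots> = C * (1 / sqrt x)" by simp
    also have "\<dots> \<le> C * s" using sqrt_le that by (intro mult_left_mono) auto
    finally show ?thesis .
  qed
  have B1: "norm (\<Sum>j\<in>{-int J..int a - 1}. X2 j - L2 j) \<le> 16 * s"
  proof -
    have "norm (\<Sum>j\<in>{-int J..int a - 1}. X2 j - L2 j) \<le> 16 / (2 * pi * (P / x2 - (real a - 1)) * sqrt x2)"
      using lower_tail[OF x2_def, of P "real a - 1"] y2 PN unfolding X2_def L2_def 
      by (subst sum_int_down[of "\<lambda>j. primitive P j (of_real x2) - primitive P j (Complex (x2/2) (- x2/2))"]) simp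
    also have "\<dots> \<le> 16 * s" using y2 x2 by (intro frac_s) auto
    finally show ?thesis .
  qed
  have B3: "norm (\<Sum>j\<in>{-int J..int N - 1}. X1 j - L1 j) \<le> 16 * s"
  proof -
    have "norm (\<Sum>j\<in>{-int J..int N - 1}. X1 j - L1 j) \<le> 16 / (2 * pi * (P / x1 - (real N - 1)) * sqrt x1)"
      using lower_tail[OF x1_def, of P "real N - 1"] y1 PN unfolding X1_def L1_def 
      by (subst sum_int_down[of "\<lambda>j. primitive P j (of_real x1) - primitive P j (Complex (x1/2) (- x1/2))"]) simp
    also have "\<dots> \<le> 16 * s" using y1 x1 by (intro frac_s) auto
    finally show ?thesis .
  qed
  have B5: "norm (\<Sum>j\<in>{int a + 1..int J}. U2 j - X2 j) \<le> 4 * s"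
  proof -
    have "norm (\<Sum>j\<in>{int a + 1..int J}. U2 j - X2 j) \<le> 4 / (2 * pi * (real a + 1 - P / x2) * sqrt x2)"
      using upper_tail[OF x2_def, of P "real a + 1" "2 * P"] y2 PN unfolding X2_def U2_def 
      by (subst sum_int_up[of "\<lambda>j. primitive P j (Complex x2 (2 * P)) - primitive P j (of_real x2)"]) simp
    also have "\<dots> \<le> 4 * s" using y2 x2 by (intro frac_s) auto
    finally show ?thesis .
  qed
  have B9: "norm (\<Sum>j\<in>{int N + 3..int J}. U1 j - X1 j) \<le> 4 * s"
  proof -
    have "norm (\<Sum>j\<in>{int N + 3..int J}. U1 j - X1 j) \<le> 4 / (2 * pi * (real N + 3 - P / x1) * sqrt x1)"
      using upper_tail[OF x1_def, of P "real N + 3" "2 * P"] y1 PN unfolding X1_def U1_def 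
      by (subst sum_int_up[of "\<lambda>j. primitive P j (Complex x1 (2 * P)) - primitive P j (of_real x1)"]) simp
    also have "\<dots> \<le> 4 * s" using y1 x1 by (intro frac_s) linarith+
    finally show ?thesis .
  qed
  have B2: "norm (\<Sum>j\<in>{-int J..int a - 1}. L2 j - L1 j) \<le> 8 * s"
  proof -
    have "(real a - 1) * x2 \<le> P" using y2(1) x2 by (simp add: field_simps) 
    hence "norm (\<Sum>j\<in>{-int J..int a - 1}. L2 j - L1 j) \<le> 8 * exp (- P) * (x2 - x1)"
      using ray_connection[of P "real a - 1" x1 x2] x1 x2 a1 PN unfolding L1_def L2_def 
      by (subst sum_int_down[of "\<lambda>j. primitive P j (Complex (x2/2) (- x2/2)) - primitive P j (Complex (x1/2) (- x1/2))"]) simp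
    also have "\<dots> \<le> 8 * exp (- P) * P" using x2P x1 N4 by (intro mult_left_mono) auto
    also have "\<dots> \<le> 8 * s" using tiny1 by (simp add: mult.commute)
    finally show ?thesis .
  qed
  have B8: "norm (\<Sum>j\<in>{int N + 3..int J}. U2 j - U1 j) \<le> 4 * s"
  proof -
    have "norm (\<Sum>j\<in>{int N + 3..int J}. U2 j - U1 j) \<le> 4 * exp (- 2 * P) * (x2 - x1)"
      using upper_connection[of P "real N + 3" x1 x2] x1 x2 PN unfolding U1_def U2_def 
      by (subst sum_int_up[of "\<lambda>j. primitive P j (Complex x2 (2 * P)) - primitive P j (Complex x1 (2 * P))"]) simp
    also have "\<dots> \<le> 4 * exp (- P) * P" using x2P x1 x2 N4 exp2 by (intro mult_mono) auto
    also have "\<dots> \<le> 4 * s" using tiny1 by (simp add: mult.commute)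
    finally show ?thesis .
  qed
  have LR: "norm (LR j - L1 j) \<le> 8 * (P * exp (- P))" if j: "1 \<le> j" "j < int N" for j
  proof -
    have j': "real_of_int j \<ge> 1" "real_of_int j \<le> real N - 1" using j by linarith+
    have "x1 * of_int j \<le> x1 * (real N - 1)" using j' x1 by (intro mult_left_mono) auto
    also have "\<dots> = real N * real N - real N / 2 - 1/2" unfolding x1_def by (simp add: field_simps)
    also have "\<dots> \<le> P" using P N4 unfolding N2 by linarith
    finally have "x1 \<le> \<rho> j" using j' by (simp add: \<rho>_def field_simps)
    moreover have "of_int j * \<rho> j = P" using j by (simp add: \<rho>_def)
    moreover have "\<rho> j \<le> P" using PN j' by (simp add: \<rho>_def field_simps)
    ultimately have "norm (LR j - L1 j) \<le> 8 * exp (- P) * (\<rho> j - x1)"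
      using ray_connection[of P "of_int j" x1 "\<rho> j" 1] x1 PN j' by (simp add: LR_def L1_def)
    also have "\<dots> \<le> 8 * exp (- P) * P" using \<open>\<rho> j \<le> P\<close> x1 by (intro mult_left_mono) auto
    finally show ?thesis by (simp add: mult_ac)
  qed
  have UR: "norm (U2 j - UR j) \<le> 12 * (P * exp (- P))" if j: "1 \<le> j" for j
  proof -
    have j': "real_of_int j \<ge> 1" using j by linarith
    have r: "\<rho> j \<le> P" "\<rho> j > 0" using PN j' by (auto simp: \<rho>_def field_simps)
    have "norm (UR j - U2 j) \<le> 4 * exp (- 2 * P) * (\<rho> j + 2 * P - x2)"
      using upper_connection[of P "of_int j" x2 "\<rho> j + 2 * P" 1] x1 x2 PN r x2P j' by (simp add: UR_def U2_def)
    also have "\<dots> \<le> 4 * exp (- P) * (3 * P)" using exp2 r x2 x2P PN by (intro mult_mono) auto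
    finally show ?thesis by (simp add: norm_minus_commute mult_ac)
  qed
  have Rr: "\<rho> j > 0" "\<rho> j \<le> P" "P / \<rho> j = of_int j" "c j = saddle_factor P (\<rho> j) / (2 * sqrt (2 * P))" if "1 \<le> j" for j
    using that PN by (auto simp: \<rho>_def field_simps c_def half_saddle_def)
  have sr: "sqrt (\<rho> j) / P \<le> 1 / (real N * sqrt (of_int j))" if "1 \<le> j" for j
  proof -
    have "sqrt (\<rho> j) / P = 1 / (sqrt P * sqrt (of_int j))"
      using PN that by (simp add: \<rho>_def real_sqrt_divide field_simps)
    also have "real N \<le> sqrt P" using P by (intro real_le_rsqrt) simp
    hence "1 / (sqrt P * sqrt (of_int j)) \<le> 1 / (real N * sqrt (of_int j))"
      using that N4 PN by (intro divide_left_mono mult_right_mono mult_pos_pos) auto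
    finally show ?thesis .
  qed
  have sr1: "sqrt (\<rho> j) / P \<le> s" if "1 \<le> j" for j
  proof -
    have "1 / (real N * sqrt (of_int j)) \<le> 1 / (real N * 1)"
      using that N4 by (intro divide_left_mono mult_left_mono) auto
    thus ?thesis using sr[OF that] invN by simp
  qed
  have SL: "norm (R j - LR j - c j) \<le> 17 * (sqrt (\<rho> j) / P)" if "1 \<le> j" for j
    using saddle_lower[OF PN(2) Rr(1)[OF that]] Rr[OF that] by (simp add: R_def LR_def)
  have SU: "norm (UR j - R j - c j) \<le> 20 * (sqrt (\<rho> j) / P)" if "1 \<le> j" for j
    using saddle_upper[OF PN(2) Rr(1,2)[OF that]] Rr[OF that] by (simp add: R_def UR_def)
  have B4: "norm ((X2 a - R a) + (R a - LR a - c a) + (LR a - L1 a)) \<le> s + 17 * s + 8 * s"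
  proof (intro norm_triangle_mono)
    have "norm (X2 (int a) - R (int a)) \<le> 1 / sqrt (real N)"
      unfolding X2_def R_def \<rho>_def using x2P x2 Pa N4 by (intro primitive_real_diff_le) auto
    thus "norm (X2 (int a) - R (int a)) \<le> s" by (simp add: s_def)
    show "norm (R (int a) - LR (int a) - c (int a)) \<le> 17 * s"
      using SL[of "int a"] sr1[of "int a"] a by simp
    show "norm (LR (int a) - L1 (int a)) \<le> 8 * s" using LR[of "int a"] a tiny1 by simp
  qed
  \<comment> \<open>The saddle errors \<open>sqrt (\<rho> j) / P \<le> 1 / (N sqrt j)\<close> add up to
  \<open>O(N^(-1/2))\<close>.\<close>
  have B6: "norm (\<Sum>j\<in>{int a<..<int N}. (U2 j - UR j) + (UR j - R j - c j) + (R j - LR j - c j) + (LR j - L1 j)) \<le> 114 * s"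
  proof -
    have "norm (\<Sum>j\<in>{int a<..<int N}. (U2 j - UR j) + (UR j - R j - c j) + (R j - LR j - c j) + (LR j - L1 j))
       \<le> (\<Sum>j\<in>{int a<..<int N}. 40 / (real N)\<^sup>2 + 37 * (1 / (real N * sqrt (of_int j))))"
    proof (rule sum_norm_le)
      fix j assume "j \<in> {int a<..<int N}"
      hence j: "1 \<le> j" "j < int N" using a by auto
      have "norm ((U2 j - UR j) + (UR j - R j - c j) + (R j - LR j - c j) + (LR j - L1 j))
         \<le> 12 * (P * exp (- P)) + 20 * (sqrt (\<rho> j) / P) + 17 * (sqrt (\<rho> j) / P) + 8 * (P * exp (- P))"
        by (intro norm_triangle_mono UR SU SL LR j)
      also have "\<dots> \<le> 40 / (real N)\<^sup>2 + 37 * (1 / (real N * sqrt (of_int j)))"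
        using tiny sr[OF j(1)] by linarith
      finally show "norm ((U2 j - UR j) + (UR j - R j - c j) + (R j - LR j - c j) + (LR j - L1 j)) \<le> 
         40 / (real N)\<^sup>2 + 37 * (1 / (real N * sqrt (of_int j)))" .
    qed
    also have "\<dots> \<le> (\<Sum>j\<in>{1..N}. 40 / (real N)\<^sup>2 + 37 * (1 / (real N * sqrt (real j))))"
    proof -
      have "(\<Sum>j\<in>{int a<..<int N}. 40 / (real N)\<^sup>2 + 37 * (1 / (real N * sqrt (of_int j)))) = 
         (\<Sum>j\<in>{a<..<N}. 40 / (real N)\<^sup>2 + 37 * (1 / (real N * sqrt (real j))))"
        by (rule sum.reindex_bij_witness[of _ int nat]) auto
      also have "\<dots> \<le> (\<Sum>j\<in>{1..N}. 40 / (real N)\<^sup>2 + 37 * (1 / (real N * sqrt (real j))))"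
        by (intro sum_mono2) auto
      finally show ?thesis .
    qed
    also have "\<dots> = 40 / real N + 37 / real N * (\<Sum>j\<in>{1..N}. 1 / sqrt (real j))"
      using N4 by (simp add: sum.distrib sum_distrib_left power2_eq_square)
    also have "\<dots> \<le> 40 / real N + 37 / real N * (2 * sqrt (real N))"
      by (intro add_left_mono mult_left_mono sum_inverse_sqrt_le) auto
    also have "37 / real N * (2 * sqrt (real N)) = 74 * s"
    proof -
      have "real N = sqrt (real N) * sqrt (real N)" by simp
      thus ?thesis using N4 unfolding s_def by (simp add: field_simps)
    qed
    also have "40 / real N = 40 * (1 / real N)" by simp
    finally show ?thesis using invN by linarith
  qed
  \<comment> \<open>These saddles lie within \<open>3\<close> of \<open>x1\<close>, so the real segment between
  them and \<open>x1\<close> is trivially small.\<close>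
  have B7: "norm (\<Sum>j\<in>{int N..int N + 2}. (U2 j - UR j) + (UR j - R j) + (R j - X1 j)) \<le> 3 * (40 * s)"
  proof -
    have "norm (\<Sum>j\<in>{int N..int N + 2}. (U2 j - UR j) + (UR j - R j) + (R j - X1 j)) \<le> (\<Sum>j\<in>{int N..int N + 2}. 40 * s)"
    proof (rule sum_norm_le)
      fix j assume j0: "j \<in> {int N..int N + 2}"
      hence j: "1 \<le> j" using N by auto
      have j': "real_of_int j \<ge> real N" "real_of_int j \<le> real N + 2" using j0 by auto
      have "norm (UR j - R j) \<le> norm (UR j - R j - c j) + norm (c j)"
        using norm_triangle_ineq[of "UR j - R j - c j" "c j"] by simp
      also have "\<dots> \<le> 20 * (sqrt (\<rho> j) / P) + 1 / sqrt (of_int j)"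
      proof (intro add_mono SU[OF j])
        have "norm (c j) = 1 / (2 * sqrt (of_int j))" using norm_half_saddle[of P "of_int j"] j PN by (simp add: c_def)
        also have "\<dots> \<le> 1 / sqrt (of_int j)" using j by (intro divide_left_mono) auto
        finally show "norm (c j) \<le> 1 / sqrt (of_int j)" .
      qed
      also have "\<dots> \<le> 20 * s + s" using sr1[OF j] sqrt_le[OF j'(1)] by linarith
      finally have 1: "norm (UR j - R j) \<le> 21 * s" by simp
      have "real N - 2 \<le> \<rho> j"
      proof -
        have "(real N - 2) * of_int j \<le> (real N - 2) * (real N + 2)" using j' N4 by (intro mult_left_mono) auto
        also have "\<dots> \<le> P" using P unfolding N2 by (simp add: algebra_simps)
        finally show ?thesis using j by (simp add: \<rho>_def le_divide_eq)
      qed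
      moreover have "\<rho> j \<le> real N + 3"
      proof -
        have "P \<le> (real N + 3) * real N" using P N4 unfolding N2 by (simp add: algebra_simps)
        also have "\<dots> \<le> (real N + 3) * of_int j" using j' by (intro mult_left_mono) auto
        finally show ?thesis using j by (simp add: \<rho>_def divide_le_eq)
      qed
      ultimately have "norm (R j - X1 j) \<le> 3 / sqrt (real N / 4)"
        unfolding R_def X1_def using N4 x1 by (intro primitive_real_diff_le) (auto simp: x1_def abs_if)
      also have "\<dots> = 6 * s" by (simp add: s_def real_sqrt_divide)
      finally have 2: "norm (R j - X1 j) \<le> 6 * s" .
      have "norm ((U2 j - UR j) + (UR j - R j) + (R j - X1 j)) \<le> 12 * (P * exp (- P)) + 21 * s + 6 * s"
        by (intro norm_triangle_mono UR j 1 2)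
      thus "norm ((U2 j - UR j) + (UR j - R j) + (R j - X1 j)) \<le> 40 * s" using tiny1 s by linarith
    qed
    thus ?thesis by simp
  qed
  have "norm ((\<Sum>j\<in>{-int J..int J}. X2 j - X1 j) - (c a + (\<Sum>j\<in>{int a<..<int N}. 2 * c j)))
      \<le> 16 * s + 8 * s + 16 * s + (s + 17 * s + 8 * s) + 4 * s + 114 * s + 3 * (40 * s) + 4 * s + 4 * s"
  proof (subst contour_decomposition[where R = R and LR = LR and UR = UR and ?U1.0 = U1 and ?U2.0 = U2 and ?L1.0 = L1 and ?L2.0 = L2])
    show "- int J \<le> int a - 1" "int a < int N" "int N + 2 \<le> int J" using a J by auto
  qed (intro norm_triangle_mono order_trans[OF norm_triangle_ineq4 add_mono] B1 B2 B3 B4 B5 B6 B7 B8 B9)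
  also have "\<dots> \<le> 500 * s" using s by simp
  finally show ?thesis unfolding freq_sum_def X1_def X2_def x1_def x2_def c_def s_def by simp
qed

section \<open>Reflection of a partial sum of the zeta series\<close>

text \<open>
  This is \<open>n^(-s)\<close> for \<open>s = 1/2 + i T\<close>.
\<close>

definition osc :: "real \<Rightarrow> nat \<Rightarrow> complex" where
  "osc T n = of_real (1 / sqrt (real n)) * cis (- (T * ln (real n)))"

text \<open>
  The conjugate is the factor of the functional equation of the zeta function at \<open>1/2 + i
  T\<close>, up to a relative error \<open>O(1 / T)\<close>.
\<close>

definition omega :: "real \<Rightarrow> complex" where
  "omega T = cis (T * ln (T / (2 * pi)) - T - pi / 4)"

lemma norm_osc: "norm (osc T n) = 1 / sqrt (real n)"
  unfolding osc_def norm_mult by (simp add: norm_divide)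

lemma norm_omega: "norm (omega T) = 1" by (simp add: omega_def)

lemma osc_mult: "a \<ge> 1 \<Longrightarrow> b \<ge> 1 \<Longrightarrow> osc T (a * b) = osc T a * osc T b"
  by (simp add: osc_def real_sqrt_mult ln_mult cis_mult algebra_simps)

lemma kernel_eq_osc:
  assumes "b \<ge> 1"
  shows "kernel P 0 (of_nat b) = osc (2 * pi * P) b"
proof -
  have b: "real b > 0" using assms by simp
  have "Ln (of_real (real b)) = of_real (ln (real b))" using b by (intro Ln_of_real)
  hence "Ln (of_nat b) = of_real (ln (real b))" by simp
  hence "kernel P 0 (of_nat b) = exp (of_real (- (ln (real b) / 2)) + \<i> * of_real (- (2 * pi * P * ln (real b))))"
    unfolding kernel_def by (intro arg_cong[of _ _ exp]) (simp add: algebra_simps)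
  also have "\<dots> = of_real (exp (- (ln (real b) / 2))) * cis (- (2 * pi * P * ln (real b)))"
    unfolding exp_add cis_conv_exp exp_of_real[symmetric] by simp
  also have "exp (- (ln (real b) / 2)) = 1 / sqrt (real b)"
  proof -
    have "ln (sqrt (real b)) = ln (real b) / 2" using b by (simp add: ln_sqrt)
    thus ?thesis using b by (metis exp_ln exp_minus inverse_eq_divide real_sqrt_gt_zero)
  qed
  finally show ?thesis by (simp add: osc_def)
qed

lemma half_saddle_eq_osc:
  assumes "P > 0" "j \<ge> 1"
  shows "half_saddle P (real j) = cnj (omega (2 * pi * P)) * cnj (osc (2 * pi * P) j) / 2"
proof -
  define \<rho> where "\<rho> = P / real j"
  have \<rho>: "\<rho> > 0" using assms by (simp add: \<rho>_def)
  have "exp (2 * pi * \<i> * P - (1/2 + 2 * pi * \<i> * P) * of_real (ln \<rho>)) = 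
        exp (of_real (- (ln \<rho> / 2)) + \<i> * of_real (2 * pi * P - 2 * pi * P * ln \<rho>))"
    by (intro arg_cong[of _ _ exp]) (simp add: algebra_simps)
  also have "\<dots> = of_real (exp (- (ln \<rho> / 2))) * cis (2 * pi * P - 2 * pi * P * ln \<rho>)"
    unfolding exp_add cis_conv_exp exp_of_real[symmetric] by simp
  also have "exp (- (ln \<rho> / 2)) = 1 / sqrt \<rho>"
  proof -
    have "ln (sqrt \<rho>) = ln \<rho> / 2" using \<rho> by (simp add: ln_sqrt)
    thus ?thesis using \<rho> by (metis exp_ln exp_minus inverse_eq_divide real_sqrt_gt_zero)
  qed
  finally have e: "exp (2 * pi * \<i> * P - (1/2 + 2 * pi * \<i> * P) * of_real (ln \<rho>)) = of_real (1 / sqrt \<rho>) * cis (2 * pi * P - 2 * pi * P * ln \<rho>)" .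
  have i: "1 + \<i> = of_real (sqrt 2) * cis (pi / 4)"
    by (simp add: complex_eq_iff cos_45 sin_45)
  have "half_saddle P (real j) = of_real (\<rho> * sqrt 2 * (1 / sqrt \<rho>) / (2 * sqrt (2 * P))) * (cis (pi / 4) * cis (2 * pi * P - 2 * pi * P * ln \<rho>))"
    unfolding half_saddle_def saddle_factor_def \<rho>_def[symmetric] e i by simp
  also have "\<rho> * sqrt 2 * (1 / sqrt \<rho>) / (2 * sqrt (2 * P)) = 1 / sqrt (real j) / 2"
  proof -
    have "\<rho> * sqrt 2 * (1 / sqrt \<rho>) / (2 * sqrt (2 * P)) = (\<rho> / sqrt \<rho>) * (sqrt 2 / sqrt (2 * P)) / 2" by simp
    also have "\<rho> / sqrt \<rho> = sqrt \<rho>" using \<rho> by (intro real_div_sqrt less_imp_le)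
    also have "sqrt \<rho> * (sqrt 2 / sqrt (2 * P)) = 1 / sqrt (real j)" 
      using assms by (simp add: \<rho>_def real_sqrt_divide real_sqrt_mult)
    finally show ?thesis .
  qed
  also have "cis (pi / 4) * cis (2 * pi * P - 2 * pi * P * ln \<rho>) = 
     cis (- (2 * pi * P * ln (2 * pi * P / (2 * pi)) - 2 * pi * P - pi / 4)) * cis (2 * pi * P * ln (real j))"
    unfolding cis_mult using assms by (intro arg_cong[of _ _ cis]) (simp add: \<rho>_def ln_div algebra_simps)
  finally show ?thesis by (simp add: omega_def osc_def cis_cnj)
qed

text \<open>
  The terms above and below the diagonal of \<open>\<bar>\<Sum> f a\<bar>^2\<close> are complex
  conjugates of each other. This accounts for the half weight at \<open>j = a\<close>.
\<close>

lemma sum_triangle_norm_sq: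
  fixes f :: "nat \<Rightarrow> complex"
  shows "2 * Re (\<Sum>a\<in>{1..N}. f a * (cnj (f a) / 2 + (\<Sum>j\<in>{a<..N}. cnj (f j)))) = (norm (\<Sum>a\<in>{1..N}. f a))\<^sup>2"
proof (induction N)
  case (Suc N)
  define A where "A = (\<Sum>a\<in>{1..N}. f a)"
  have "(\<Sum>a\<in>{1..Suc N}. f a * (cnj (f a) / 2 + (\<Sum>j\<in>{a<..Suc N}. cnj (f j)))) =
     (\<Sum>a\<in>{1..N}. f a * (cnj (f a) / 2 + (\<Sum>j\<in>{a<..Suc N}. cnj (f j)))) + f (Suc N) * (cnj (f (Suc N)) / 2)"
    by simp
  also have "(\<Sum>a\<in>{1..N}. f a * (cnj (f a) / 2 + (\<Sum>j\<in>{a<..Suc N}. cnj (f j)))) =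
     (\<Sum>a\<in>{1..N}. f a * (cnj (f a) / 2 + (\<Sum>j\<in>{a<..N}. cnj (f j))) + f a * cnj (f (Suc N)))"
  proof (intro sum.cong refl)
    fix a assume "a \<in> {1..N}"
    hence "{a<..Suc N} = insert (Suc N) {a<..N}" by auto
    thus "f a * (cnj (f a) / 2 + (\<Sum>j\<in>{a<..Suc N}. cnj (f j))) = f a * (cnj (f a) / 2 + (\<Sum>j\<in>{a<..N}. cnj (f j))) + f a * cnj (f (Suc N))"
      by (simp add: algebra_simps)
  qed
  also have "\<dots> = (\<Sum>a\<in>{1..N}. f a * (cnj (f a) / 2 + (\<Sum>j\<in>{a<..N}. cnj (f j)))) + A * cnj (f (Suc N))"
    by (simp add: sum.distrib A_def sum_distrib_right)
  finally have "2 * Re (\<Sum>a\<in>{1..Suc N}. f a * (cnj (f a) / 2 + (\<Sum>j\<in>{a<..Suc N}. cnj (f j)))) =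
     (norm A)\<^sup>2 + 2 * Re (A * cnj (f (Suc N))) + Re (f (Suc N) * cnj (f (Suc N)))"
    using Suc by (simp add: A_def)
  also have "\<dots> = (norm (A + f (Suc N)))\<^sup>2"
    unfolding cmod_power2 by (simp add: power2_eq_square algebra_simps)
  finally show ?case by (simp add: A_def)
qed simp

definition zeta_poly :: "nat \<Rightarrow> real \<Rightarrow> complex" where
  "zeta_poly N T = (\<Sum>a\<in>{1..N}. osc T a)"

definition rs_theta :: "real \<Rightarrow> real" where
  "rs_theta T = (T * ln (T / (2 * pi)) - T - pi / 4) / 2"

text \<open>
  The main sum of the Riemann-Siegel formula for Hardy's function. The length \<open>N\<close>
  is a separate argument, so that the function is continuous in \<open>T\<close>; it
  approximates Hardy's function where \<open>N^2 < T / (2 pi) \<le> (N + 1)^2\<close>.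
\<close>

definition RS_Z :: "nat \<Rightarrow> real \<Rightarrow> real" where
  "RS_Z N T = 2 * Re (cis (rs_theta T) * zeta_poly N T)"

definition S_limit :: "real \<Rightarrow> real" where
  "S_limit T = 2 * Re (omega T * (\<Sum>n | 0 < n \<and> real n < T / (2 * pi). of_nat (divisor_count n) * osc T n))"

lemma finite_nat_less: "finite {n::nat. Q n \<and> real n < x}"
  by (rule finite_subset[of _ "{..nat \<lceil>x\<rceil>}"]) (auto, linarith)

lemma divisor_sum_pairs:
  "(\<Sum>n | 0 < n \<and> real n < P. of_nat (divisor_count n) * osc T n) =
     (\<Sum>(a, b) | 1 \<le> a \<and> 1 \<le> b \<and> real a * real b < P. osc T a * osc T b)"
proof -
  have "(\<Sum>n | 0 < n \<and> real n < P. of_nat (divisor_count n) * osc T n) =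
     (\<Sum>n | 0 < n \<and> real n < P. \<Sum>a | a dvd n. osc T n)"
    by (simp add: divisor_count_def)
  also have "\<dots> = (\<Sum>(n, a)\<in>(SIGMA n:{n. 0 < n \<and> real n < P}. {a. a dvd n}). osc T n)"
    by (rule sum.Sigma) (auto simp: finite_nat_less)
  also have "\<dots> = (\<Sum>(a, b) | 1 \<le> a \<and> 1 \<le> b \<and> real a * real b < P. osc T a * osc T b)"
    by (rule sum.reindex_bij_witness[of _ "\<lambda>(a, b). (a * b, a)" "\<lambda>(n, a). (a, n div a)"])
       (auto simp: osc_mult elim!: dvdE simp flip: of_nat_mult intro!: Suc_leI)
  finally show ?thesis .
qed

text \<open>
  The case \<open>a < N\<close> is the limit of \<open>truncated_Poisson_bound\<close>; for
  \<open>a = N\<close> at most two terms occur, all of the size of the error.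
\<close>

lemma partial_sum_reflection:
  fixes P :: real and N a :: nat
  assumes N: "N \<ge> 4" and P: "real N ^ 2 < P" "P \<le> (real N + 1)\<^sup>2" and a: "1 \<le> a" "a \<le> N"
  shows "norm ((\<Sum>b | N < b \<and> real a * real b < P. osc (2 * pi * P) b)
     - cnj (omega (2 * pi * P)) * (cnj (osc (2 * pi * P) a) / 2 + (\<Sum>j\<in>{a<..N}. cnj (osc (2 * pi * P) j)))) \<le> 501 / sqrt (real N)"
proof -
  define T where "T = 2 * pi * P"
  have N4: "real N \<ge> 4" using N by simp
  have "real N * 4 \<le> real N ^ 2" using N4 unfolding power2_eq_square by (intro mult_left_mono) auto
  hence P0: "P > 0" "P \<ge> 1" using P N4 by linarith+
  define m where "m = nat (\<lceil>P / real a\<rceil> - 1)"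
  have Pa: "P / real a > 0" using P0 a by simp
  hence m1: "real m < P / real a" "P / real a \<le> real m + 1" unfolding m_def by linarith+
  have Nm: "N \<le> m"
  proof -
    have "real N * real a \<le> real N * real N" using a by (intro mult_left_mono) auto
    hence "real N * real a < P" using P by (simp only: power2_eq_square)
    hence "real N < P / real a" using a by (simp add: less_divide_eq)
    thus ?thesis using m1 by linarith
  qed
  have set: "{b. N < b \<and> real a * real b < P} = {N<..m}"
  proof -
    have "real a * real b < P \<longleftrightarrow> b \<le> m" for b
    proof -
      have "real a * real b < P \<longleftrightarrow> real b < P / real a" using a by (simp add: less_divide_eq mult.commute)
      also have "\<dots> \<longleftrightarrow> b \<le> m"
      proof
        assume "real b < P / real a"
        hence "real b < real m + 1" using m1 by linarith
        thus "b \<le> m" by linarith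
      qed (use m1 in linarith)
      finally show ?thesis .
    qed
    thus ?thesis by (intro set_eqI) (simp only: mem_Collect_eq greaterThanAtMost_iff)
  qed
  show ?thesis
  proof (cases "a = N")
    case False
    hence aN: "a < N" using a by simp
    have "(\<lambda>J. norm (freq_sum P J (real N + 1/2) (real m + 1/2)
       - (half_saddle P (real a) + (\<Sum>j\<in>{int a<..<int N}. 2 * half_saddle P (of_int j)))))
       \<longlonglongrightarrow> norm ((\<Sum>b\<in>{N<..m}. kernel P 0 (of_nat b)) - (half_saddle P (real a) + (\<Sum>j\<in>{int a<..<int N}. 2 * half_saddle P (of_int j))))"
      by (intro tendsto_intros Poisson_interval Nm)
    moreover have "eventually (\<lambda>J. norm (freq_sum P J (real N + 1/2) (real m + 1/2)
       - (half_saddle P (real a) + (\<Sum>j\<in>{int a<..<int N}. 2 * half_saddle P (of_int j)))) \<le> 500 / sqrt (real N)) sequentially"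
      using eventually_ge_at_top[of "N + 3"]
      by eventually_elim (intro truncated_Poisson_bound N P a(1) aN m1)
    ultimately have 1: "norm ((\<Sum>b\<in>{N<..m}. kernel P 0 (of_nat b)) - (half_saddle P (real a) + (\<Sum>j\<in>{int a<..<int N}. 2 * half_saddle P (of_int j)))) \<le> 500 / sqrt (real N)"
      by (rule tendsto_upperbound) simp
    have 2: "(\<Sum>b\<in>{N<..m}. kernel P 0 (of_nat b)) = (\<Sum>b\<in>{N<..m}. osc T b)"
      unfolding T_def by (intro sum.cong refl kernel_eq_osc) auto
    have "(\<Sum>j\<in>{int a<..<int N}. 2 * half_saddle P (of_int j)) = (\<Sum>j\<in>{a<..<N}. 2 * half_saddle P (real j))"
      by (rule sum.reindex_bij_witness[of _ int nat]) auto
    also have "\<dots> = (\<Sum>j\<in>{a<..<N}. cnj (omega T) * cnj (osc T j))"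
      unfolding T_def by (intro sum.cong refl, subst half_saddle_eq_osc) (use P0 in auto)
    finally have 3: "(\<Sum>j\<in>{int a<..<int N}. 2 * half_saddle P (of_int j)) = cnj (omega T) * (\<Sum>j\<in>{a<..<N}. cnj (osc T j))"
      by (simp add: sum_distrib_left)
    have "{a<..N} = insert N {a<..<N}" using aN by auto
    hence 4: "(\<Sum>j\<in>{a<..N}. cnj (osc T j)) = cnj (osc T N) + (\<Sum>j\<in>{a<..<N}. cnj (osc T j))" by simp
    have 5: "half_saddle P (real a) = cnj (omega T) * (cnj (osc T a) / 2)"
      using half_saddle_eq_osc[of P a] P0 a by (simp add: T_def)
    have "(\<Sum>b\<in>{N<..m}. osc T b) - cnj (omega T) * (cnj (osc T a) / 2 + (\<Sum>j\<in>{a<..N}. cnj (osc T j))) =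
       ((\<Sum>b\<in>{N<..m}. osc T b) - (cnj (omega T) * (cnj (osc T a) / 2) + cnj (omega T) * (\<Sum>j\<in>{a<..<N}. cnj (osc T j))))
         - cnj (omega T) * cnj (osc T N)"
      unfolding 4 by (simp only: ring_distribs) simp
    also have "norm \<dots> \<le> 500 / sqrt (real N) + 1 / sqrt (real N)"
    proof (intro order_trans[OF norm_triangle_ineq4 add_mono])
      show "norm ((\<Sum>b\<in>{N<..m}. osc T b) - (cnj (omega T) * (cnj (osc T a) / 2) + cnj (omega T) * (\<Sum>j\<in>{a<..<N}. cnj (osc T j)))) \<le> 500 / sqrt (real N)"
        using 1 unfolding 2 3 5 .
      show "norm (cnj (omega T) * cnj (osc T N)) \<le> 1 / sqrt (real N)"
        by (simp add: norm_mult norm_omega norm_osc)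
    qed
    finally show ?thesis unfolding set T_def[symmetric] by simp
  next
    case True
    have "P \<le> real N * (real N + 3)" using P N4 by (simp add: power2_eq_square algebra_simps)
    hence "P / real a \<le> real N + 3" using True N4 by (simp add: divide_le_eq mult.commute)
    hence "m \<le> N + 2" using m1 by linarith
    have "norm (\<Sum>b\<in>{N<..m}. osc T b) \<le> of_nat (card {N<..m}) * (1 / sqrt (real N))"
    proof (rule sum_norm_bound)
      fix b assume "b \<in> {N<..m}"
      hence "sqrt (real N) \<le> sqrt (real b)" by simp
      thus "norm (osc T b) \<le> 1 / sqrt (real N)"
        unfolding norm_osc using N4 by (intro divide_left_mono) simp_all
    qed
    also have "\<dots> \<le> 2 * (1 / sqrt (real N))" using \<open>m \<le> N + 2\<close> by (intro mult_right_mono) auto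
    finally have 1: "norm (\<Sum>b\<in>{N<..m}. osc T b) \<le> 2 / sqrt (real N)" by simp
    have 2: "norm (cnj (omega T) * (cnj (osc T a) / 2 + (\<Sum>j\<in>{a<..N}. cnj (osc T j)))) \<le> 1 / sqrt (real N)"
    proof -
      have "norm (cnj (omega T) * (cnj (osc T a) / 2 + (\<Sum>j\<in>{a<..N}. cnj (osc T j)))) = 1 / sqrt (real N) / 2"
        using True by (simp add: norm_mult norm_divide norm_omega norm_osc)
      also have "\<dots> \<le> 1 / sqrt (real N)" proof -
        have "0 \<le> 1 / sqrt (real N)" by simp
        moreover have "x / 2 \<le> x" if "0 \<le> x" for x :: real using that by simp
        ultimately show ?thesis by blast
      qed 
      finally show ?thesis .
    qed
    have "norm ((\<Sum>b\<in>{N<..m}. osc T b) - cnj (omega T) * (cnj (osc T a) / 2 + (\<Sum>j\<in>{a<..N}. cnj (osc T j)))) \<le> 2 / sqrt (real N) + 1 / sqrt (real N)"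
      by (intro order_trans[OF norm_triangle_ineq4 add_mono] 1 2)
    also have "\<dots> \<le> 501 / sqrt (real N)"
      unfolding add_divide_distrib[symmetric] by (intro divide_right_mono) simp_all
    finally show ?thesis unfolding set T_def[symmetric] .
  qed
qed


section \<open>The divisor sum as the square of the Riemann-Siegel main sum\<close>

lemma sum_norm_osc_le:
  "(\<Sum>a\<in>{1..N}. norm (osc T a)) \<le> 2 * sqrt (real N)"
  using sum_inverse_sqrt_le[of N] by (simp add: norm_osc)

text \<open>
  If \<open>a b < P\<close> then \<open>a\<close> and \<open>b\<close> do not both exceed
  \<open>N\<close>; conversely \<open>a, b \<le> N\<close> implies \<open>a b \<le> N^2 <
  P\<close>. So the pairs form a full square and two congruent tails.
\<close>

lemma hyperbola_sum:
  fixes f :: "nat \<Rightarrow> complex" and P :: real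
  assumes P: "real N ^ 2 < P" "P \<le> (real N + 1)\<^sup>2"
  shows "(\<Sum>(a, b) | 1 \<le> a \<and> 1 \<le> b \<and> real a * real b < P. f a * f b) =
     (\<Sum>a\<in>{1..N}. f a)\<^sup>2 + 2 * (\<Sum>a\<in>{1..N}. f a * (\<Sum>b | N < b \<and> real a * real b < P. f b))"
proof -
  \<comment> \<open>\<open>C\<close> and \<open>C'\<close> are the two tails, \<open>B\<close> is the square.\<close>
  define C where "C = (SIGMA a:{1..N}. {b. N < b \<and> real a * real b < P})"
  define C' where "C' = (\<lambda>(a, b). (b, a)) ` C"
  define B where "B = {1..N} \<times> {1..N}"
  have small: "real a * real b < P" if "a \<le> N" "b \<le> N" for a b
  proof -
    have "real a * real b \<le> real N * real N" using that by (intro mult_mono) auto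
    thus ?thesis using P by (simp only: power2_eq_square)
  qed
  have large: "\<not> real a * real b < P" if "N < a" "N < b" for a b
  proof -
    have "(real N + 1) * (real N + 1) \<le> real a * real b" using that by (intro mult_mono) auto
    thus ?thesis using P by (simp only: power2_eq_square)
  qed
  have fin: "finite {b. N < b \<and> real a * real b < P}" if "1 \<le> a" for a
  proof (rule finite_subset)
    show "{b. N < b \<and> real a * real b < P} \<subseteq> {b. True \<and> real b < P}"
    proof
      fix b assume b: "b \<in> {b. N < b \<and> real a * real b < P}"
      have "1 * real b \<le> real a * real b" using that by (intro mult_right_mono) simp_all
      moreover have "real a * real b < P" using b by blast
      ultimately have "real b < P" by linarith
      thus "b \<in> {b. True \<and> real b < P}" by blast
    qed
  qed (rule finite_nat_less)
  have finC: "finite C" unfolding C_def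
    by (intro finite_SigmaI finite_atLeastAtMost fin) simp
  have "{(a, b). 1 \<le> a \<and> 1 \<le> b \<and> real a * real b < P} = B \<union> (C \<union> C')" (is "?D = _")
  proof (intro set_eqI iffI)
    fix z assume z: "z \<in> ?D"
    obtain a b where ab: "z = (a, b)" by (cases z)
    have z': "1 \<le> a" "1 \<le> b" "real a * real b < P" "real b * real a < P"
      using z unfolding ab by (simp_all add: mult.commute)
    have "a \<le> N \<or> b \<le> N" using large[of a b] z'(3) by linarith
    moreover have "z \<in> B" if "a \<le> N" "b \<le> N"
      unfolding ab B_def using that z'(1,2) by simp
    moreover have "z \<in> C" if "a \<le> N" "\<not> b \<le> N"
      unfolding ab C_def using that z'(1,3) by simp
    moreover have "z \<in> C'" if "\<not> a \<le> N" "b \<le> N"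
    proof -
      have "(b, a) \<in> C" unfolding C_def using that z'(2,4) by simp
      thus ?thesis unfolding ab C'_def by (intro image_eqI[of _ _ "(b, a)"]) simp_all
    qed
    ultimately show "z \<in> B \<union> (C \<union> C')" by blast
  next
    fix z assume "z \<in> B \<union> (C \<union> C')"
    then consider "z \<in> B" | "z \<in> C" | a b where "(b, a) \<in> C" "z = (a, b)"
      unfolding C'_def by fast
    thus "z \<in> ?D"
    proof cases
      case 1
      then obtain a b where ab: "z = (a, b)" "a \<le> N" "b \<le> N" "1 \<le> a" "1 \<le> b"
        unfolding B_def by auto
      show ?thesis unfolding ab(1) using small[OF ab(2,3)] ab(4,5) by simp
    next
      case 2
      thus ?thesis unfolding C_def by auto
    next
      case 3
      thus ?thesis unfolding C_def by (auto simp: mult.commute)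
    qed
  qed
  moreover have "B \<inter> (C \<union> C') = {}" "C \<inter> C' = {}" "finite C'" "finite B"
    using finC by (auto simp: B_def C_def C'_def)
  ultimately have "(\<Sum>(a, b)\<in>?D. f a * f b) = (\<Sum>(a, b)\<in>B. f a * f b) + ((\<Sum>(a, b)\<in>C. f a * f b) + (\<Sum>(a, b)\<in>C'. f a * f b))"
    using finC by (simp add: sum.union_disjoint)
  also have "(\<Sum>(a, b)\<in>C'. f a * f b) = (\<Sum>(a, b)\<in>C. f a * f b)"
    unfolding C'_def by (subst sum.reindex) (auto simp: inj_on_def case_prod_unfold mult.commute)
  also have "(\<Sum>(a, b)\<in>C. f a * f b) = (\<Sum>a\<in>{1..N}. f a * (\<Sum>b | N < b \<and> real a * real b < P. f b))"
    unfolding C_def using fin by (subst sum.Sigma[symmetric]) (simp_all add: sum_distrib_left)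
  also have "(\<Sum>(a, b)\<in>B. f a * f b) = (\<Sum>a\<in>{1..N}. f a)\<^sup>2"
    unfolding B_def power2_eq_square by (simp add: sum_product sum.cartesian_product)
  finally show ?thesis by simp
qed

text \<open>
  After the hyperbola method, reflecting the tails turns the sum into \<open>A^2 + 2 cnj omega
  B\<close> up to an error, where \<open>B\<close> is the triangular sum of
  \<open>sum_triangle_norm_sq\<close>, so that the real part of \<open>2 B\<close> is
  \<open>\<bar>A\<bar>^2\<close>. On the other hand \<open>Z^2 = 2 Re (omega A^2) + 2
  \<bar>A\<bar>^2\<close>.
\<close>

lemma S_limit_approx_RS_Z_squared:
  fixes T :: real and N :: nat
  assumes N: "N \<ge> 4" and P: "real N ^ 2 < T / (2 * pi)" "T / (2 * pi) \<le> (real N + 1)\<^sup>2"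
  shows "\<bar>S_limit T - (RS_Z N T)\<^sup>2\<bar> \<le> 4008"
proof -
  define P where "P = T / (2 * pi)"
  have T: "2 * pi * P = T" by (simp add: P_def)
  define f where "f = osc T"
  define A where "A = (\<Sum>a\<in>{1..N}. f a)"
  define w where "w = omega T"
  define Q where "Q = (\<lambda>a. cnj (f a) / 2 + (\<Sum>j\<in>{a<..N}. cnj (f j)))"
  define e where "e = (\<lambda>a. (\<Sum>b | N < b \<and> real a * real b < P. f b) - cnj w * Q a)"
  have ww: "w * cnj w = 1" by (simp add: complex_norm_square[symmetric] w_def norm_omega)
  have ebound: "norm (e a) \<le> 501 / sqrt (real N)" if "a \<in> {1..N}" for a
    using partial_sum_reflection[of N P a] N P that unfolding e_def Q_def f_def w_def T P_def[symmetric] by simp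
  have "(\<Sum>n | 0 < n \<and> real n < T / (2 * pi). of_nat (divisor_count n) * osc T n) = A\<^sup>2 + 2 * (\<Sum>a\<in>{1..N}. f a * (cnj w * Q a + e a))"
    unfolding divisor_sum_pairs P_def[symmetric] hyperbola_sum[OF P, folded P_def] A_def e_def f_def by simp
  also have "(\<Sum>a\<in>{1..N}. f a * (cnj w * Q a + e a)) = cnj w * (\<Sum>a\<in>{1..N}. f a * Q a) + (\<Sum>a\<in>{1..N}. f a * e a)"
    by (simp add: sum.distrib sum_distrib_left algebra_simps)
  finally have "S_limit T = 2 * Re (w * (A\<^sup>2 + 2 * (cnj w * (\<Sum>a\<in>{1..N}. f a * Q a) + (\<Sum>a\<in>{1..N}. f a * e a))))"
    unfolding S_limit_def w_def by simp
  also have "w * (A\<^sup>2 + 2 * (cnj w * (\<Sum>a\<in>{1..N}. f a * Q a) + (\<Sum>a\<in>{1..N}. f a * e a))) =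
     w * A\<^sup>2 + 2 * (w * cnj w) * (\<Sum>a\<in>{1..N}. f a * Q a) + 2 * (w * (\<Sum>a\<in>{1..N}. f a * e a))"
    by (simp add: algebra_simps)
  finally have F: "S_limit T = 2 * Re (w * A\<^sup>2) + 2 * (2 * Re (\<Sum>a\<in>{1..N}. f a * Q a)) + 4 * Re (w * (\<Sum>a\<in>{1..N}. f a * e a))"
    unfolding ww by simp
  have tri: "2 * Re (\<Sum>a\<in>{1..N}. f a * Q a) = (norm A)\<^sup>2"
    unfolding Q_def A_def by (rule sum_triangle_norm_sq)
  define v where "v = cis (rs_theta T) * A"
  have v2: "v\<^sup>2 = w * A\<^sup>2"
    by (simp add: v_def w_def omega_def rs_theta_def power_mult_distrib power2_eq_square cis_mult)
  have "(RS_Z N T)\<^sup>2 = 2 * Re (v\<^sup>2) + 2 * (norm v)\<^sup>2"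
    unfolding RS_Z_def zeta_poly_def f_def[symmetric] A_def[symmetric] v_def[symmetric] cmod_power2
    by (simp add: power2_eq_square algebra_simps)
  hence Z: "(RS_Z N T)\<^sup>2 = 2 * Re (w * A\<^sup>2) + 2 * (norm A)\<^sup>2"
    unfolding v2 by (simp add: v_def norm_mult)
  have "\<bar>S_limit T - (RS_Z N T)\<^sup>2\<bar> = 4 * \<bar>Re (w * (\<Sum>a\<in>{1..N}. f a * e a))\<bar>"
  proof -
    have "S_limit T - (RS_Z N T)\<^sup>2 = 4 * Re (w * (\<Sum>a\<in>{1..N}. f a * e a))" unfolding F Z tri by linarith
    thus ?thesis by (simp only: abs_mult abs_numeral)
  qed
  also have "\<bar>Re (w * (\<Sum>a\<in>{1..N}. f a * e a))\<bar> \<le> norm (w * (\<Sum>a\<in>{1..N}. f a * e a))"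
    by (rule abs_Re_le_cmod)
  also have "\<dots> = norm (\<Sum>a\<in>{1..N}. f a * e a)" by (simp add: norm_mult w_def norm_omega)
  also have "\<dots> \<le> (\<Sum>a\<in>{1..N}. norm (f a) * (501 / sqrt (real N)))"
    unfolding norm_mult by (intro sum_norm_le) (simp only: norm_mult mult_left_mono ebound norm_ge_zero)
  also have "\<dots> = (\<Sum>a\<in>{1..N}. norm (f a)) * (501 / sqrt (real N))" by (rule sum_distrib_right[symmetric])
  also have "\<dots> \<le> 2 * sqrt (real N) * (501 / sqrt (real N))"
    unfolding f_def by (intro mult_right_mono sum_norm_osc_le) simp
  also have "\<dots> = 1002" using N by simp
  finally show ?thesis by simp
qed

section \<open>Exponential integrals over short windows\<close>

text \<open>
  Integration by parts with \<open>cis (g t) = (cis (g t) g' t) / g' t\<close>: as \<open>1 /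
  g'\<close> decreases, its total variation and its two end values add up to twice its value at
  \<open>a\<close>.
\<close>

lemma first_derivative_test:
  fixes g g' g'' :: "real \<Rightarrow> real"
  assumes ab: "a \<le> b"
    and g: "\<And>t. t \<in> {a..b} \<Longrightarrow> (g has_real_derivative g' t) (at t within {a..b})"
    and g': "\<And>t. t \<in> {a..b} \<Longrightarrow> (g' has_real_derivative g'' t) (at t within {a..b})"
    and g'': "\<And>t. t \<in> {a..b} \<Longrightarrow> g'' t \<ge> 0"
    and \<delta>: "\<delta> > 0" "\<And>t. t \<in> {a..b} \<Longrightarrow> g' t \<ge> \<delta>"
  shows "norm (integral {a..b} (\<lambda>t. cis (g t))) \<le> 2 / \<delta>"
proof -
  have pos: "g' t > 0" if "t \<in> {a..b}" for t using \<delta> that by (meson less_le_trans)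
  have contg: "continuous_on {a..b} g"
    unfolding continuous_on_eq_continuous_within using g DERIV_continuous by blast
  have cont: "continuous_on {a..b} (\<lambda>t. cis (g t))"
    by (intro continuous_intros contg)
  define h where "h = (\<lambda>t. integral {a..t} (\<lambda>t. cis (g t)) + \<i> * cis (g t) * of_real (inverse (g' t)))"
  have "norm (h b - h a) \<le> - inverse (g' b) - (- inverse (g' a))"
  proof (rule norm_diff_le_antiderivative[OF ab])
    fix t assume t: "t \<in> {a..b}"
    have 1: "((\<lambda>u. integral {a..u} (\<lambda>t. cis (g t))) has_vector_derivative cis (g t)) (at t within {a..b})"
      by (rule integral_has_vector_derivative[OF cont t])
    have "((\<lambda>t. cis (g t)) has_vector_derivative (of_real (g' t) * (\<i> * cis (g t)))) (at t within {a..b})"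
    proof -
      have "((\<lambda>t. of_real (g t) :: complex) has_vector_derivative of_real (g' t)) (at t within {a..b})"
        using g[OF t] by (simp add: has_vector_derivative_of_real has_real_derivative_iff_has_vector_derivative)
      moreover have "((\<lambda>z. exp (\<i> * z)) has_field_derivative (\<i> * exp (\<i> * of_real (g t)))) (at (of_real (g t)) within X)" for X
        by (auto intro!: derivative_eq_intros)
      ultimately show ?thesis
        unfolding cis_conv_exp using field_vector_diff_chain_within[unfolded o_def] by blast
    qed
    hence 2: "((\<lambda>t. \<i> * cis (g t)) has_vector_derivative (\<i> * (of_real (g' t) * (\<i> * cis (g t))))) (at t within {a..b})"
      by (rule has_vector_derivative_mult_right)
    have inv: "((\<lambda>t. inverse (g' t)) has_real_derivative - (inverse (g' t) * g'' t * inverse (g' t))) (at t within {a..b})"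
      by (rule DERIV_inverse'[OF g'[OF t]]) (use pos[OF t] in simp)
    define d where "d = - (inverse (g' t) * g'' t * inverse (g' t))"
    have "((\<lambda>t. of_real (inverse (g' t)) :: complex) has_vector_derivative of_real d) (at t within {a..b})"
      using inv unfolding d_def[symmetric]
      by (simp add: has_vector_derivative_of_real has_real_derivative_iff_has_vector_derivative del: of_real_inverse)
    from has_vector_derivative_add[OF 1 has_vector_derivative_mult[OF 2 this]]
    have "(h has_vector_derivative (cis (g t) + (\<i> * cis (g t) * of_real d + 
         \<i> * (of_real (g' t) * (\<i> * cis (g t))) * of_real (inverse (g' t))))) (at t within {a..b})"
      unfolding h_def .
    also have "\<i> * (of_real (g' t) * (\<i> * cis (g t))) * of_real (inverse (g' t)) = - cis (g t) * of_real (g' t * inverse (g' t))"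
      unfolding of_real_mult by (simp only: mult_ac) (simp add: mult.assoc[symmetric])
    also have "g' t * inverse (g' t) = 1" using pos[OF t] by simp
    finally show "(h has_vector_derivative (\<i> * cis (g t) * of_real d)) (at t within {a..b})"
      by simp
    have "((\<lambda>t. - inverse (g' t)) has_real_derivative - (- (inverse (g' t) * g'' t * inverse (g' t)))) (at t within {a..b})"
      by (rule DERIV_minus[OF inv])
    thus "((\<lambda>t. - inverse (g' t)) has_real_derivative (inverse (g' t) * g'' t * inverse (g' t))) (at t within {a..b})" by simp
    have "0 \<le> inverse (g' t) * g'' t * inverse (g' t)" using pos[OF t] g''[OF t] by simp
    thus "norm (\<i> * cis (g t) * of_real d) \<le> inverse (g' t) * g'' t * inverse (g' t)"
      by (simp only: d_def norm_mult norm_of_real norm_cis norm_ii abs_minus_cancel abs_of_nonneg mult_1)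
  qed
  moreover have "norm (\<i> * cis (g t) * of_real (inverse (g' t))) = inverse (g' t)" if "t \<in> {a..b}" for t
    using pos[OF that] by (simp add: norm_mult norm_inverse)
  moreover have "norm (p - q + r) \<le> norm p + norm q + norm r" for p q r :: complex
    using norm_triangle_ineq[of "p - q" r] norm_triangle_ineq4[of p q] by linarith
  ultimately have "norm ((h b - h a) - \<i> * cis (g b) * of_real (inverse (g' b)) + \<i> * cis (g a) * of_real (inverse (g' a)))
      \<le> (- inverse (g' b) - (- inverse (g' a))) + inverse (g' b) + inverse (g' a)"
    using ab by (smt (verit) atLeastAtMost_iff)
  moreover have "(h b - h a) - \<i> * cis (g b) * of_real (inverse (g' b)) + \<i> * cis (g a) * of_real (inverse (g' a)) = integral {a..b} (\<lambda>t. cis (g t))"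
    unfolding h_def by simp
  ultimately have "norm (integral {a..b} (\<lambda>t. cis (g t))) \<le> (- inverse (g' b) - (- inverse (g' a))) + inverse (g' b) + inverse (g' a)"
    by (simp only:)
  also have "\<dots> = 2 * inverse (g' a)" by simp
  also have "\<dots> \<le> 2 * inverse \<delta>" using \<delta> ab by (intro mult_left_mono le_imp_inverse_le) auto
  finally show ?thesis by (simp add: divide_inverse)
qed

text \<open>
  All phases in use have this form: \<open>c = 1/2\<close> for \<open>rs_theta\<close>,
  \<open>c = 1\<close> for twice \<open>rs_theta\<close>, and \<open>c = 0\<close> for the
  quotients of integers.
\<close>

lemma phase_integral:
  assumes "0 < a" "a \<le> b" "c \<ge> 0" "\<delta> > 0" "c * ln (a / (2 * pi)) - \<beta> \<ge> \<delta>"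
  shows "norm (integral {a..b} (\<lambda>t. cis (c * (t * ln (t / (2 * pi)) - t) - \<beta> * t + \<gamma>))) \<le> 2 / \<delta>"
proof (rule first_derivative_test[OF assms(2) _ _ _ assms(4)])
  fix t assume t: "t \<in> {a..b}"
  hence t0: "t > 0" using assms by auto
  show "((\<lambda>t. c * (t * ln (t / (2 * pi)) - t) - \<beta> * t + \<gamma>) has_real_derivative (c * ln (t / (2 * pi)) - \<beta>)) (at t within {a..b})"
    using t0 by (auto intro!: derivative_eq_intros simp: field_simps)
  show "((\<lambda>t. c * ln (t / (2 * pi)) - \<beta>) has_real_derivative c / t) (at t within {a..b})"
    using t0 by (auto intro!: derivative_eq_intros simp: field_simps)
  show "0 \<le> c / t" using t0 assms by simp
  have "a / (2 * pi) \<le> t / (2 * pi)" using t by (intro divide_right_mono) auto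
  hence "ln (a / (2 * pi)) \<le> ln (t / (2 * pi))" using assms t0 by (intro ln_mono) auto
  hence "c * ln (a / (2 * pi)) \<le> c * ln (t / (2 * pi))" using assms by (intro mult_left_mono)
  thus "\<delta> \<le> c * ln (t / (2 * pi)) - \<beta>" using assms by linarith
qed

lemma pure_phase_integral:
  assumes "0 < a" "a \<le> b" "\<bar>\<beta>\<bar> \<ge> \<delta>" "\<delta> > 0"
  shows "norm (integral {a..b} (\<lambda>t. cis (- (t * \<beta>)))) \<le> 2 / \<delta>"
proof (cases "\<beta> < 0")
  case True
  thus ?thesis using phase_integral[of a b 0 \<delta> \<beta> 0] assms by (simp add: mult.commute)
next
  case False
  have "norm (integral {a..b} (\<lambda>t. cis (- (t * \<beta>)))) = norm (cnj (integral {a..b} (\<lambda>t. cis (- (t * \<beta>)))))" by simp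
  also have "cnj (integral {a..b} (\<lambda>t. cis (- (t * \<beta>)))) = integral {a..b} (\<lambda>t. cis (t * \<beta>))"
    by (simp add: integral_cnj cis_cnj)
  also have "norm \<dots> \<le> 2 / \<delta>" using phase_integral[of a b 0 \<delta> "-\<beta>" 0] assms False by (simp add: mult.commute)
  finally show ?thesis .
qed


section \<open>The Riemann-Siegel main sum is small on average\<close>

lemma harm_le_ln: "n \<ge> 1 \<Longrightarrow> (harm n :: real) \<le> 1 + ln (real n)"
proof -
  assume "n \<ge> 1"
  then obtain k where k: "n = Suc k" by (cases n) auto
  have "(harm (Suc k) - ln (Suc k) :: real) \<le> harm (Suc 0) - ln (real (Suc 0))"
    using decseqD[OF decseq_harm_diff_ln, of 0 k] by simp
  thus ?thesis unfolding k by (simp add: harm_def)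
qed

lemma continuous_on_rs_theta: "a > 0 \<Longrightarrow> continuous_on {a..b} rs_theta"
  unfolding rs_theta_def by (intro continuous_intros) auto

lemma continuous_on_osc: "continuous_on X (\<lambda>t. osc t n)"
  unfolding osc_def by (intro continuous_intros)

lemma continuous_on_RS_Z: "a > 0 \<Longrightarrow> continuous_on {a..b} (RS_Z N)"
  unfolding RS_Z_def zeta_poly_def by (intro continuous_intros continuous_on_rs_theta continuous_on_osc)

text \<open>
  Writing \<open>N = (N - n) + n\<close> splits the summand into \<open>2 / sqrt n\<close> and
  \<open>2 sqrt n / (N - n)\<close>, so the singularity at \<open>n = N\<close> costs only
  \<open>sqrt N\<close> times a logarithm.
\<close>

lemma weighted_harmonic_sum:
  assumes "N \<ge> 2"
  shows "(\<Sum>n\<in>{1..N-1}. 1 / sqrt (real n) * (2 / ((real N - real n) / real N))) \<le> 4 * sqrt (real N) + 2 * sqrt (real N) * (1 + ln (real N))"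
proof -
  have "(\<Sum>n\<in>{1..N-1}. 1 / sqrt (real n) * (2 / ((real N - real n) / real N))) \<le> 
     (\<Sum>n\<in>{1..N-1}. 2 * (1 / sqrt (real n)) + 2 * sqrt (real N) * (1 / (real N - real n)))"
  proof (rule sum_mono)
    fix n assume n: "n \<in> {1..N-1}"
    hence n': "0 < real n" "real n < real N" using assms by auto
    have "1 / sqrt (real n) * (2 / ((real N - real n) / real N)) = 2 * (1 / sqrt (real n)) + 2 * (real n / sqrt (real n)) * (1 / (real N - real n))"
      using n' by (simp add: field_simps)
    also have "real n / sqrt (real n) = sqrt (real n)" using n' by (intro real_div_sqrt) simp
    also have "2 * sqrt (real n) * (1 / (real N - real n)) \<le> 2 * sqrt (real N) * (1 / (real N - real n))"
      using n' by (intro mult_right_mono) auto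
    finally show "1 / sqrt (real n) * (2 / ((real N - real n) / real N)) \<le> 2 * (1 / sqrt (real n)) + 2 * sqrt (real N) * (1 / (real N - real n))"
      by simp
  qed
  also have "\<dots> = 2 * (\<Sum>n\<in>{1..N-1}. 1 / sqrt (real n)) + 2 * sqrt (real N) * (\<Sum>n\<in>{1..N-1}. 1 / (real N - real n))"
    by (simp add: sum.distrib sum_distrib_left)
  also have "(\<Sum>n\<in>{1..N-1}. 1 / (real N - real n)) = harm (N - 1)"
    unfolding harm_def by (rule sum.reindex_bij_witness[of _ "\<lambda>n. N - n" "\<lambda>n. N - n"]) (auto simp: of_nat_diff inverse_eq_divide)
  also have "2 * (\<Sum>n\<in>{1..N-1}. 1 / sqrt (real n)) + 2 * sqrt (real N) * harm (N - 1) \<le> 2 * (2 * sqrt (real N)) + 2 * sqrt (real N) * (1 + ln (real N))"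
  proof (intro add_mono mult_left_mono)
    have "(\<Sum>n\<in>{1..N-1}. 1 / sqrt (real n)) \<le> 2 * sqrt (real (N - 1))" by (rule sum_inverse_sqrt_le)
    also have "\<dots> \<le> 2 * sqrt (real N)" by simp
    finally show "(\<Sum>n\<in>{1..N-1}. 1 / sqrt (real n)) \<le> 2 * sqrt (real N)" .
    have "harm (N - 1) \<le> 1 + ln (real (N - 1))" using assms by (intro harm_le_ln) simp
    also have "\<dots> \<le> 1 + ln (real N)" using assms by simp
    finally show "harm (N - 1) \<le> 1 + ln (real N)" .
  qed auto
  finally show ?thesis by simp
qed

text \<open>
  The phase of the \<open>n\<close>-th term has derivative at least \<open>ln (N / n) \<ge> (N
  - n) / N\<close>. For \<open>n = N\<close> the phase may be stationary, and this term is
  bounded trivially.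
\<close>

lemma RS_Z_integral_bound:
  assumes N: "N \<ge> 2" and a: "real N ^ 2 < a / (2 * pi)" and ab: "a \<le> b"
  shows "\<bar>integral {a..b} (RS_Z N)\<bar> \<le> 2 * ((b - a) / sqrt (real N) + (4 * sqrt (real N) + 2 * sqrt (real N) * (1 + ln (real N))))"
proof -
  have "0 < real N ^ 2" using N by simp
  hence "0 < a / (2 * pi)" using a by linarith
  hence a0: "a > 0" by (simp add: zero_less_divide_iff)
  define f where "f = (\<lambda>n t. cis (1/2 * (t * ln (t / (2 * pi)) - t) - ln (real n) * t + (- pi / 8)))"
  have cf: "continuous_on {a..b} (f n)" for n unfolding f_def using a0 by (intro continuous_intros) auto
  have eq: "cis (rs_theta t) * zeta_poly N t = (\<Sum>n\<in>{1..N}. of_real (1 / sqrt (real n)) * f n t)" for t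
    unfolding zeta_poly_def sum_distrib_left
  proof (intro sum.cong refl)
    fix n
    have "cis (rs_theta t) * osc t n = of_real (1 / sqrt (real n)) * (cis (rs_theta t) * cis (- (t * ln (real n))))"
      by (simp add: osc_def)
    also have "cis (rs_theta t) * cis (- (t * ln (real n))) = f n t"
      unfolding cis_mult f_def by (intro arg_cong[of _ _ cis]) (simp add: rs_theta_def field_simps)
    finally show "cis (rs_theta t) * osc t n = of_real (1 / sqrt (real n)) * f n t" .
  qed
  have contA: "continuous_on {a..b} (\<lambda>t. cis (rs_theta t) * zeta_poly N t)"
    unfolding zeta_poly_def by (intro continuous_intros continuous_on_rs_theta continuous_on_osc a0)
  have "integral {a..b} (RS_Z N) = integral {a..b} ((\<lambda>z. 2 * Re z) \<circ> (\<lambda>t. cis (rs_theta t) * zeta_poly N t))"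
    by (intro arg_cong[of _ _ "integral {a..b}"] ext) (simp only: RS_Z_def o_def)
  also have "\<dots> = 2 * Re (integral {a..b} (\<lambda>t. cis (rs_theta t) * zeta_poly N t))"
    by (rule integral_linear) (intro integrable_continuous_interval contA bounded_linear_const_mult bounded_linear_Re)+
  also have "\<bar>\<dots>\<bar> \<le> 2 * norm (integral {a..b} (\<lambda>t. cis (rs_theta t) * zeta_poly N t))"
    using abs_Re_le_cmod[of "integral {a..b} (\<lambda>t. cis (rs_theta t) * zeta_poly N t)"] by simp
  also have "integral {a..b} (\<lambda>t. cis (rs_theta t) * zeta_poly N t) = (\<Sum>n\<in>{1..N}. of_real (1 / sqrt (real n)) * integral {a..b} (f n))"
    unfolding eq by (subst integral_sum) (auto intro!: integrable_continuous_interval continuous_intros cf)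
  also have "norm \<dots> \<le> (\<Sum>n\<in>{1..N}. 1 / sqrt (real n) * norm (integral {a..b} (f n)))"
    by (intro sum_norm_le) (simp add: norm_mult norm_divide)
  also have "\<dots> = (\<Sum>n\<in>{1..N-1}. 1 / sqrt (real n) * norm (integral {a..b} (f n))) + 1 / sqrt (real N) * norm (integral {a..b} (f N))"
  proof -
    have "{1..N} = insert N {1..N-1}" using N by auto
    thus ?thesis using N by simp
  qed
  also have "\<dots> \<le> (\<Sum>n\<in>{1..N-1}. 1 / sqrt (real n) * (2 / ((real N - real n) / real N))) + 1 / sqrt (real N) * (1 * (b - a))"
  proof (intro add_mono sum_mono mult_left_mono)
    fix n assume n: "n \<in> {1..N-1}"
    hence n': "0 < real n" "real n < real N" using N by auto
    have "ln (real N ^ 2) \<le> ln (a / (2 * pi))" using a N by (intro ln_mono) auto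
    hence "ln (real N) \<le> 1/2 * ln (a / (2 * pi))" using N by (simp add: ln_realpow)
    moreover have "ln (real n / real N) \<le> real n / real N - 1" using n' by (intro ln_le_minus_one) auto
    hence "ln (real N) - ln (real n) \<ge> (real N - real n) / real N" using n' by (simp add: ln_div field_simps)
    ultimately show "norm (integral {a..b} (f n)) \<le> 2 / ((real N - real n) / real N)"
      unfolding f_def using n' by (intro phase_integral a0 ab) auto
  next
    show "norm (integral {a..b} (f N)) \<le> 1 * (b - a)"
      by (rule integral_bound[OF ab cf]) (simp add: f_def)
  qed auto
  also have "\<dots> \<le> (4 * sqrt (real N) + 2 * sqrt (real N) * (1 + ln (real N))) + (b - a) / sqrt (real N)"
    using weighted_harmonic_sum[OF N] by simp
  finally show ?thesis by simp
qed


section \<open>The Riemann-Siegel main sum has large values\<close>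

text \<open>
  Distinct positive integers, one of which is at most \<open>M\<close>, have a ratio bounded
  away from \<open>1\<close>, however large the other one is.
\<close>

lemma ln_gap:
  assumes "x \<ge> 1" "y \<ge> 1" "x \<noteq> y" "x \<le> M \<or> y \<le> M"
  shows "1 / (2 * real M) \<le> \<bar>ln (real x) - ln (real y)\<bar>"
proof -
  have *: "1 / (2 * real M) \<le> ln (real y) - ln (real x)" if "1 \<le> x" "x < y" "x \<le> M" for x y
  proof -
    have "1 / (2 * real M) \<le> 1 / (real x + 1)" using that by (intro divide_left_mono) auto
    also have "\<dots> = 1 - real x / (real x + 1)" using that by (simp add: field_simps)
    also have "\<dots> \<le> 1 - real x / real y" using that by (intro diff_left_mono divide_left_mono) auto
    also have "\<dots> \<le> - ln (real x / real y)" using ln_le_minus_one[of "real x / real y"] that by simp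
    also have "\<dots> = ln (real y) - ln (real x)" using that by (simp add: ln_div)
    finally show ?thesis .
  qed
  show ?thesis
  proof (cases "x < y")
    case True
    thus ?thesis using *[of x y] assms by linarith
  next
    case False
    thus ?thesis using *[of y x] assms by linarith
  qed
qed

lemma pure_phase_gap:
  assumes "0 < a" "a \<le> b" "x \<ge> 1" "y \<ge> 1" "x \<noteq> y" "x \<le> M \<or> y \<le> M" "M \<ge> 1"
  shows "norm (integral {a..b} (\<lambda>t. cis (- (t * (ln (real x) - ln (real y)))))) \<le> 4 * real M"
proof -
  have "norm (integral {a..b} (\<lambda>t. cis (- (t * (ln (real x) - ln (real y)))))) \<le> 2 / (1 / (2 * real M))"
    by (intro pure_phase_integral ln_gap assms) (use assms in auto)
  thus ?thesis by simp
qed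

lemma integral_weighted_sum:
  fixes f :: "'i \<Rightarrow> real \<Rightarrow> complex"
  assumes "finite A" "\<And>n. n \<in> A \<Longrightarrow> continuous_on {a..b} (f n)"
  shows "integral {a..b} (\<lambda>t. \<Sum>n\<in>A. c n * f n t) = (\<Sum>n\<in>A. c n * integral {a..b} (f n))"
proof -
  have "integral {a..b} (\<lambda>t. \<Sum>n\<in>A. c n * f n t) = (\<Sum>n\<in>A. integral {a..b} (\<lambda>t. c n * f n t))"
    by (rule Henstock_Kurzweil_Integration.integral_sum[OF assms(1)])
       (intro integrable_continuous_interval continuous_intros assms(2))
  thus ?thesis by (simp only: Henstock_Kurzweil_Integration.integral_mult_right)
qed

lemma Dirichlet_polynomial_mean_square:
  assumes "0 < a" "a \<le> b" "M \<ge> 1"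
  shows "integral {a..b} (\<lambda>t. (norm (zeta_poly M t))\<^sup>2) \<le> (b - a) * (1 + ln (real M)) + 16 * real M ^ 2"
proof -
  define I where "I = (\<lambda>k m. integral {a..b} (\<lambda>t. cis (- (t * (ln (real k) - ln (real m))))))"
  define w where "w = (\<lambda>k m. 1 / sqrt (real k) * (1 / sqrt (real m)))"
  have cA: "continuous_on {a..b} (zeta_poly M)" unfolding zeta_poly_def by (intro continuous_intros continuous_on_osc)
  have t: "osc t k * cnj (osc t m) = of_real (w k m) * cis (- (t * (ln (real k) - ln (real m))))" for t k m
    unfolding osc_def w_def by (simp add: cis_cnj cis_mult algebra_simps)
  have "integral {a..b} (\<lambda>t. (norm (zeta_poly M t))\<^sup>2) = integral {a..b} (Re \<circ> (\<lambda>t. zeta_poly M t * cnj (zeta_poly M t)))"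
    by (intro arg_cong[of _ _ "integral {a..b}"] ext) (simp only: comp_def cmod_power2, simp add: power2_eq_square)
  also have "\<dots> = Re (integral {a..b} (\<lambda>t. zeta_poly M t * cnj (zeta_poly M t)))"
    by (rule integral_linear) (intro integrable_continuous_interval continuous_intros cA bounded_linear_Re)+
  also have "\<dots> \<le> norm (integral {a..b} (\<lambda>t. zeta_poly M t * cnj (zeta_poly M t)))" by (rule complex_Re_le_cmod)
  also have "(\<lambda>t. zeta_poly M t * cnj (zeta_poly M t)) = (\<lambda>t. \<Sum>k\<in>{1..M}. \<Sum>m\<in>{1..M}. of_real (w k m) * cis (- (t * (ln (real k) - ln (real m)))))"
    unfolding zeta_poly_def cnj_sum sum_product t ..
  also have "integral {a..b} \<dots> = (\<Sum>k\<in>{1..M}. \<Sum>m\<in>{1..M}. of_real (w k m) * I k m)"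
    unfolding I_def sum.cartesian_product case_prod_unfold
    by (rule integral_weighted_sum) (simp, intro continuous_intros)
  also have "norm \<dots> \<le> (\<Sum>k\<in>{1..M}. \<Sum>m\<in>{1..M}. (if m = k then (b - a) * (1 / real k) else 0) + 4 * real M * w k m)"
  proof (intro sum_norm_le)
    fix k m assume km: "k \<in> {1..M}" "m \<in> {1..M}"
    have w0: "w k m \<ge> 0" by (simp add: w_def)
    show "norm (of_real (w k m) * I k m) \<le> (if m = k then (b - a) * (1 / real k) else 0) + 4 * real M * w k m"
    proof (cases "m = k")
      case True
      have "norm (of_real (w k m) * I k m) = (b - a) * (1 / real k)"
        using True assms km by (simp add: I_def w_def norm_mult norm_divide)
      thus ?thesis using True w0 by simp
    next
      case False
      have "norm (I k m) \<le> 4 * real M" unfolding I_def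
        using km False by (intro pure_phase_gap assms) auto
      hence "w k m * norm (I k m) \<le> w k m * (4 * real M)" by (intro mult_left_mono w0)
      thus ?thesis using False w0 by (simp add: norm_mult mult_ac)
    qed
  qed
  also have "\<dots> = (b - a) * harm M + 4 * real M * (\<Sum>k\<in>{1..M}. \<Sum>m\<in>{1..M}. w k m)"
    by (simp add: sum.distrib sum_distrib_left harm_def inverse_eq_divide sum.delta)
  also have "(\<Sum>k\<in>{1..M}. \<Sum>m\<in>{1..M}. w k m) = (\<Sum>k\<in>{1..M}. 1 / sqrt (real k)) * (\<Sum>k\<in>{1..M}. 1 / sqrt (real k))"
    unfolding w_def sum_product ..
  also have "(b - a) * harm M + 4 * real M * \<dots> \<le> (b - a) * (1 + ln (real M)) + 4 * real M * ((2 * sqrt (real M)) * (2 * sqrt (real M)))"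
    using assms by (intro add_mono mult_left_mono mult_mono harm_le_ln sum_inverse_sqrt_le sum_nonneg) auto
  also have "4 * real M * ((2 * sqrt (real M)) * (2 * sqrt (real M))) = 16 * real M ^ 2"
    by (simp add: power2_eq_square)
  finally show ?thesis .
qed

lemma triple_sum_product:
  fixes x y z :: "nat \<Rightarrow> 'a::comm_semiring_0"
  shows "sum x A * (sum y B * sum z C) = (\<Sum>n\<in>A. \<Sum>k\<in>B. \<Sum>m\<in>C. x n * (y k * z m))"
  by (subst sum_distrib_right, intro sum.cong refl, subst sum_product, simp only: sum_distrib_left)


text \<open>
  The resonance method with the weight \<open>\<bar>D\<bar>^2\<close>, \<open>D = zeta_poly
  M\<close>. Since \<open>Z exp (-i theta) = A + exp (-2 i theta) cnj A\<close>, the weighted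
  integral is the sum of the terms \<open>a k = m\<close> of \<open>A D cnj D\<close>, which
  contribute at least \<open>(b - a) (harm r)^2\<close>, and of oscillating terms. The left
  side is a lower bound for it, and the right side is an upper bound by the mean square of
  \<open>D\<close>.
\<close>

lemma RS_Z_large_value_bound:
  assumes N: "N \<ge> 3 * M" and a: "real N ^ 2 < a / (2 * pi)" and ab: "a \<le> b" and M: "M \<ge> 1"
    and r: "r ^ 2 \<le> M" and V: "\<And>t. t \<in> {a..b} \<Longrightarrow> \<bar>RS_Z N t\<bar> \<le> V"
  shows "(b - a) * (harm r)\<^sup>2 - 48 * sqrt (real N) * real M ^ 2 \<le> V * ((b - a) * (1 + ln (real M)) + 16 * real M ^ 2)"
proof -
  have N0: "N \<ge> 1" "real N \<ge> 1" using N M by auto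
  hence "0 < real N ^ 2" by simp
  hence "0 < a / (2 * pi)" using a by linarith
  hence a0: "a > 0" by (simp add: zero_less_divide_iff)
  have V0: "V \<ge> 0" using V[of a] ab by auto
  define w where "w = (\<lambda>n k m. 1 / sqrt (real n) * (1 / sqrt (real k) * (1 / sqrt (real m))))"
  have w0: "w n k m \<ge> 0" for n k m by (simp add: w_def)
  have sumw: "(\<Sum>n\<in>{1..N}. \<Sum>k\<in>{1..M}. \<Sum>m\<in>{1..M}. w n k m) \<le> 8 * sqrt (real N) * real M"
  proof -
    have "(\<Sum>n\<in>{1..N}. \<Sum>k\<in>{1..M}. \<Sum>m\<in>{1..M}. w n k m) = 
      (\<Sum>n\<in>{1..N}. 1 / sqrt (real n)) * ((\<Sum>k\<in>{1..M}. 1 / sqrt (real k)) * (\<Sum>m\<in>{1..M}. 1 / sqrt (real m)))"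
      unfolding w_def by (rule triple_sum_product[symmetric])
    also have "\<dots> \<le> (2 * sqrt (real N)) * ((2 * sqrt (real M)) * (2 * sqrt (real M)))"
      by (intro mult_mono sum_inverse_sqrt_le mult_nonneg_nonneg sum_nonneg) auto
    finally show ?thesis by simp
  qed
  define f1 where "f1 = (\<lambda>n k m t. cis (- (t * (ln (real (n * k)) - ln (real m)))))"
  define f2 where "f2 = (\<lambda>n k m t. cis (1 * (t * ln (t / (2 * pi)) - t) - (ln (real n) - ln (real k) + ln (real m)) * t + (- pi / 4)))"
  have cf1: "continuous_on {a..b} (f1 n k m)" for n k m unfolding f1_def by (intro continuous_intros)
  have cf2: "continuous_on {a..b} (f2 n k m)" for n k m unfolding f2_def using a0 by (intro continuous_intros) auto
  define A where "A = zeta_poly N"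
  define D where "D = zeta_poly M"
  have cA: "continuous_on {a..b} A" "continuous_on {a..b} D" 
    unfolding A_def D_def zeta_poly_def by (intro continuous_intros continuous_on_osc)+
  have t1: "osc t n * (osc t k * cnj (osc t m)) = of_real (w n k m) * f1 n k m t" if "n \<ge> 1" "k \<ge> 1" for t n k m
    unfolding osc_def w_def f1_def using that by (simp add: cis_cnj cis_mult ln_mult algebra_simps)
  have t2: "cis (- (2 * rs_theta t)) * cnj (osc t n) * (osc t k * cnj (osc t m)) = of_real (w n k m) * cnj (f2 n k m t)" for t n k m
  proof -
    have "cis (- (2 * rs_theta t)) * cnj (osc t n) * (osc t k * cnj (osc t m)) =
        of_real (w n k m) * cis (- (2 * rs_theta t) + t * ln (real n) + (- (t * ln (real k)) + t * ln (real m)))"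
      by (simp add: osc_def w_def cis_cnj cis_mult)
    also have "- (2 * rs_theta t) + t * ln (real n) + (- (t * ln (real k)) + t * ln (real m)) =
        - (1 * (t * ln (t / (2 * pi)) - t) - (ln (real n) - ln (real k) + ln (real m)) * t + (- pi / 4))"
      by (simp add: rs_theta_def field_simps)
    finally show ?thesis by (simp only: f2_def cis_cnj)
  qed
  have prod: "(\<Sum>n\<in>{1..N}. x n) * ((\<Sum>k\<in>{1..M}. y k) * (\<Sum>m\<in>{1..M}. z m)) = (\<Sum>n\<in>{1..N}. \<Sum>k\<in>{1..M}. \<Sum>m\<in>{1..M}. x n * (y k * z m))"
    for x y z :: "nat \<Rightarrow> complex"
    by (rule triple_sum_product)
  have e1: "A t * (D t * cnj (D t)) = (\<Sum>n\<in>{1..N}. \<Sum>k\<in>{1..M}. \<Sum>m\<in>{1..M}. of_real (w n k m) * f1 n k m t)" for t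
    unfolding A_def D_def zeta_poly_def cnj_sum prod by (intro sum.cong refl t1) auto
  have e2: "cis (- (2 * rs_theta t)) * cnj (A t) * (D t * cnj (D t)) = (\<Sum>n\<in>{1..N}. \<Sum>k\<in>{1..M}. \<Sum>m\<in>{1..M}. of_real (w n k m) * cnj (f2 n k m t))" for t
    unfolding A_def D_def zeta_poly_def cnj_sum sum_distrib_left[of "cis (- (2 * rs_theta t))"] prod by (intro sum.cong refl t2)
  have int3: "integral {a..b} (\<lambda>t. \<Sum>n\<in>{1..N}. \<Sum>k\<in>{1..M}. \<Sum>m\<in>{1..M}. of_real (w n k m) * f n k m t) = 
     (\<Sum>n\<in>{1..N}. \<Sum>k\<in>{1..M}. \<Sum>m\<in>{1..M}. of_real (w n k m) * integral {a..b} (f n k m))"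
    if cf: "\<And>n k m. continuous_on {a..b} (f n k m)" for f :: "nat \<Rightarrow> nat \<Rightarrow> nat \<Rightarrow> real \<Rightarrow> complex"
  proof -
    have "integral {a..b} (\<lambda>t. \<Sum>n\<in>{1..N}. 1 * (\<Sum>k\<in>{1..M}. 1 * (\<Sum>m\<in>{1..M}. of_real (w n k m) * f n k m t))) = 
      (\<Sum>n\<in>{1..N}. 1 * integral {a..b} (\<lambda>t. \<Sum>k\<in>{1..M}. 1 * (\<Sum>m\<in>{1..M}. of_real (w n k m) * f n k m t)))"
      by (rule integral_weighted_sum) (simp, intro continuous_intros cf)
    also have "\<dots> = (\<Sum>n\<in>{1..N}. 1 * (\<Sum>k\<in>{1..M}. 1 * integral {a..b} (\<lambda>t. \<Sum>m\<in>{1..M}. of_real (w n k m) * f n k m t)))"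
      by (intro sum.cong refl arg_cong[of _ _ "(*) 1"] integral_weighted_sum) (simp, intro continuous_intros cf)
    also have "\<dots> = (\<Sum>n\<in>{1..N}. 1 * (\<Sum>k\<in>{1..M}. 1 * (\<Sum>m\<in>{1..M}. of_real (w n k m) * integral {a..b} (f n k m))))"
      by (intro sum.cong refl arg_cong[of _ _ "(*) 1"] integral_weighted_sum) (simp, rule cf)
    finally show ?thesis by (simp only: mult_1)
  qed
  \<comment> \<open>The weight of the diagonal \<open>n k = m\<close>, where nothing oscillates.\<close>
  define S0 where "S0 = (\<Sum>n\<in>{1..N}. \<Sum>k\<in>{1..M}. \<Sum>m\<in>{1..M}. if n * k = m then w n k m else 0)"
  have T1: "norm (integral {a..b} (\<lambda>t. A t * (D t * cnj (D t))) - of_real ((b - a) * S0)) \<le> 32 * sqrt (real N) * real M ^ 2"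
  proof -
    define u :: "nat \<Rightarrow> nat \<Rightarrow> nat \<Rightarrow> complex" where
      "u = (\<lambda>n k m. of_real (w n k m) * integral {a..b} (f1 n k m) - of_real ((b - a) * (if n * k = m then w n k m else 0)))"
    have u_le: "norm (u n k m) \<le> w n k m * (4 * real M)"
      if nkm: "n \<in> {1..N}" "k \<in> {1..M}" "m \<in> {1..M}" for n k m
    proof (cases "n * k = m")
      case True
      have "f1 n k m = (\<lambda>t. 1)" unfolding f1_def True by simp
      hence "u n k m = 0"
        using True ab by (simp add: u_def scaleR_conv_of_real)
      thus ?thesis using w0 by simp
    next
      case False
      have "norm (integral {a..b} (f1 n k m)) \<le> 4 * real M" unfolding f1_def
        using nkm False by (intro pure_phase_gap a0 ab M) auto
      hence "w n k m * norm (integral {a..b} (f1 n k m)) \<le> w n k m * (4 * real M)" by (intro mult_left_mono w0)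
      thus ?thesis using False w0 by (simp add: u_def norm_mult)
    qed
    have "integral {a..b} (\<lambda>t. A t * (D t * cnj (D t))) - of_real ((b - a) * S0) = 
       (\<Sum>n\<in>{1..N}. \<Sum>k\<in>{1..M}. \<Sum>m\<in>{1..M}. u n k m)"
      unfolding e1 int3[of f1, OF cf1] S0_def u_def by (simp only: sum_subtractf sum_distrib_left of_real_sum)
    also have "norm \<dots> \<le> (\<Sum>n\<in>{1..N}. \<Sum>k\<in>{1..M}. \<Sum>m\<in>{1..M}. w n k m * (4 * real M))"
      by (intro sum_norm_le u_le)
    also have "\<dots> = (\<Sum>n\<in>{1..N}. \<Sum>k\<in>{1..M}. \<Sum>m\<in>{1..M}. w n k m) * (4 * real M)"
      by (simp only: sum_distrib_right)
    also have "\<dots> \<le> (8 * sqrt (real N) * real M) * (4 * real M)" by (intro mult_right_mono sumw) auto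
    finally show ?thesis by (simp add: power2_eq_square mult_ac)
  qed
  have T2: "norm (integral {a..b} (\<lambda>t. cis (- (2 * rs_theta t)) * cnj (A t) * (D t * cnj (D t)))) \<le> 16 * sqrt (real N) * real M ^ 2"
  proof -
    have "integral {a..b} (\<lambda>t. cis (- (2 * rs_theta t)) * cnj (A t) * (D t * cnj (D t))) = 
       (\<Sum>n\<in>{1..N}. \<Sum>k\<in>{1..M}. \<Sum>m\<in>{1..M}. of_real (w n k m) * integral {a..b} (\<lambda>t. cnj (f2 n k m t)))"
      unfolding e2 by (rule int3) (intro continuous_intros cf2)
    also have "norm \<dots> \<le> (\<Sum>n\<in>{1..N}. \<Sum>k\<in>{1..M}. \<Sum>m\<in>{1..M}. w n k m * 2)"
    proof (intro sum_norm_le)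
      fix n k m assume nkm: "n \<in> {1..N}" "k \<in> {1..M}" "m \<in> {1..M}"
      have "ln (real N ^ 2) \<le> ln (a / (2 * pi))" using a N0 by (intro ln_mono) auto
      hence 1: "2 * ln (real N) \<le> 1 * ln (a / (2 * pi))" using N0 by (simp add: ln_realpow)
      have 2: "ln (real n) \<le> ln (real N)" "ln (real m) \<le> ln (real M)" "ln (real k) \<ge> 0" using nkm by auto
      have "ln (exp 1 * real M) \<le> ln (real N)"
      proof (intro ln_mono)
        have "exp 1 * real M \<le> 3 * real M" using exp_le by (intro mult_right_mono) auto
        also have "\<dots> \<le> real N" using N by linarith
        finally show "exp 1 * real M \<le> real N" .
      qed (use M N0 in auto)
      hence "1 + ln (real M) \<le> ln (real N)" using M by (simp add: ln_mult)
      hence "norm (integral {a..b} (f2 n k m)) \<le> 2 / 1"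
        unfolding f2_def using 1 2 by (intro phase_integral a0 ab) linarith+
      hence "norm (integral {a..b} (\<lambda>t. cnj (f2 n k m t))) \<le> 2"
        unfolding Henstock_Kurzweil_Integration.integral_cnj[symmetric] by simp
      hence "w n k m * norm (integral {a..b} (\<lambda>t. cnj (f2 n k m t))) \<le> w n k m * 2" by (intro mult_left_mono w0)
      thus "norm (of_real (w n k m) * integral {a..b} (\<lambda>t. cnj (f2 n k m t))) \<le> w n k m * 2"
        using w0 by (simp add: norm_mult)
    qed
    also have "\<dots> = (\<Sum>n\<in>{1..N}. \<Sum>k\<in>{1..M}. \<Sum>m\<in>{1..M}. w n k m) * 2"
      by (simp only: sum_distrib_right)
    also have "\<dots> \<le> (8 * sqrt (real N) * real M) * 2" by (intro mult_right_mono sumw) auto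
    also have "\<dots> = 16 * sqrt (real N) * (real M * 1)" by simp
    also have "\<dots> \<le> 16 * sqrt (real N) * (real M * real M)" using M by (intro mult_left_mono) auto
    finally show ?thesis by (simp add: power2_eq_square)
  qed
  have S0: "S0 \<ge> (harm r)\<^sup>2"
  proof -
    have rM: "r \<le> M" using r by (metis le_square le_trans power2_eq_square)
    have rN: "r \<le> N" using rM N by linarith
    have "(harm r)\<^sup>2 = (\<Sum>n\<in>{1..r}. \<Sum>k\<in>{1..r}. 1 / (real n * real k))"
      unfolding harm_def power2_eq_square sum_product by (simp add: inverse_eq_divide)
    also have "\<dots> \<le> (\<Sum>n\<in>{1..r}. \<Sum>k\<in>{1..r}. \<Sum>m\<in>{1..M}. if n * k = m then w n k m else 0)"
    proof (intro sum_mono)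
      fix n k assume nk: "n \<in> {1..r}" "k \<in> {1..r}"
      have "n * k \<le> r * r" using nk by (intro mult_mono) auto
      hence "n * k \<in> {1..M}" using nk r by (auto simp: power2_eq_square)
      hence "(\<Sum>m\<in>{1..M}. if n * k = m then w n k m else 0) = w n k (n * k)" by (simp add: sum.delta')
      also have "\<dots> = (1 / (sqrt (real n) * sqrt (real n))) * (1 / (sqrt (real k) * sqrt (real k)))"
        unfolding w_def of_nat_mult real_sqrt_mult
        by (simp only: times_divide_eq_left times_divide_eq_right mult_1 divide_divide_eq_left mult_ac)
      also have "\<dots> = 1 / (real n * real k)" by simp
      finally show "1 / (real n * real k) \<le> (\<Sum>m\<in>{1..M}. if n * k = m then w n k m else 0)" by simp
    qed
    also have "\<dots> \<le> (\<Sum>n\<in>{1..N}. \<Sum>k\<in>{1..r}. \<Sum>m\<in>{1..M}. if n * k = m then w n k m else 0)"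
      using rN w0 by (intro sum_mono2 sum_nonneg) auto
    also have "\<dots> \<le> S0" unfolding S0_def
      using rM w0 by (intro sum_mono sum_mono2 sum_nonneg) auto
    finally show ?thesis .
  qed
  define X where "X = integral {a..b} (\<lambda>t. of_real (RS_Z N t) * cis (- rs_theta t) * (D t * cnj (D t)))"
  have contZ: "continuous_on {a..b} (\<lambda>t. of_real (RS_Z N t) * cis (- rs_theta t) * (D t * cnj (D t)))"
    by (intro continuous_intros continuous_on_RS_Z continuous_on_rs_theta cA a0)
  have "norm X \<le> integral {a..b} (\<lambda>t. V * (norm (zeta_poly M t))\<^sup>2)"
    unfolding X_def
  proof (rule Henstock_Kurzweil_Integration.integral_norm_bound_integral)
    show "(\<lambda>t. of_real (RS_Z N t) * cis (- rs_theta t) * (D t * cnj (D t))) integrable_on {a..b}"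
      by (intro integrable_continuous_interval contZ)
    show "(\<lambda>t. V * (norm (zeta_poly M t))\<^sup>2) integrable_on {a..b}"
      using cA(2) unfolding D_def by (intro integrable_continuous_interval continuous_intros)
    fix t assume t: "t \<in> {a..b}"
    have "norm (of_real (RS_Z N t) * cis (- rs_theta t) * (D t * cnj (D t))) = \<bar>RS_Z N t\<bar> * (norm (D t))\<^sup>2"
      by (simp add: norm_mult power2_eq_square)
    also have "\<dots> \<le> V * (norm (D t))\<^sup>2" by (intro mult_right_mono V t) auto
    finally show "norm (of_real (RS_Z N t) * cis (- rs_theta t) * (D t * cnj (D t))) \<le> V * (norm (zeta_poly M t))\<^sup>2"
      by (simp add: D_def)
  qed
  also have "\<dots> = V * integral {a..b} (\<lambda>t. (norm (zeta_poly M t))\<^sup>2)" by simp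
  also have "\<dots> \<le> V * ((b - a) * (1 + ln (real M)) + 16 * real M ^ 2)"
    by (intro mult_left_mono Dirichlet_polynomial_mean_square a0 ab M V0)
  finally have upper: "norm X \<le> V * ((b - a) * (1 + ln (real M)) + 16 * real M ^ 2)" .
  \<comment> \<open>Multiplying by \<open>cis (- rs_theta t)\<close> removes the phase from one of the two
  conjugate halves of \<open>Z\<close>.\<close>
  have Zc: "of_real (RS_Z N t) * cis (- rs_theta t) = A t + cis (- (2 * rs_theta t)) * cnj (A t)" for t
  proof -
    have "of_real (RS_Z N t) = cis (rs_theta t) * A t + cnj (cis (rs_theta t) * A t)"
      unfolding RS_Z_def A_def[symmetric] by (simp only: complex_add_cnj)
    also have "\<dots> * cis (- rs_theta t) = (cis (rs_theta t) * cis (- rs_theta t)) * A t + (cis (- rs_theta t) * cis (- rs_theta t)) * cnj (A t)"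
      by (simp add: algebra_simps cis_cnj)
    also have "\<dots> = A t + cis (- (2 * rs_theta t)) * cnj (A t)" by (simp add: cis_mult)
    finally show ?thesis .
  qed
  have "X = integral {a..b} (\<lambda>t. A t * (D t * cnj (D t)) + cis (- (2 * rs_theta t)) * cnj (A t) * (D t * cnj (D t)))"
    unfolding X_def Zc by (simp only: ring_distribs)
  also have "\<dots> = integral {a..b} (\<lambda>t. A t * (D t * cnj (D t))) + integral {a..b} (\<lambda>t. cis (- (2 * rs_theta t)) * cnj (A t) * (D t * cnj (D t)))"
    by (intro Henstock_Kurzweil_Integration.integral_add integrable_continuous_interval continuous_intros cA continuous_on_rs_theta a0)
  finally have X: "X - (integral {a..b} (\<lambda>t. A t * (D t * cnj (D t))) - of_real ((b - a) * S0))
      - integral {a..b} (\<lambda>t. cis (- (2 * rs_theta t)) * cnj (A t) * (D t * cnj (D t))) = of_real ((b - a) * S0)" by simp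
  have "(b - a) * S0 \<le> norm (of_real ((b - a) * S0) :: complex)"
    unfolding norm_of_real by (rule abs_ge_self)
  also have "\<dots> \<le> norm X + 32 * sqrt (real N) * real M ^ 2 + 16 * sqrt (real N) * real M ^ 2"
    by (rule order_trans[OF eq_refl[OF arg_cong[of _ _ norm, OF X[symmetric]]]])
       (intro order_trans[OF norm_triangle_ineq4 add_mono] T1 T2 order_refl)
  finally have "(b - a) * S0 - 48 * sqrt (real N) * real M ^ 2 \<le> norm X" by simp
  moreover have "(b - a) * (harm r)\<^sup>2 \<le> (b - a) * S0" using ab by (intro mult_left_mono S0) auto
  ultimately show ?thesis using upper by linarith
qed

section \<open>Points where S is close to the logarithm\<close>

text \<open>
  Every \<open>n < P\<close> has \<open>ln (P / n) > 0\<close>, so the quotient of the sine by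
  its argument tends to \<open>1\<close> in each of the finitely many terms.
\<close>

lemma S_tendsto_S_limit: "((\<lambda>U. S T U) \<longlongrightarrow> S_limit T) (at_right 0)"
proof -
  define P where "P = T / (2 * pi)"
  define D where "D = {n::nat. 0 < n \<and> real n < P}"
  define w where "w = (\<lambda>n. real (divisor_count n) / sqrt (real n))"
  define ph where "ph = (\<lambda>U n. (2 * pi * P + U / 2) * ln (P / real n) - 2 * pi * P - pi / 4)"
  have "((\<lambda>U. 2 * (\<Sum>n\<in>D. w n * (sin (U / 2 * ln (P / real n)) / (U / 2 * ln (P / real n))) * cos (ph U n)))
     \<longlongrightarrow> 2 * (\<Sum>n\<in>D. w n * 1 * cos (ph 0 n))) (at_right 0)"
    unfolding ph_def
  proof (intro tendsto_intros)
    fix n assume n: "n \<in> D"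
    define L where "L = ln (P / real n)"
    have "L > 0" unfolding L_def using n by (intro ln_gt_zero) (auto simp: D_def)
    have "((\<lambda>U. sin (U / 2 * L) / (U / 2 * L)) \<longlongrightarrow> 1) (at_right 0)"
      using \<open>L > 0\<close> by real_asymp
    thus "((\<lambda>U. sin (U / 2 * ln (P / real n)) / (U / 2 * ln (P / real n))) \<longlongrightarrow> 1) (at_right 0)"
      unfolding L_def .
  qed auto
  also have "(\<lambda>U. 2 * (\<Sum>n\<in>D. w n * (sin (U / 2 * ln (P / real n)) / (U / 2 * ln (P / real n))) * cos (ph U n))) = S T"
    unfolding S_def Let_def P_def D_def w_def ph_def by simp
  also have "2 * (\<Sum>n\<in>D. w n * 1 * cos (ph 0 n)) = S_limit T"
  proof -
    have "S_limit T = 2 * (\<Sum>n\<in>D. Re (omega T * (of_nat (divisor_count n) * osc T n)))"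
      unfolding S_limit_def P_def D_def sum_distrib_left Re_sum by simp
    also have "(\<Sum>n\<in>D. Re (omega T * (of_nat (divisor_count n) * osc T n))) = (\<Sum>n\<in>D. w n * 1 * cos (ph 0 n))"
    proof (intro sum.cong refl)
      fix n assume n: "n \<in> D"
      have T: "T = 2 * pi * P" by (simp add: P_def)
      have "omega T * (of_nat (divisor_count n) * osc T n) = of_real (w n) * (cis (T * ln P - T - pi / 4) * cis (- (T * ln (real n))))"
        unfolding omega_def osc_def w_def P_def[symmetric] by simp
      also have "cis (T * ln P - T - pi / 4) * cis (- (T * ln (real n))) = cis (ph 0 n)"
        unfolding cis_mult ph_def using n
        by (intro arg_cong[of _ _ cis]) (simp add: D_def ln_div T algebra_simps)
      finally show "Re (omega T * (of_nat (divisor_count n) * osc T n)) = w n * 1 * cos (ph 0 n)"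
        by (simp only: times_complex.sel Re_complex_of_real Im_complex_of_real cis.sel mult_1_right mult_zero_left diff_zero)
    qed
    finally show ?thesis by simp
  qed
  finally show ?thesis .
qed

text \<open>
  Consecutive squares near \<open>x / (2 pi)\<close> are farther apart than \<open>H / (2
  pi)\<close>, so the first or the second half of the window contains no value where the length
  of the main sum jumps.
\<close>

lemma window_in_square_gap:
  assumes x: "x \<ge> 1" and H: "0 < H" "H \<le> sqrt x"
  obtains N a where "x \<le> a" "a + H / 2 \<le> x + H" "real N ^ 2 < a / (2 * pi)" "(a + H / 2) / (2 * pi) \<le> (real N + 1)\<^sup>2"
proof -
  define N0 where "N0 = nat (\<lceil>sqrt (x / (2 * pi))\<rceil> - 1)"
  have pos: "sqrt (x / (2 * pi)) > 0" using x by simp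
  hence N0: "real N0 < sqrt (x / (2 * pi))" "sqrt (x / (2 * pi)) \<le> real N0 + 1" unfolding N0_def by linarith+
  have l: "real N0 ^ 2 < x / (2 * pi)"
  proof -
    have "real N0 ^ 2 < (sqrt (x / (2 * pi)))\<^sup>2" using N0 by (intro power_strict_mono) auto
    thus ?thesis using x by simp
  qed
  have u: "x / (2 * pi) \<le> (real N0 + 1)\<^sup>2"
  proof -
    have "(sqrt (x / (2 * pi)))\<^sup>2 \<le> (real N0 + 1)\<^sup>2" using N0 pos by (intro power_mono) auto
    thus ?thesis using x by simp
  qed
  show ?thesis
  proof (cases "(x + H / 2) / (2 * pi) \<le> (real N0 + 1)\<^sup>2")
    case True
    show ?thesis by (rule that[of x N0]) (use True l H in auto)
  next
    case False
    have "H / (2 * pi) \<le> sqrt x / (2 * pi)" using H by (intro divide_right_mono) auto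
    also have "\<dots> \<le> sqrt x / sqrt (2 * pi)"
    proof (intro divide_left_mono)
      show "sqrt (2 * pi) \<le> 2 * pi" using pi_gt3 by (intro real_le_lsqrt) (auto simp: power2_eq_square)
    qed (use x in auto)
    also have "\<dots> = sqrt (x / (2 * pi))" by (simp only: real_sqrt_divide)
    also have "\<dots> \<le> real N0 + 1" by (rule N0)
    finally have h: "H / (2 * pi) \<le> real N0 + 1" .
    have "(x + H / 2 + H / 2) / (2 * pi) = x / (2 * pi) + H / (2 * pi)" by (simp add: add_divide_distrib)
    also have "\<dots> \<le> (real N0 + 1)\<^sup>2 + (real N0 + 1)" using u h by linarith
    also have "\<dots> \<le> (real (N0 + 1) + 1)\<^sup>2" by (simp add: power2_eq_square algebra_simps)
    finally show ?thesis using False H by (intro that[of "x + H / 2" "N0 + 1"]) (auto simp: add.commute)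
  qed
qed


text \<open>
  On half of the window the main sum has constant length and is continuous. It takes a value of
  modulus above \<open>sqrt (ln x)\<close>, since \<open>RS_Z_large_value_bound\<close> with
  \<open>V = sqrt (ln x)\<close> is absurd, and because of its small integral it takes values
  on the other side of \<open>sqrt (ln x)\<close> or \<open>- sqrt (ln x)\<close>.
\<close>

lemma eventually_RS_Z_squared_eq_ln:
  "eventually (\<lambda>x. \<exists>N t. N \<ge> 4 \<and> x \<le> t \<and> t \<le> x + x powr (1/3) \<and> 
      real N ^ 2 < t / (2 * pi) \<and> t / (2 * pi) \<le> (real N + 1)\<^sup>2 \<and> (RS_Z N t)\<^sup>2 = ln x) at_top"
proof -
  have ev: 
    "eventually (\<lambda>x::real. x \<ge> 1) at_top"
    "eventually (\<lambda>x::real. x powr (1/100) \<ge> 2) at_top"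
    "eventually (\<lambda>x::real. x powr (1/3) \<le> sqrt x) at_top"
    "eventually (\<lambda>x::real. 3 * x powr (1/50) + 20 \<le> sqrt (x / 8) - 1) at_top"
    "eventually (\<lambda>x::real. 2 * (4 * x powr (1/4) + 2 * x powr (1/4) * (1 + ln x)) \<le> x powr (1/3) / 2 / 2) at_top"
    "eventually (\<lambda>x::real. 48 * x powr (1/4) * x powr (1/25) \<le> x powr (1/3) / 2) at_top"
    "eventually (\<lambda>x::real. 16 * x powr (1/25) \<le> x powr (1/3) / 2) at_top"
    "eventually (\<lambda>x::real. sqrt (ln x) * (2 + ln x / 50) < (ln x / 100)\<^sup>2 - 1) at_top"
    "eventually (\<lambda>x::real. sqrt (ln x) \<ge> 2) at_top"
    by real_asymp+
  show ?thesis
    using ev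
  proof eventually_elim
    case (elim x)
    define h where "h = x powr (1/3) / 2"
    have h: "h > 0" using elim(1) by (simp add: h_def)
    obtain N a where Na: "x \<le> a" "a + h \<le> x + x powr (1/3)" "real N ^ 2 < a / (2 * pi)" "(a + h) / (2 * pi) \<le> (real N + 1)\<^sup>2"
    proof -
      have "0 < x powr (1/3)" using elim(1) by simp
      from window_in_square_gap[OF elim(1) this elim(3)] show ?thesis using that unfolding h_def by blast
    qed
    define b where "b = a + h"
    have ab: "a \<le> b" "b - a = h" using h by (auto simp: b_def)
    have a0: "a > 0" using Na elim(1) by linarith
    have a2x: "a \<le> 2 * x"
    proof -
      have "x powr (1/3) \<le> x powr 1" using elim(1) by (intro powr_mono) auto
      thus ?thesis using Na h elim(1) by simp
    qed
    have range: "real N ^ 2 < t / (2 * pi)" "t / (2 * pi) \<le> (real N + 1)\<^sup>2" if "t \<in> {a..b}" for t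
    proof -
      have "a / (2 * pi) \<le> t / (2 * pi)" "t / (2 * pi) \<le> (a + h) / (2 * pi)" 
        using that by (auto intro!: divide_right_mono simp: b_def)
      thus "real N ^ 2 < t / (2 * pi)" "t / (2 * pi) \<le> (real N + 1)\<^sup>2" using Na by linarith+
    qed
    have Nx: "real N \<le> sqrt x"
    proof -
      have "a / (2 * pi) \<le> a / 2" using a0 pi_gt3 by (intro divide_left_mono) auto
      hence "real N ^ 2 \<le> x" using Na a2x by linarith
      thus ?thesis by (rule real_le_rsqrt)
    qed
    have sqrtN: "sqrt (real N) \<le> x powr (1/4)"
    proof -
      have "sqrt (real N) \<le> sqrt (sqrt x)" using Nx by simp
      also have "sqrt (sqrt x) = x powr (1/4)" using elim(1) by (simp add: powr_half_sqrt[symmetric] powr_powr)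
      finally show ?thesis .
    qed
    have lnN: "ln (real N) \<le> ln x" if "N \<ge> 1"
    proof -
      have "sqrt x \<le> x" using elim(1) by (intro real_le_lsqrt) (auto simp: power2_eq_square)
      thus ?thesis using Nx that by (intro ln_mono) auto
    qed
    have N_ge: "real N \<ge> sqrt (x / 8) - 1"
    proof -
      have "x / 8 \<le> a / (2 * pi)" using Na a0 elim(1) pi_less_4 by (intro frac_le) auto
      also have "\<dots> \<le> (real N + 1)\<^sup>2" using range[of a] ab by simp
      finally have "sqrt (x / 8) \<le> real N + 1" by (intro real_le_lsqrt) auto
      thus ?thesis by simp
    qed
    have N20: "N \<ge> 20" 
    proof -
      have "real N \<ge> 20" using N_ge elim(4) powr_ge_zero[of x "1/50"] by linarith
      thus ?thesis by simp
    qed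
    \<comment> \<open>With \<open>M = r^2 \<le> x^(1/50)\<close> the error terms of size \<open>sqrt N M^2 \<le>
    x^(1/4 + 1/25)\<close> are small against the window, as \<open>1/4 + 1/25 < 1/3\<close>.\<close>
    define r where "r = nat \<lfloor>x powr (1/100)\<rfloor>"
    define M where "M = r ^ 2"
    have r: "real r \<le> x powr (1/100)" "x powr (1/100) \<le> real r + 1" "r \<ge> 1"
      using elim(2) unfolding r_def by linarith+
    have M: "real M \<le> x powr (1/50)"
    proof -
      have "real M \<le> (x powr (1/100)) ^ 2" unfolding M_def of_nat_power using r by (intro power_mono) auto
      also have "\<dots> = x powr (1/50)" using elim(1) by (simp add: power2_eq_square powr_add[symmetric])
      finally show ?thesis .
    qed
    have M2: "real M ^ 2 \<le> x powr (1/25)"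
    proof -
      have "real M ^ 2 \<le> (x powr (1/50)) ^ 2" using M by (intro power_mono) auto
      also have "\<dots> = x powr (1/25)" using elim(1) by (simp add: power2_eq_square powr_add[symmetric])
      finally show ?thesis .
    qed
    have M1: "M \<ge> 1" using r(3) by (simp add: M_def)
    have NM: "N \<ge> 3 * M"
    proof -
      have "3 * real M \<le> real N" using M N_ge elim(4) by linarith
      thus ?thesis by linarith
    qed
    have cont: "continuous_on {a..b} (RS_Z N)" by (rule continuous_on_RS_Z[OF a0])
    have "\<exists>t\<in>{a..b}. \<bar>RS_Z N t\<bar> > sqrt (ln x)"
    proof (rule ccontr)
      assume "\<not> ?thesis"
      hence V: "\<bar>RS_Z N t\<bar> \<le> sqrt (ln x)" if "t \<in> {a..b}" for t using that by (meson not_le)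
      have "(b - a) * (harm r)\<^sup>2 - 48 * sqrt (real N) * real M ^ 2 \<le> sqrt (ln x) * ((b - a) * (1 + ln (real M)) + 16 * real M ^ 2)"
        by (rule RS_Z_large_value_bound[OF NM Na(3) ab(1) M1 _ V]) (simp_all add: M_def)
      also have "\<dots> = sqrt (ln x) * (h * (1 + ln (real M)) + 16 * real M ^ 2)"
        unfolding ab(2) ..
      also have "\<dots> \<le> sqrt (ln x) * (h * (1 + ln x / 50) + h)"
      proof (intro mult_left_mono add_mono)
        have "ln (real M) \<le> ln (x powr (1/50))" using M M1 by (intro ln_mono) auto
        thus "ln (real M) \<le> ln x / 50" using elim(1) by (simp add: ln_powr)
        show "16 * (real M)\<^sup>2 \<le> h" using M2 elim(7) unfolding h_def by linarith
      qed (use ab h elim(1) in auto)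
      finally have 1: "h * (harm r)\<^sup>2 - 48 * sqrt (real N) * real M ^ 2 \<le> sqrt (ln x) * (h * (1 + ln x / 50) + h)"
        unfolding ab(2) .
      have "48 * sqrt (real N) * real M ^ 2 \<le> 48 * x powr (1/4) * x powr (1/25)"
        using sqrtN M2 by (intro mult_mono) auto
      also have "\<dots> \<le> h" using elim(6) unfolding h_def .
      finally have 2: "48 * sqrt (real N) * real M ^ 2 \<le> h" .
      have "ln x / 100 \<le> harm r"
      proof -
        have "ln x / 100 = ln (x powr (1/100))" using elim(1) by (simp add: ln_powr)
        also have "\<dots> \<le> ln (real r + 1)" using r elim(1) by (intro ln_mono) auto
        also have "\<dots> \<le> harm r" by (rule ln_le_harm)
        finally show ?thesis .
      qed
      hence "(ln x / 100)\<^sup>2 \<le> (harm r)\<^sup>2" using elim(1) by (intro power_mono) auto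
      hence "h * (ln x / 100)\<^sup>2 \<le> h * (harm r)\<^sup>2" using h by (intro mult_left_mono) auto
      hence "h * ((ln x / 100)\<^sup>2 - 1) \<le> h * (sqrt (ln x) * (2 + ln x / 50))"
        using 1 2 by (simp add: algebra_simps)
      hence "(ln x / 100)\<^sup>2 - 1 \<le> sqrt (ln x) * (2 + ln x / 50)" using h by (simp add: mult_le_cancel_left)
      thus False using elim(8) by linarith
    qed
    then obtain t2 where t2: "t2 \<in> {a..b}" "\<bar>RS_Z N t2\<bar> > sqrt (ln x)" by blast
    have "\<bar>integral {a..b} (RS_Z N)\<bar> \<le> h"
    proof -
      have "\<bar>integral {a..b} (RS_Z N)\<bar> \<le> 2 * ((b - a) / sqrt (real N) + (4 * sqrt (real N) + 2 * sqrt (real N) * (1 + ln (real N))))"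
        by (rule RS_Z_integral_bound[OF _ Na(3) ab(1)]) (use N20 in simp)
      also have "\<dots> = 2 * (h / sqrt (real N)) + 2 * (4 * sqrt (real N) + 2 * sqrt (real N) * (1 + ln (real N)))"
        unfolding ab(2) by simp
      also have "\<dots> \<le> 2 * (h / 4) + 2 * (4 * x powr (1/4) + 2 * x powr (1/4) * (1 + ln x))"
      proof (intro add_mono mult_left_mono mult_mono)
        have "sqrt 16 \<le> sqrt (real N)" using N20 by (intro real_sqrt_le_mono) simp
        thus "h / sqrt (real N) \<le> h / 4" using h N20 by (intro divide_left_mono) auto
      qed (use sqrtN lnN N20 elim(1) in auto)
      also have "\<dots> \<le> h" using elim(5) unfolding h_def by simp
      finally show ?thesis .
    qed
    note I = this
    have int: "RS_Z N integrable_on {a..b}" by (intro integrable_continuous_interval cont)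
    have low: "\<exists>t\<in>{a..b}. RS_Z N t \<le> 2"
    proof (rule ccontr)
      assume "\<not> ?thesis"
      hence "2 \<le> RS_Z N t" if "t \<in> {a..b}" for t using that by (meson linear)
      hence "integral {a..b} (\<lambda>_. 2) \<le> integral {a..b} (RS_Z N)"
        by (intro integral_le int integrable_const_ivl)
      thus False using I h ab by simp
    qed
    have high: "\<exists>t\<in>{a..b}. RS_Z N t \<ge> - 2"
    proof (rule ccontr)
      assume "\<not> ?thesis"
      hence "RS_Z N t \<le> - 2" if "t \<in> {a..b}" for t using that by (meson linear)
      hence "integral {a..b} (RS_Z N) \<le> integral {a..b} (\<lambda>_. - 2)"
        by (intro integral_le int integrable_const_ivl)
      thus False using I h ab by simp
    qed
    have conn: "connected (RS_Z N ` {a..b})" by (intro connected_continuous_image cont) auto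
    have "\<exists>t\<in>{a..b}. (RS_Z N t)\<^sup>2 = ln x"
    proof (cases "RS_Z N t2 > 0")
      case True
      obtain t1 where t1: "t1 \<in> {a..b}" "RS_Z N t1 \<le> 2" using low by blast
      have "RS_Z N t1 \<le> sqrt (ln x)" "sqrt (ln x) \<le> RS_Z N t2"
        using t1(2) t2(2) True elim(9) by linarith+
      hence "sqrt (ln x) \<in> RS_Z N ` {a..b}"
        by (rule connectedD_interval[OF conn imageI[OF t1(1)] imageI[OF t2(1)]])
      then obtain t where t: "sqrt (ln x) = RS_Z N t" "t \<in> {a..b}" by (rule imageE)
      have "(RS_Z N t)\<^sup>2 = ln x" unfolding t(1)[symmetric] using elim(1) by simp
      thus ?thesis using t(2) by blast
    next
      case False
      obtain t1 where t1: "t1 \<in> {a..b}" "RS_Z N t1 \<ge> - 2" using high by blast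
      have "RS_Z N t2 \<le> - sqrt (ln x)" "- sqrt (ln x) \<le> RS_Z N t1"
        using t1(2) t2(2) False elim(9) by linarith+
      hence "- sqrt (ln x) \<in> RS_Z N ` {a..b}"
        by (rule connectedD_interval[OF conn imageI[OF t2(1)] imageI[OF t1(1)]])
      then obtain t where t: "- sqrt (ln x) = RS_Z N t" "t \<in> {a..b}" by (rule imageE)
      have "(RS_Z N t)\<^sup>2 = ln x" unfolding t(1)[symmetric] using elim(1) by simp
      thus ?thesis using t(2) by blast
    qed
    then obtain t where t: "t \<in> {a..b}" "(RS_Z N t)\<^sup>2 = ln x" by blast
    have "x \<le> t" "t \<le> x + x powr (1/3)" using t Na by (auto simp: b_def)
    moreover have "N \<ge> 4" using N20 by linarith
    ultimately show ?case using t(2) range[OF t(1)] by blast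
  qed
qed

lemma eventually_S_limit_near_ln:
  "eventually (\<lambda>x. \<exists>t. x \<le> t \<and> t \<le> x + x powr (1/3) \<and> \<bar>S_limit t - ln x\<bar> \<le> 4008) at_top"
  using eventually_RS_Z_squared_eq_ln
proof eventually_elim
  case (elim x)
  then obtain N t where "N \<ge> 4" "x \<le> t" "t \<le> x + x powr (1/3)" 
      "real N ^ 2 < t / (2 * pi)" "t / (2 * pi) \<le> (real N + 1)\<^sup>2" "(RS_Z N t)\<^sup>2 = ln x" by blast
  moreover from this have "\<bar>S_limit t - ln x\<bar> \<le> 4008" using S_limit_approx_RS_Z_squared[of N t] by simp
  ultimately show ?case by blast
qed


lemma eventually_S_near_ln:
  "eventually (\<lambda>x. \<exists>t c. x \<le> t \<and> t \<le> x + x powr (1/3) \<and> 0 < c \<and>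
      (\<forall>u\<in>{0<..<c}. \<bar>S t u - ln x\<bar> \<le> 4009)) at_top"
  using eventually_S_limit_near_ln
proof eventually_elim
  case (elim x)
  then obtain t where t: "x \<le> t" "t \<le> x + x powr (1/3)" "\<bar>S_limit t - ln x\<bar> \<le> 4008" by blast
  have "eventually (\<lambda>u. dist (S t u) (S_limit t) < 1) (at_right 0)"
    using tendstoD[OF S_tendsto_S_limit, of 1 t] by simp
  then obtain c where c: "c > 0" "\<And>u. 0 < u \<Longrightarrow> u < c \<Longrightarrow> \<bar>S t u - S_limit t\<bar> < 1"
    unfolding eventually_at_right_field dist_real_def by blast
  have "\<bar>S t u - ln x\<bar> \<le> 4009" if "u \<in> {0<..<c}" for u
    using c(2)[of u] that t(3) by simp
  thus ?case using t(1,2) c(1) by blast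
qed

section \<open>The continuum of solutions\<close>

text \<open>
  A sequence of sets of naturals is coded as one set of pairs of naturals.
\<close>

lemma real_sequences_lepoll_real: "(UNIV :: (nat \<Rightarrow> real) set) \<lesssim> (UNIV :: real set)"
proof -
  obtain g :: "real \<Rightarrow> nat set" where g: "inj g"
    using nat_sets_eqpoll_reals eqpoll_sym eqpoll_imp_lepoll unfolding lepoll_def by blast
  define h :: "(nat \<Rightarrow> real) \<Rightarrow> nat set" where "h = (\<lambda>f. {prod_encode (k, m) | k m. m \<in> g (f k)})"
  have "inj h"
  proof (rule injI)
    fix f1 f2 assume eq: "h f1 = h f2"
    have mem: "m \<in> g (f k) \<longleftrightarrow> prod_encode (k, m) \<in> h f" for f k m
      by (auto simp: h_def)
    have "g (f1 k) = g (f2 k)" for k unfolding set_eq_iff mem eq by blast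
    thus "f1 = f2" using injD[OF g] by blast
  qed
  hence "(UNIV :: (nat \<Rightarrow> real) set) \<lesssim> (UNIV :: nat set set)"
    unfolding lepoll_def by blast
  thus ?thesis using nat_sets_eqpoll_reals lepoll_trans eqpoll_imp_lepoll by blast
qed

text \<open>
  Two sequences are interleaved into one.
\<close>

lemma pairs_of_real_sequences_lepoll_real: "(UNIV :: ((nat \<Rightarrow> real) \<times> (nat \<Rightarrow> real)) set) \<lesssim> (UNIV :: real set)"
proof -
  define h :: "(nat \<Rightarrow> real) \<times> (nat \<Rightarrow> real) \<Rightarrow> nat \<Rightarrow> real" where
    "h = (\<lambda>(f, g) n. if even n then f (n div 2) else g (n div 2))"
  have "inj h"
  proof (rule injI)
    fix p q assume eq: "h p = h q"
    obtain f g f' g' where pq: "p = (f, g)" "q = (f', g')" by (cases p, cases q)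
    have "f n = f' n" for n using fun_cong[OF eq, of "2 * n"] by (simp add: h_def pq)
    moreover have "g n = g' n" for n using fun_cong[OF eq, of "Suc (2 * n)"] by (simp add: h_def pq)
    ultimately show "p = q" unfolding pq by auto
  qed
  hence "(UNIV :: ((nat \<Rightarrow> real) \<times> (nat \<Rightarrow> real)) set) \<lesssim> (UNIV :: (nat \<Rightarrow> real) set)"
    unfolding lepoll_def by blast
  thus ?thesis using real_sequences_lepoll_real lepoll_trans by blast
qed

text \<open>
  Since \<open>T x\<close> lies between \<open>x\<close> and \<open>2 x\<close>, its logarithm
  is within \<open>1\<close> of \<open>ln x\<close>, so the quotient is within \<open>(C + 1) /
  ln x\<close> of \<open>1\<close>.
\<close>

lemma AAS_family_asymp_equiv:
  fixes T U :: "real \<Rightarrow> real"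
  assumes "\<And>x. x \<ge> T\<^sub>1 \<Longrightarrow> x \<le> T x \<and> T x \<le> 2 * x \<and> \<bar>S (T x) (U x) - ln x\<bar> \<le> C"
  shows "(\<lambda>x. S (T x) (U x) / ln (T x)) \<sim>[at_top] (\<lambda>_. 1)"
proof (rule asymp_equivI')
  have "((\<lambda>x. S (T x) (U x) / ln (T x) - 1) \<longlongrightarrow> 0) at_top"
  proof (rule Lim_null_comparison)
    show "((\<lambda>x. (C + 1) / ln x) \<longlongrightarrow> 0) at_top" by real_asymp
    show "eventually (\<lambda>x. norm (S (T x) (U x) / ln (T x) - 1) \<le> (C + 1) / ln x) at_top"
      using eventually_ge_at_top[of T\<^sub>1] eventually_gt_at_top[of 1]
    proof eventually_elim
      case (elim x)
      note x = assms[OF elim(1)]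
      have lnx: "ln x > 0" using elim by simp
      have ln1: "ln x \<le> ln (T x)" using x elim by (intro ln_mono) auto
      have "ln (T x) \<le> ln (2 * x)" using x elim by (intro ln_mono) auto
      also have "\<dots> = ln 2 + ln x" using elim by (simp add: ln_mult)
      also have "\<dots> \<le> 1 + ln x" using ln_2_less_1 by simp
      finally have "\<bar>S (T x) (U x) - ln (T x)\<bar> \<le> C + 1" using x ln1 by linarith
      hence "\<bar>S (T x) (U x) - ln (T x)\<bar> / ln (T x) \<le> (C + 1) / ln x"
        using lnx ln1 by (intro frac_le) auto
      moreover have "S (T x) (U x) / ln (T x) - 1 = (S (T x) (U x) - ln (T x)) / ln (T x)"
        using lnx ln1 by (simp add: diff_divide_distrib)
      ultimately show ?case using lnx ln1 by (simp add: abs_divide)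
    qed
  qed
  hence "((\<lambda>x. S (T x) (U x) / ln (T x)) \<longlongrightarrow> 1) at_top" by (simp only: LIM_zero_iff)
  thus "((\<lambda>x. S (T x) (U x) / ln (T x) / 1) \<longlongrightarrow> 1) at_top" by simp
qed

text \<open>
  For each large \<open>T0\<close> one point \<open>t T0\<close> is paired with an interval of
  values of \<open>U\<close>. For the first claim, changing the first member of the
  \<open>U\<close>-sequence already gives a continuum of solutions, and there are no more pairs
  of real sequences than reals.
\<close>

theorem theorem1:
  "\<exists>\<epsilon>\<^sub>0>0. \<exists>\<eta>\<^sub>0>0. \<forall>\<epsilon> \<eta> :: real. 0 < \<epsilon> \<and> \<epsilon> < \<epsilon>\<^sub>0 \<and> 0 < \<eta> \<and> \<eta> < \<eta>\<^sub>0 \<longrightarrow>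
     {(T, U). \<exists>T0. is_AAS \<eta> \<epsilon> 1 T0 T U} \<approx> (UNIV :: real set) \<and>
     (\<exists>(A :: real \<Rightarrow> (real \<times> real) set) T\<^sub>1. T\<^sub>1 > 0 \<and>
        (\<forall>T0\<ge>T\<^sub>1. A T0 \<subseteq> admissible_pairs \<epsilon> T0 \<and> A T0 \<approx> (UNIV :: real set)) \<and>
        (\<forall>T U :: real \<Rightarrow> real. (\<forall>T0\<ge>T\<^sub>1. (T T0, U T0) \<in> A T0) \<longrightarrow>
           (\<lambda>T0. S (T T0) (U T0) / ln (T T0)) \<sim>[at_top] (\<lambda>_. 1) \<and>
           (\<forall>X :: nat \<Rightarrow> real. (\<forall>k. X k \<ge> T\<^sub>1) \<and> filterlim X at_top sequentially \<longrightarrow>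
              is_AAS \<eta> \<epsilon> 1 X (T \<circ> X) (U \<circ> X))))"
  (is "\<exists>\<epsilon>\<^sub>0>0. \<exists>\<eta>\<^sub>0>0. \<forall>\<epsilon> \<eta>. _ \<longrightarrow> ?claim \<epsilon> \<eta>")
proof (rule exI[of _ 1], rule conjI[OF zero_less_one], rule exI[of _ 1], rule conjI[OF zero_less_one], intro allI impI)
  fix \<epsilon> \<eta> :: real
  assume \<epsilon>\<eta>: "0 < \<epsilon> \<and> \<epsilon> < 1 \<and> 0 < \<eta> \<and> \<eta> < 1"
  have "eventually (\<lambda>x. x \<ge> 1 \<and> (\<exists>t c. x \<le> t \<and> t \<le> x + x powr (1/3) \<and> 0 < c \<and>
      (\<forall>u\<in>{0<..<c}. \<bar>S t u - ln x\<bar> \<le> 4009))) at_top"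
    by (intro eventually_conj eventually_ge_at_top eventually_S_near_ln)
  then obtain T\<^sub>1 where ex: "\<And>x. x \<ge> T\<^sub>1 \<Longrightarrow> x \<ge> 1 \<and> (\<exists>t c. x \<le> t \<and> t \<le> x + x powr (1/3) \<and> 0 < c \<and>
      (\<forall>u\<in>{0<..<c}. \<bar>S t u - ln x\<bar> \<le> 4009))"
    unfolding eventually_at_top_linorder by blast
  then obtain t c where tc: "\<And>x. x \<ge> T\<^sub>1 \<Longrightarrow> x \<le> t x" "\<And>x. x \<ge> T\<^sub>1 \<Longrightarrow> t x \<le> x + x powr (1/3)" 
    "\<And>x. x \<ge> T\<^sub>1 \<Longrightarrow> 0 < c x" "\<And>x u. x \<ge> T\<^sub>1 \<Longrightarrow> u \<in> {0<..<c x} \<Longrightarrow> \<bar>S (t x) u - ln x\<bar> \<le> 4009"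
    by metis
  have ge1: "x \<ge> 1" if "x \<ge> T\<^sub>1" for x using ex that by blast
  define d where "d = (\<lambda>x. min (c x) (x powr (1/6 - \<epsilon> / 2)))"
  have d: "d x > 0" if "x \<ge> T\<^sub>1" for x using tc(3)[OF that] ge1[OF that] by (simp add: d_def)
  define A where "A = (\<lambda>x. {t x} \<times> {0<..<d x})"
  have sub: "A x \<subseteq> admissible_pairs \<epsilon> x" if x: "x \<ge> T\<^sub>1" for x
  proof -
    have "x powr (1/3) \<le> x powr (1/3 + 2 * \<epsilon>)" using ge1[OF x] \<epsilon>\<eta> by (intro powr_mono) auto
    also have "\<dots> \<le> 1.1 * x powr (1/3 + 2 * \<epsilon>)" by simp
    finally have "t x \<in> {x..x + 1.1 * U0 \<epsilon> x}" using tc(1,2)[OF x] by (simp add: U0_def)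
    thus ?thesis by (auto simp: A_def admissible_pairs_def d_def)
  qed
  have card: "A x \<approx> (UNIV :: real set)" if x: "x \<ge> T\<^sub>1" for x
  proof -
    have "bij_betw snd (A x) {0<..<d x}" by (rule bij_betwI[of _ _ _ "\<lambda>u. (t x, u)"]) (auto simp: A_def)
    hence "A x \<approx> {0<..<d x}" unfolding eqpoll_def by blast
    thus ?thesis using open_interval_eqpoll_reals[of 0 "d x"] d[OF x] eqpoll_trans by blast
  qed
  have asymp: "(\<lambda>T0. S (T T0) (U T0) / ln (T T0)) \<sim>[at_top] (\<lambda>_. 1)"
    if TU: "\<forall>T0\<ge>T\<^sub>1. (T T0, U T0) \<in> A T0" for T U :: "real \<Rightarrow> real"
  proof (rule AAS_family_asymp_equiv[where C = 4009])
    fix x assume x: "x \<ge> T\<^sub>1"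
    have "(T x, U x) \<in> A x" using TU x by blast
    hence T: "T x = t x" and U: "U x \<in> {0<..<c x}" by (auto simp: A_def d_def)
    have "x powr (1/3) \<le> x powr 1" using ge1[OF x] by (intro powr_mono) auto
    hence "t x \<le> 2 * x" using tc(2)[OF x] ge1[OF x] by simp
    thus "x \<le> T x \<and> T x \<le> 2 * x \<and> \<bar>S (T x) (U x) - ln x\<bar> \<le> 4009"
      unfolding T using tc(1)[OF x] tc(4)[OF x U] by blast
  qed
  have AAS: "is_AAS \<eta> \<epsilon> 1 X (T \<circ> X) (U \<circ> X)"
    if TU: "\<forall>T0\<ge>T\<^sub>1. (T T0, U T0) \<in> A T0" and X: "\<forall>k. X k \<ge> T\<^sub>1" "filterlim X at_top sequentially"
    for T U and X :: "nat \<Rightarrow> real"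
  proof -
    have "(\<lambda>k. S (T (X k)) (U (X k)) / ln (T (X k))) \<sim>[sequentially] (\<lambda>k. 1)"
      using asymp_equiv_compose'[OF asymp[OF TU] X(2)] .
    hence "(\<lambda>_. 1) \<sim>[sequentially] (\<lambda>k. S ((T \<circ> X) k) ((U \<circ> X) k) / ln ((T \<circ> X) k))"
      unfolding o_def by (rule asymp_equiv_symI)
    moreover have "X k > 0" for k using ge1[of "X k"] X(1) by (meson less_le_trans zero_less_one)
    moreover have "((T \<circ> X) k, (U \<circ> X) k) \<in> admissible_pairs \<epsilon> (X k)" for k
      using sub[of "X k"] TU X(1) by auto
    ultimately show ?thesis using X(2) unfolding is_AAS_def by blast
  qed
  have all: "{(T, U). \<exists>T0. is_AAS \<eta> \<epsilon> 1 T0 T U} \<approx> (UNIV :: real set)"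
  proof (rule lepoll_antisym)
    show "{(T, U). \<exists>T0. is_AAS \<eta> \<epsilon> 1 T0 T U} \<lesssim> (UNIV :: real set)"
      using lepoll_trans[OF subset_imp_lepoll[OF subset_UNIV] pairs_of_real_sequences_lepoll_real] .
    define X where "X = (\<lambda>k. T\<^sub>1 + real k)"
    have X: "\<forall>k. X k \<ge> T\<^sub>1" "filterlim X at_top sequentially"
      unfolding X_def by (simp, real_asymp)
    \<comment> \<open>Only the member at \<open>T\<^sub>1\<close> depends on \<open>u\<close>; all other members
    are chosen once and for all.\<close>
    define U where "U = (\<lambda>u x. if x = T\<^sub>1 then u else d x / 2)"
    define f where "f = (\<lambda>u. (t \<circ> X, U u \<circ> X))"
    have "inj_on f {0<..<d T\<^sub>1}"
    proof (rule inj_onI)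
      fix u v assume "f u = f v"
      hence "(U u \<circ> X) 0 = (U v \<circ> X) 0" unfolding f_def by simp
      thus "u = v" by (simp add: U_def X_def)
    qed
    moreover have "f ` {0<..<d T\<^sub>1} \<subseteq> {(T, U). \<exists>T0. is_AAS \<eta> \<epsilon> 1 T0 T U}"
    proof
      fix p assume "p \<in> f ` {0<..<d T\<^sub>1}"
      then obtain u where u: "u \<in> {0<..<d T\<^sub>1}" "p = f u" by blast
      have "\<forall>x\<ge>T\<^sub>1. (t x, U u x) \<in> A x"
        using u(1) d by (auto simp: A_def U_def)
      hence "is_AAS \<eta> \<epsilon> 1 X (t \<circ> X) (U u \<circ> X)" by (rule AAS[OF _ X])
      thus "p \<in> {(T, U). \<exists>T0. is_AAS \<eta> \<epsilon> 1 T0 T U}" unfolding u(2) f_def by blast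
    qed
    ultimately have "{0<..<d T\<^sub>1} \<lesssim> {(T, U). \<exists>T0. is_AAS \<eta> \<epsilon> 1 T0 T U}" unfolding lepoll_def by blast
    moreover have "(UNIV :: real set) \<approx> {0<..<d T\<^sub>1}"
      using open_interval_eqpoll_reals[of 0 "d T\<^sub>1"] d[of T\<^sub>1] eqpoll_sym by blast
    ultimately show "(UNIV :: real set) \<lesssim> {(T, U). \<exists>T0. is_AAS \<eta> \<epsilon> 1 T0 T U}"
      using lepoll_trans1 by blast
  qed
  have "T\<^sub>1 > 0" using ge1[of T\<^sub>1] by simp
  show "?claim \<epsilon> \<eta>"
    using all \<open>T\<^sub>1 > 0\<close> sub card asymp AAS
    by (intro conjI all exI[of _ A] exI[of _ T\<^sub>1] allI impI) blast+
qed

end
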